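(* Let $m,n$ be positive integers with $\gcd(m,n)=1$ and let $\mathbb{H}_{m/n}=\{(z_1,z_2)\in\mathbb{C}^2:|z_1|^{m/n}<|z_2|<1\}$. For each $p$ with $2\le p<\infty$, the sub-Bergman projection $\widetilde{\mathbf{B}^p}:L^p(\mathbb{H}_{m/n})\to A^p(\mathbb{H}_{m/n})$ satisfies (i) $\big|\widetilde{\mathbf{B}^p}\big|$ is bounded on $L^p(\mathbb{H}_{m/n})$; (ii) $\widetilde{\mathbf{B}^p}h=h$ for all $h\in A^p(\mathbb{H}_{m/n})$.
   Context: $A^p(\Omega)$ is the Bergman space of holomorphic functions on $\Omega$ lying in $L^p(\Omega)$ (Lebesgue measure $dV$). For a bounded domain $\Omega$ and $p\ge2$, let $G^{2,p}(\Omega)$ be the closure of $A^p(\Omega)$ in $A^2(\Omega)$ (with respect to the $L^2$ norm). The $L^p$ sub-Bergman projection $\widetilde{\mathbf{B}^p}$ is the orthogonal projection of $L^2(\Omega)$ onto $G^{2,p}(\Omega)$; its representing kernel is denoted $\widetilde{B^p}(z,w)$, so $\widetilde{\mathbf{B}^p}f(z)=\int_\Omega\widetilde{B^p}(z,w)f(w)\,dV(w)$. For $\Omega=\mathbb{H}_{m/n}$ (a bounded Reinhardt domain) it is $\widetilde{B^p}(z,w)=\sum_{\alpha}\frac{z^\alpha\overline{w^\alpha}}{\|z^\alpha\|_{2}^2}$, the sum over all $\alpha\in\mathbb{Z}^2$ such that the monomial $z^\alpha$ belongs to $A^p(\mathbb{H}_{m/n})$. The operator $\big|\widetilde{\mathbf{B}^p}\big|$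 is defined by $\big|\widetilde{\mathbf{B}^p}\big|f(z)=\int_\Omega\big|\widetilde{B^p}(z,w)\big|f(w)\,dV(w)$. *)

theory Defs
  imports "HOL-Analysis.Analysis"
begin

text \<open>Functions on a set \<open>\<Omega>\<close> in \<open>\<complex>\<^sup>2\<close> are total functions
  \<^typ>\<open>complex \<times> complex \<Rightarrow> complex\<close> of which only the values on \<open>\<Omega>\<close> matter.\<close>

definition hartogs :: "nat \<Rightarrow> nat \<Rightarrow> (complex \<times> complex) set" where
  "hartogs m n = {(z1, z2). cmod z1 powr (real m / real n) < cmod z2 \<and> cmod z2 < 1}"

text \<open>Complex Frechet differentiability; \<open>a\<close> and \<open>b\<close> are the two complex partial derivatives.\<close>

definition holomorphic2_on :: "(complex \<times> complex \<Rightarrow> complex) \<Rightarrow> (complex \<times> complex) set \<Rightarrow> bool" where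
  "holomorphic2_on f \<Omega> \<longleftrightarrow>
     (\<forall>z\<in>\<Omega>. \<exists>a b. (f has_derivative (\<lambda>h. a * fst h + b * snd h)) (at z within \<Omega>))"

definition Lp :: "(complex \<times> complex) set \<Rightarrow> real \<Rightarrow> (complex \<times> complex \<Rightarrow> complex) set" where
  "Lp \<Omega> p = {f. f \<in> borel_measurable (lebesgue_on \<Omega>) \<and>
                 integrable (lebesgue_on \<Omega>) (\<lambda>z. cmod (f z) powr p)}"

definition Lp_norm :: "(complex \<times> complex) set \<Rightarrow> real \<Rightarrow> (complex \<times> complex \<Rightarrow> complex) \<Rightarrow> real" where
  "Lp_norm \<Omega> p f = (\<integral>z. cmod (f z) powr p \<partial>lebesgue_on \<Omega>) powr (1 / p)"

definition bergman_space :: "(complex \<times> complex) set \<Rightarrow> real \<Rightarrow> (complex \<times> complex \<Rightarrow> complex) set" where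
  "bergman_space \<Omega> p = {f \<in> Lp \<Omega> p. holomorphic2_on f \<Omega>}"

definition G2 :: "(complex \<times> complex) set \<Rightarrow> real \<Rightarrow> (complex \<times> complex \<Rightarrow> complex) set" where
  "G2 \<Omega> p = {g \<in> bergman_space \<Omega> 2.
     \<forall>\<epsilon>>0. \<exists>h\<in>bergman_space \<Omega> p. Lp_norm \<Omega> 2 (\<lambda>z. g z - h z) < \<epsilon>}"

text \<open>Orthogonal projection of \<open>L\<^sup>2(\<Omega>)\<close> onto \<open>G2 \<Omega> p\<close>. A holomorphic representative is determined
  by its class on the open set \<open>\<Omega>\<close>; the value 0 outside \<open>\<Omega>\<close> only serves to make it unique as a
  total function.\<close>

definition sub_bergman_proj ::
  "(complex \<times> complex) set \<Rightarrow> real \<Rightarrow> (complex \<times> complex \<Rightarrow> complex) \<Rightarrow> complex \<times> complex \<Rightarrow> complex" where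
  "sub_bergman_proj \<Omega> p f = (THE g. g \<in> G2 \<Omega> p \<and> (\<forall>z. z \<notin> \<Omega> \<longrightarrow> g z = 0) \<and>
     (\<forall>h\<in>G2 \<Omega> p. (\<integral>z. (f z - g z) * cnj (h z) \<partial>lebesgue_on \<Omega>) = 0))"

text \<open>The representing kernel. The integral formula fixes \<open>K(z, \<cdot>)\<close> only up to null sets;
  requiring its conjugate to lie in \<open>G2 \<Omega> p\<close> (Riesz representation of \<open>g \<mapsto> g z\<close> on that
  space) selects the antiholomorphic representative.\<close>

definition sub_bergman_kernel ::
  "(complex \<times> complex) set \<Rightarrow> real \<Rightarrow> complex \<times> complex \<Rightarrow> complex \<times> complex \<Rightarrow> complex" where
  "sub_bergman_kernel \<Omega> p z = (THE k. (\<lambda>w. cnj (k w)) \<in> G2 \<Omega> p \<and> (\<forall>w. w \<notin> \<Omega> \<longrightarrow> k w = 0) \<and>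
     (\<forall>f\<in>Lp \<Omega> 2. sub_bergman_proj \<Omega> p f z = (\<integral>w. k w * f w \<partial>lebesgue_on \<Omega>)))"

definition abs_sub_bergman_op ::
  "(complex \<times> complex) set \<Rightarrow> real \<Rightarrow> (complex \<times> complex \<Rightarrow> complex) \<Rightarrow> complex \<times> complex \<Rightarrow> complex" where
  "abs_sub_bergman_op \<Omega> p f z =
     (\<integral>w. of_real (cmod (sub_bergman_kernel \<Omega> p z w)) * f w \<partial>lebesgue_on \<Omega>)"

definition bounded_on_Lp ::
  "(complex \<times> complex) set \<Rightarrow> real \<Rightarrow>
   ((complex \<times> complex \<Rightarrow> complex) \<Rightarrow> complex \<times> complex \<Rightarrow> complex) \<Rightarrow> bool" where
  "bounded_on_Lp \<Omega> p T \<longleftrightarrow>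
     (\<exists>C. \<forall>f\<in>Lp \<Omega> p. T f \<in> Lp \<Omega> p \<and> Lp_norm \<Omega> p (T f) \<le> C * Lp_norm \<Omega> p f)"

end

theory Submission
  imports Defs "HOL-Complex_Analysis.Complex_Analysis"
begin

text \<open>
  The monomials in \<open>A\<^sup>p\<close> are the \<open>z\<^sub>1\<^sup>a z\<^sub>2\<^sup>b\<close> with \<open>a \<ge> 0\<close> and \<open>n a + m b > -2 (m + n) / p\<close>. Splitting \<open>a\<close>
  by residues modulo \<open>m\<close>, the monomial series of the kernel sums to a rational function of
  \<open>t = z\<^sub>2 cnj w\<^sub>2\<close> and \<open>u = (z\<^sub>1 cnj w\<^sub>1)\<^sup>m / t\<^sup>n\<close>, which is dominated by
  \<open>\<bar>t\<bar>\<^sup>\<kappa> / (\<bar>1 - u\<bar>\<^sup>2 \<bar>1 - t\<bar>\<^sup>2)\<close> with \<open>\<kappa> p > -2 (m + n) / m\<close>. Integrating out the angles replaces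
  \<open>1 / \<bar>1 - u\<bar>\<^sup>2\<close> by \<open>1 / (1 - \<bar>u\<bar>\<^sup>2)\<close>, and Schur's test with an explicit weight gives boundedness on \<open>L\<^sup>q\<close>
  for \<open>q = 2\<close> and \<open>q = p\<close>. That the kernel reproduces \<open>A\<^sup>p\<close> follows from the Laurent expansion: averaging
  over rotations shows that \<open>L\<^sup>p\<close>-integrability kills all the other coefficients. Orthogonality and density of
  bounded functions then identify the integral operator with the projection onto \<open>G2\<close>.
\<close>

subsection \<open>Radial and angular integration in the plane\<close>

text \<open>The obstacle is the boundary point (0, 0): near it a monomial with a negative power of
  \<open>z2\<close> can be square integrable without being p-th power integrable, and a kernel
  containing such a monomial does not map \<open>L^p\<close> into itself. Dropping these monomials
  does not spoil the closed form, because multiplication by z1^m / z2^n preserves n a + m b, so that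
  the admissible exponents (a, b) are invariant under the shift by (m, -n). The slice of the domain
  at \<open>z2\<close> has area proportional to |z2|^(2 n / m), so the inequality \<kappa> p + 2 n /
  m > -2 says exactly that |z2|^\<kappa> is p-th power integrable. In Schur's test it reappears as
  convergence at \<open>z2 = 0\<close> of one of the two weighted integrals; the other one needs it
  for the exponent 2 only, which is weaker as \<kappa> \<le> 0. The case q = 2 is wanted because the
  projection is defined on \<open>L^2\<close>: it makes the double integrals absolutely convergent
  and controls the distance to the images of bounded functions. All estimates are made for Borel
  functions, where Fubini's theorem applies directly, and carried over to Lebesgue measurable
  functions at the end.\<close>

lemma lborel_complex: "(lborel :: complex measure) = distr (lborel \<Otimes>\<^sub>M lborel) borel (\<lambda>(x, y). Complex x y)"
proof (rule lborel_eqI)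
  have [measurable]: "(\<lambda>(x, y). Complex x y) \<in> borel_measurable (lborel \<Otimes>\<^sub>M lborel)"
    by (auto simp: lborel_prod complex_eq_iff case_prod_beta Complex_eq intro!: borel_measurable_continuous_onI continuous_intros)
  fix l u :: complex assume lu: "\<And>b. b \<in> Basis \<Longrightarrow> l \<bullet> b \<le> u \<bullet> b"
  then have *: "Re l \<le> Re u" "Im l \<le> Im u" using lu[of 1] lu[of \<i>] by (auto simp: Basis_complex_def inner_complex_def)
  have "(\<lambda>(x, y). Complex x y) -` box l u \<inter> space (lborel \<Otimes>\<^sub>M lborel) = {Re l<..<Re u} \<times> {Im l<..<Im u}"
    by (auto simp: box_def Basis_complex_def inner_complex_def space_pair_measure)
  then show "emeasure (distr (lborel \<Otimes>\<^sub>M lborel) borel (\<lambda>(x, y). Complex x y)) (box l u) = (\<Prod>b\<in>Basis. (u - l) \<bullet> b)"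
    using * by (subst emeasure_distr) (auto simp: lborel.emeasure_pair_measure_Times Basis_complex_def inner_complex_def ennreal_mult')
qed auto

text \<open>This order of integration and the opposite one in the next lemma are both needed: a
  horizontal shear is a translation of the inner variable only if the real part is integrated first,
  a vertical one only if the imaginary part is.\<close>

lemma nn_integral_lborel_complex:
  assumes [measurable]: "F \<in> borel_measurable borel"
  shows "(\<integral>\<^sup>+z. F z \<partial>lborel) = (\<integral>\<^sup>+y. \<integral>\<^sup>+x. F (Complex x y) \<partial>lborel \<partial>lborel)"
proof -
  have [measurable]: "(\<lambda>(x, y). Complex x y) \<in> borel_measurable (lborel \<Otimes>\<^sub>M lborel)"
    by (auto simp: lborel_prod complex_eq_iff case_prod_beta Complex_eq intro!: borel_measurable_continuous_onI continuous_intros)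
  show ?thesis
    by (subst lborel_complex, subst nn_integral_distr, simp, simp)
       (subst lborel_pair.nn_integral_snd[symmetric], simp_all add: case_prod_beta)
qed

lemma nn_integral_lborel_complex':
  assumes [measurable]: "F \<in> borel_measurable borel"
  shows "(\<integral>\<^sup>+z. F z \<partial>lborel) = (\<integral>\<^sup>+x. \<integral>\<^sup>+y. F (Complex x y) \<partial>lborel \<partial>lborel)"
proof -
  have [measurable]: "(\<lambda>(x, y). Complex x y) \<in> borel_measurable (lborel \<Otimes>\<^sub>M lborel)"
    by (auto simp: lborel_prod complex_eq_iff case_prod_beta Complex_eq intro!: borel_measurable_continuous_onI continuous_intros)
  show ?thesis
    by (subst lborel_complex, subst nn_integral_distr, simp, simp)
       (subst lborel.nn_integral_fst[symmetric], simp_all add: case_prod_beta)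
qed

text \<open>With the untouched coordinate frozen, a shear is a translation of the other one, so
  one-dimensional translation invariance suffices. The term \<open>1 * x\<close> gives the integrand
  the shape of the affine substitution rule.\<close>

lemma nn_integral_shear:
  assumes [measurable]: "F \<in> borel_measurable borel"
  shows "(\<integral>\<^sup>+z. F (z + of_real (t * Im z)) \<partial>lborel) = (\<integral>\<^sup>+z. F z \<partial>lborel)"
    and "(\<integral>\<^sup>+z. F (z + \<i> * of_real (t * Re z)) \<partial>lborel) = (\<integral>\<^sup>+z. F z \<partial>lborel)"
proof -
  have C: "Complex x y + of_real (t * y) = Complex (t * y + 1 * x) y" 
      "Complex x y + \<i> * of_real (t * x) = Complex x (t * x + 1 * y)" for x y
    by (auto simp: complex_eq_iff)
  have M: "(\<lambda>x. Complex x y) \<in> borel_measurable borel" "(\<lambda>x. Complex y x) \<in> borel_measurable borel" for y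
    by (auto simp: Complex_eq intro!: borel_measurable_continuous_onI continuous_intros)
  have "(\<integral>\<^sup>+z. F (z + of_real (t * Im z)) \<partial>lborel) = (\<integral>\<^sup>+y. \<integral>\<^sup>+x. F (Complex (t * y + 1 * x) y) \<partial>lborel \<partial>lborel)"
    by (subst nn_integral_lborel_complex, measurable) (simp only: C complex.sel)
  also have "\<dots> = (\<integral>\<^sup>+y. \<integral>\<^sup>+x. F (Complex x y) \<partial>lborel \<partial>lborel)"
  proof -
    have "(\<integral>\<^sup>+x. F (Complex (t * y + 1 * x) y) \<partial>lborel) = (\<integral>\<^sup>+x. F (Complex x y) \<partial>lborel)" for y
      using nn_integral_real_affine[of "\<lambda>x. F (Complex x y)" 1 "t * y"] measurable_compose[OF M(1) assms] by simp
    then show ?thesis by simp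
  qed
  finally show "(\<integral>\<^sup>+z. F (z + of_real (t * Im z)) \<partial>lborel) = (\<integral>\<^sup>+z. F z \<partial>lborel)"
    by (simp add: nn_integral_lborel_complex)
  have "(\<integral>\<^sup>+z. F (z + \<i> * of_real (t * Re z)) \<partial>lborel) = (\<integral>\<^sup>+y. \<integral>\<^sup>+x. F (Complex y (t * y + 1 * x)) \<partial>lborel \<partial>lborel)"
    by (subst nn_integral_lborel_complex', measurable) (simp only: C complex.sel)
  also have "\<dots> = (\<integral>\<^sup>+y. \<integral>\<^sup>+x. F (Complex y x) \<partial>lborel \<partial>lborel)"
  proof -
    have "(\<integral>\<^sup>+x. F (Complex y (t * y + 1 * x)) \<partial>lborel) = (\<integral>\<^sup>+x. F (Complex y x) \<partial>lborel)" for y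
      using nn_integral_real_affine[of "\<lambda>x. F (Complex y x)" 1 "t * y"] measurable_compose[OF M(2) assms] by simp
    then show ?thesis by simp
  qed
  finally show "(\<integral>\<^sup>+z. F (z + \<i> * of_real (t * Re z)) \<partial>lborel) = (\<integral>\<^sup>+z. F z \<partial>lborel)"
    by (simp add: nn_integral_lborel_complex')
qed

text \<open>A rotation other than \<open>\<plusminus>1\<close> is a product of three shears.\<close>

lemma nn_integral_rotate:
  assumes [measurable]: "F \<in> borel_measurable borel" and c: "cmod c = 1"
  shows "(\<integral>\<^sup>+z. F (c * z) \<partial>lborel) = (\<integral>\<^sup>+z. F z \<partial>lborel)"
proof -
  have *: "(\<integral>\<^sup>+z. F (c * z) \<partial>lborel) = (\<integral>\<^sup>+z. F z \<partial>lborel)" 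
    if c: "cmod c = 1" "Im c \<noteq> 0" and [measurable]: "F \<in> borel_measurable borel" for c F
  proof -
    \<comment> \<open>For c = exp(i \<theta>) this is -tan(\<theta> / 2); shears with the factors t,
      sin \<theta>, t compose to the rotation by \<theta>. The formula needs
      \<open>Im c \<noteq> 0\<close>.\<close>
    define t where "t = - (1 - Re c) / Im c"
    have n: "(Re c)\<^sup>2 + (Im c)\<^sup>2 = 1" using c(1) by (simp add: cmod_def)
    let ?X = "\<lambda>z. z + complex_of_real (t * Im z)" and ?Y = "\<lambda>z. z + \<i> * complex_of_real (Im c * Re z)"
    have t: "t * Im c = Re c - 1" using c by (simp add: t_def)
    have "c * z = ?X (?Y (?X z))" for z
    proof (rule complex_eqI)
      have i: "Im (?Y (?X z)) = Im c * Re z + Re c * Im z"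
        using t by (simp add: algebra_simps) (metis (no_types, opaque_lifting) add.commute add_diff_cancel_left' diff_add_cancel distrib_right mult.assoc mult.commute mult.left_commute mult.right_neutral mult_1)
      then show "Im (c * z) = Im (?X (?Y (?X z)))" by simp
      have tr: "t * (1 + Re c) = - Im c"
        using c n by (simp add: t_def field_simps power2_eq_square)
      have "Re (?X (?Y (?X z))) = Re z + t * Im z + t * (Im c * Re z + Re c * Im z)"
        unfolding i[symmetric] by simp
      also have "\<dots> = Re z * (1 + t * Im c) + Im z * (t * (1 + Re c))" by (simp add: algebra_simps)
      also have "\<dots> = Re (c * z)" by (simp add: t tr)
      finally show "Re (c * z) = Re (?X (?Y (?X z)))" by simp
    qed
    then have "(\<integral>\<^sup>+z. F (c * z) \<partial>lborel) = (\<integral>\<^sup>+z. F (?X (?Y (?X z))) \<partial>lborel)" by presburger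
    also have "\<dots> = (\<integral>\<^sup>+z. F (?X (?Y z)) \<partial>lborel)"
      by (rule nn_integral_shear(1)[of "\<lambda>z. F (?X (?Y z))"]) measurable
    also have "\<dots> = (\<integral>\<^sup>+z. F (?X z) \<partial>lborel)"
      by (rule nn_integral_shear(2)[of "\<lambda>z. F (?X z)"]) measurable
    also have "\<dots> = (\<integral>\<^sup>+z. F z \<partial>lborel)" by (rule nn_integral_shear(1)) measurable
    finally show ?thesis .
  qed
  show ?thesis
  proof (cases "Im c = 0")
    case True
    then have "c = 1 \<or> c = -1" using c by (metis Re_complex_of_real abs_1 abs_minus_cancel complex_eq_iff Im_complex_of_real abs_eq_iff cmod_eq_Re of_real_1 of_real_minus)
    \<comment> \<open>The rotation by -1 has vanishing imaginary part, so it is split into two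
      rotations by \<open>\<i>\<close>.\<close>
    moreover have "(\<integral>\<^sup>+z. F (- z) \<partial>lborel) = (\<integral>\<^sup>+z. F z \<partial>lborel)"
    proof -
      have "(\<integral>\<^sup>+z. F (- z) \<partial>lborel) = (\<integral>\<^sup>+z. F (\<i> * (\<i> * z)) \<partial>lborel)" by (simp add: mult.assoc[symmetric])
      also have "\<dots> = (\<integral>\<^sup>+z. F z \<partial>lborel)" by (subst *[of \<i> "\<lambda>z. F (\<i> * z)"]) (auto intro!: *)
      finally show ?thesis .
    qed
    ultimately show ?thesis by auto
  qed (use * c in auto)
qed

lemma distr_lborel_rotate: 
  assumes "cmod c = 1" shows "distr lborel borel ((*) c) = (lborel :: complex measure)"
proof (rule measure_eqI)
  fix A :: "complex set" assume "A \<in> sets (distr lborel borel ((*) c))"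
  then have [measurable]: "A \<in> sets borel" by simp
  have "emeasure (distr lborel borel ((*) c)) A = (\<integral>\<^sup>+z. indicator A z \<partial>distr lborel borel ((*) c))" by simp
  also have "\<dots> = (\<integral>\<^sup>+z. indicator A (c * z) \<partial>lborel)" by (subst nn_integral_distr) auto
  also have "\<dots> = (\<integral>\<^sup>+z. indicator A z \<partial>lborel)" by (rule nn_integral_rotate) (use assms in auto)
  finally show "emeasure (distr lborel borel ((*) c)) A = emeasure lborel A" by simp
qed simp

lemma integral_rotate:
  fixes F :: "complex \<Rightarrow> 'a::{banach, second_countable_topology}"
  assumes [measurable]: "F \<in> borel_measurable borel" and c: "cmod c = 1"
  shows "(\<integral>z. F (c * z) \<partial>lborel) = (\<integral>z. F z \<partial>lborel)"
    and "integrable lborel F \<Longrightarrow> integrable lborel (\<lambda>z. F (c * z))"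
proof -
  have "(\<integral>z. F z \<partial>lborel) = (\<integral>z. F z \<partial>distr lborel borel ((*) c))" by (simp add: distr_lborel_rotate c)
  also have "\<dots> = (\<integral>z. F (c * z) \<partial>lborel)" by (rule integral_distr) auto
  finally show "(\<integral>z. F (c * z) \<partial>lborel) = (\<integral>z. F z \<partial>lborel)" by simp
  assume "integrable lborel F"
  then have "integrable (distr lborel borel ((*) c)) F" by (simp add: distr_lborel_rotate c)
  then show "integrable lborel (\<lambda>z. F (c * z))" by (subst (asm) integrable_distr_eq) auto
qed

text \<open>The image of area under the squared modulus is \<pi> times Lebesgue measure on the half
  line, since the disc of squared radius a has area \<pi> a. The square makes the density constant,
  so it is enough to compare half lines, and no polar coordinates are set up.\<close>

lemma nn_integral_radial:
  assumes [measurable]: "\<phi> \<in> borel_measurable borel"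
  shows "(\<integral>\<^sup>+z. \<phi> ((cmod z)\<^sup>2) \<partial>lborel) = ennreal pi * (\<integral>\<^sup>+x. \<phi> x * indicator {0..} x \<partial>lborel)"
proof -
  let ?N = "density lborel (\<lambda>x::real. ennreal pi * indicator {0..} x)"
  have "distr lborel borel (\<lambda>z. (cmod z)\<^sup>2) = ?N"
  proof (rule measure_eqI_generator_eq[where \<Omega>=UNIV and A="\<lambda>i::nat. {..<real i}"])
    show "Int_stable (range (\<lambda>a::real. {..<a}))"
    proof (clarsimp simp: Int_stable_def)
      show "{..<a} \<inter> {..<b} \<in> range lessThan" for a b :: real
        by (rule image_eqI[where x="min a b"]) auto
    qed
    show "sets (distr lborel borel (\<lambda>z::complex. (cmod z)\<^sup>2)) = sigma_sets UNIV (range lessThan)" 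
      by (simp add: borel_Iio)
    show "sets ?N = sigma_sets UNIV (range lessThan)" by (simp add: borel_Iio)
    have e: "emeasure (distr lborel borel (\<lambda>z::complex. (cmod z)\<^sup>2)) {..<a} = ennreal (pi * max 0 a)" for a
    proof -
      have "(\<lambda>z::complex. (cmod z)\<^sup>2) -` {..<a} = (if a \<le> 0 then {} else ball 0 (sqrt a))"
        by (auto simp: real_less_rsqrt not_less) (meson order_trans not_less zero_le_power2, metis norm_ge_zero real_sqrt_less_iff real_sqrt_unique real_sqrt_pow2 not_less less_le_trans real_less_lsqrt abs_norm_cancel power2_less_imp_less real_sqrt_abs sqrt_le_D)
      then show ?thesis
        by (subst emeasure_distr) (auto simp: emeasure_ball unit_ball_vol_numeral max_def)
    qed
    fix X :: "real set" assume "X \<in> range lessThan"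
    then obtain a where X: "X = {..<a}" by auto
    have "emeasure ?N {..<a} = (\<integral>\<^sup>+x. ennreal pi * indicator {0..<a} x \<partial>lborel)"
      by (subst emeasure_density) (auto intro!: nn_integral_cong split: split_indicator)
    also have "\<dots> = ennreal (pi * max 0 a)"
      by (subst nn_integral_cmult) (auto simp: ennreal_mult max_def)
    finally show "emeasure (distr lborel borel (\<lambda>z::complex. (cmod z)\<^sup>2)) X = emeasure ?N X"
      unfolding X e by simp
  next
    show "(\<Union>i. {..<real i}) = UNIV" using reals_Archimedean2 by auto
    show "emeasure (distr lborel borel (\<lambda>z::complex. (cmod z)\<^sup>2)) {..<real i} \<noteq> \<infinity>" for i
    proof -
      have "(\<lambda>z::complex. (cmod z)\<^sup>2) -` {..<real i} \<subseteq> ball 0 (real i + 1)"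
        by (auto simp: power2_eq_square) (smt (verit, best) mult_le_cancel_left2 of_nat_0_le_iff mult_mono norm_ge_zero mult_less_cancel_left2)
      then have "emeasure lborel ((\<lambda>z::complex. (cmod z)\<^sup>2) -` {..<real i}) \<le> emeasure lborel (ball 0 (real i + 1) :: complex set)"
        by (intro emeasure_mono) auto
      also have "\<dots> < \<infinity>" by (simp add: emeasure_ball)
      finally show ?thesis by (subst emeasure_distr) auto
    qed
  qed auto
  then have "(\<integral>\<^sup>+x. \<phi> x \<partial>distr lborel borel (\<lambda>z::complex. (cmod z)\<^sup>2)) = (\<integral>\<^sup>+x. \<phi> x \<partial>?N)" by simp
  also have "\<dots> = (\<integral>\<^sup>+x. ennreal pi * (\<phi> x * indicator {0..} x) \<partial>lborel)"
    by (subst nn_integral_density) (auto intro!: nn_integral_cong simp: mult_ac)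
  also have "\<dots> = ennreal pi * (\<integral>\<^sup>+x. \<phi> x * indicator {0..} x \<partial>lborel)"
    by (rule nn_integral_cmult) measurable
  finally show ?thesis by (subst (asm) nn_integral_distr) auto
qed

text \<open>Cauchy's formula for the k-th derivative, applied on the unit circle to
  \<open>\<lambda>w. f (z * w)\<close>. Placing \<open>z\<close> inside the function instead of
  taking a circle through \<open>z\<close> covers \<open>z = 0\<close> as well.\<close>

lemma circle_mean_coeff:
  assumes f: "f holomorphic_on ball 0 R" and z: "cmod z < R"
  shows "(\<integral>t. f (exp (2 * of_real pi * \<i> * of_real t) * z) * cnj (exp (2 * of_real pi * \<i> * of_real t)) ^ k
     \<partial>restrict_space lborel {0..1}) = (deriv ^^ k) f 0 / fact k * z ^ k"
proof -
  define e where "e t = exp (2 * of_real pi * \<i> * of_real t)" for t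
  have e1: "cmod (e t) = 1" for t by (simp add: e_def norm_exp_eq_Re)
  have ece: "e t * cnj (e t) = 1" for t
    using complex_norm_square[of "e t"] e1[of t] by simp
  have conte: "continuous_on A e" for A unfolding e_def by (intro continuous_intros)
  define S where "S = {w. cmod (w * z) < R}"
  have S: "open S" unfolding S_def by (intro open_Collect_less continuous_intros)
  have S1: "cball 0 1 \<subseteq> S"
    using z by (auto simp: S_def norm_mult) (metis le_less_trans mult_left_le_one_le norm_ge_zero)
  define G where "G = (\<lambda>w. f (z * w))"
  have hG: "G holomorphic_on S" unfolding G_def
    by (intro holomorphic_on_compose_gen[OF _ f, unfolded o_def] holomorphic_intros) (auto simp: S_def mult.commute)
  have "((\<lambda>u. G u / (u - 0) ^ Suc k) has_contour_integral (2 * pi * \<i> / fact k * (deriv ^^ k) G 0)) (circlepath 0 1)"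
    by (rule Cauchy_has_contour_integral_higher_derivative_circlepath)
       (use S1 hG in \<open>auto intro!: holomorphic_on_imp_continuous_on intro: holomorphic_on_subset[OF hG order_trans[OF ball_subset_cball]]\<close>)
  then have "((\<lambda>t. G (e t) / e t ^ Suc k * (2 * pi * \<i> * e t)) has_integral (2 * pi * \<i> / fact k * (deriv ^^ k) G 0)) {0..1}"
    unfolding has_contour_integral_def
  proof (rule has_integral_eq[rotated])
    fix t :: real assume "t \<in> {0..1}"
    then have vd: "vector_derivative (circlepath 0 1) (at t within {0..1}) = 2 * pi * \<i> * e t"
      by (simp add: vector_derivative_circlepath01 e_def mult_ac)
    have c: "circlepath 0 1 t = e t" by (simp add: circlepath e_def)
    show "G (circlepath 0 1 t) / (circlepath 0 1 t - 0) ^ Suc k * vector_derivative (circlepath 0 1) (at t within {0..1})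
       = G (e t) / e t ^ Suc k * (2 * pi * \<i> * e t)" unfolding vd c by simp
  qed
  then have "((\<lambda>t. 1 / (2 * pi * \<i>) * (G (e t) / e t ^ Suc k * (2 * pi * \<i> * e t))) has_integral 1 / (2 * pi * \<i>) * (2 * pi * \<i> / fact k * (deriv ^^ k) G 0)) {0..1}"
    by (rule has_integral_mult_right)
  also have "(\<lambda>t. 1 / (2 * pi * \<i>) * (G (e t) / e t ^ Suc k * (2 * pi * \<i> * e t))) = (\<lambda>t. f (e t * z) * cnj (e t) ^ k)"
  proof
    fix t
    have "e t \<noteq> 0" by (simp add: e_def)
    then have "cnj (e t) = 1 / e t" using ece[of t] by (simp add: field_simps)
    then show "1 / (2 * pi * \<i>) * (G (e t) / e t ^ Suc k * (2 * pi * \<i> * e t)) = f (e t * z) * cnj (e t) ^ k"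
      using \<open>e t \<noteq> 0\<close> unfolding \<open>cnj (e t) = 1 / e t\<close> by (simp add: G_def field_simps)
  qed
  also have "(deriv ^^ k) G 0 = z ^ k * (deriv ^^ k) f 0"
    unfolding G_def by (subst higher_deriv_compose_linear[OF f S]) (use z le_less_trans[OF norm_ge_zero z] in \<open>auto simp: S_def mult.commute\<close>)
  finally have *: "((\<lambda>t. f (e t * z) * cnj (e t) ^ k) has_integral ((deriv ^^ k) f 0 / fact k * z ^ k)) {0..1}"
    by (simp add: field_simps)
  have "continuous_on {0..1} (\<lambda>t. f (e t * z) * cnj (e t) ^ k)"
    by (intro continuous_intros continuous_on_compose2[OF holomorphic_on_imp_continuous_on[OF f]] conte)
       (use z in \<open>auto simp: norm_mult e1\<close>)
  then have "set_integrable lborel {0..1} (\<lambda>t. f (e t * z) * cnj (e t) ^ k)"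
    by (rule borel_integrable_atLeastAtMost')
  from set_borel_integral_eq_integral(2)[OF this] integral_unique[OF *]
  have "(LBINT t:{0..1}. f (e t * z) * cnj (e t) ^ k) = (deriv ^^ k) f 0 / fact k * z ^ k" by simp
  then show ?thesis
    by (simp add: integral_restrict_space set_lebesgue_integral_def e_def)
qed

lemma borel_measurable_holomorphic_indicator:
  assumes "g holomorphic_on S" "open S"
  shows "(\<lambda>z. indicator S z * g z) \<in> borel_measurable borel"
proof -
  have "(\<lambda>z. indicator S z *\<^sub>R g z) = (\<lambda>z. indicator S z * g z)" by (auto simp: fun_eq_iff indicator_def)
  then show ?thesis
    using borel_measurable_continuous_on_indicator[of S g] assms by (simp add: holomorphic_on_imp_continuous_on)
qed

text \<open>Averaging over rotations isolates one Taylor coefficient.\<close>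

lemma integral_ball_coeff:
  fixes \<omega> :: "real \<Rightarrow> real"
  assumes g: "g holomorphic_on ball 0 R" and [measurable]: "\<omega> \<in> borel_measurable borel"
    and int: "integrable lborel (\<lambda>z. indicator (ball 0 R) z * (of_real (\<omega> (cmod z)) * g z * cnj z ^ k))"
  shows "(\<integral>z. indicator (ball 0 R) z * (of_real (\<omega> (cmod z)) * g z * cnj z ^ k) \<partial>lborel)
    = (deriv ^^ k) g 0 / fact k * of_real (\<integral>z. indicator (ball 0 R) z * (\<omega> (cmod z) * cmod z ^ (2 * k)) \<partial>lborel)"
proof -
  define e where "e t = exp (2 * of_real pi * \<i> * of_real t)" for t
  have e1 [simp]: "cmod (e t) = 1" for t by (simp add: e_def norm_exp_eq_Re)
  have e_meas[measurable]: "e \<in> borel_measurable borel" unfolding e_def by measurable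
  have *: "(\<lambda>z. indicator (ball 0 R) z * g z) \<in> borel_measurable borel"
    by (rule borel_measurable_holomorphic_indicator[OF g]) auto
  have "(\<lambda>z. of_real (\<omega> (cmod z)) * cnj z ^ k) \<in> borel_measurable borel"
    using borel_measurable_continuous_onI[of cnj] by measurable
  note M = borel_measurable_times[OF * this]
  define G where "G z = indicator (ball 0 R) z * g z * (of_real (\<omega> (cmod z)) * cnj z ^ k)" for z
  have Geq: "G = (\<lambda>z. indicator (ball 0 R) z * (of_real (\<omega> (cmod z)) * g z * cnj z ^ k))"
    by (auto simp: G_def mult_ac)
  have G[measurable]: "G \<in> borel_measurable borel" unfolding G_def by (rule M)
  have iG: "integrable lborel G" using int by (simp add: Geq)
  let ?T = "restrict_space lborel {0..1::real}"
  have [measurable]: "e \<in> borel_measurable ?T"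
    by (rule measurable_restrict_space1) (simp add: e_meas)
  interpret T: sigma_finite_measure ?T
    by (rule sigma_finite_measure_restrict_space) (auto intro: lborel.sigma_finite_measure_axioms)
  interpret P: pair_sigma_finite ?T "lborel :: complex measure" ..
  have mT: "measure ?T {0..1} = 1"
    by (simp add: measure_restrict_space)
  have int2: "integrable (?T \<Otimes>\<^sub>M lborel) (\<lambda>(t, z). G (e t * z))"
  proof (rule P.Fubini_integrable)
    show "(\<lambda>(t, z). G (e t * z)) \<in> borel_measurable (?T \<Otimes>\<^sub>M lborel)" by measurable
    \<comment> \<open>By rotation invariance the inner integral does not depend on t, so over the
      unit interval it is integrable as a constant.\<close>
    have "(\<integral>z. norm (G (e t * z)) \<partial>lborel) = (\<integral>z. norm (G z) \<partial>lborel)" for t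
      by (rule integral_rotate(1)[where F="\<lambda>z. norm (G z)"]) auto
    then show "integrable ?T (\<lambda>x. \<integral>y. norm (case (x, y) of (t, z) \<Rightarrow> G (e t * z)) \<partial>lborel)" 
      by (simp add: integrable_restrict_space)
    show "AE x in ?T. integrable lborel (\<lambda>y. case (x, y) of (t, z) \<Rightarrow> G (e t * z))"
      by (simp add: integral_rotate(2)[OF G _ iG])
  qed
  \<comment> \<open>The radial weight is constant along the circle through z, so integrating over
    the angle first leaves a single Taylor coefficient times
    \<open>\<omega> (cmod z) * cmod z ^ (2 * k)\<close>.\<close>
  have pt: "(\<integral>t. G (e t * z) \<partial>?T) = (deriv ^^ k) g 0 / fact k * of_real (indicator (ball 0 R) z * (\<omega> (cmod z) * cmod z ^ (2 * k)))" for z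
  proof (cases "cmod z < R")
    case True
    have "(\<integral>t. G (e t * z) \<partial>?T) = (\<integral>t. (of_real (\<omega> (cmod z)) * cnj z ^ k) * (g (e t * z) * cnj (e t) ^ k) \<partial>?T)"
      using True by (intro Bochner_Integration.integral_cong) (auto simp: G_def norm_mult power_mult_distrib mult_ac)
    also have "\<dots> = (of_real (\<omega> (cmod z)) * cnj z ^ k) * (\<integral>t. g (e t * z) * cnj (e t) ^ k \<partial>?T)"
      by simp
    also have "(\<integral>t. g (e t * z) * cnj (e t) ^ k \<partial>?T) = (deriv ^^ k) g 0 / fact k * z ^ k"
      unfolding e_def by (rule circle_mean_coeff[OF g True])
    also have "(of_real (\<omega> (cmod z)) * cnj z ^ k) * ((deriv ^^ k) g 0 / fact k * z ^ k)
       = (deriv ^^ k) g 0 / fact k * of_real (\<omega> (cmod z)) * (z * cnj z) ^ k"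
      by (simp add: power_mult_distrib mult_ac)
    also have "(z * cnj z) ^ k = of_real (cmod z ^ (2 * k))"
      by (simp add: complex_norm_square[symmetric] power_mult)
    finally show ?thesis using True by simp
  qed (simp add: G_def norm_mult)
  from P.Fubini_integral[OF int2]
  have "(\<integral>z. \<integral>t. G (e t * z) \<partial>?T \<partial>lborel) = (\<integral>t. \<integral>z. G (e t * z) \<partial>lborel \<partial>?T)" .
  also have "\<dots> = (\<integral>z. G z \<partial>lborel)"
    by (simp add: integral_rotate(1)[OF G] mT)
  finally have "(\<integral>z. G z \<partial>lborel) = (\<integral>z. \<integral>t. G (e t * z) \<partial>?T \<partial>lborel)" by simp
  also have "\<dots> = (deriv ^^ k) g 0 / fact k * of_real (\<integral>z. indicator (ball 0 R) z * (\<omega> (cmod z) * cmod z ^ (2 * k)) \<partial>lborel)"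
    by (simp only: pt integral_mult_right_zero integral_complex_of_real)
  finally show ?thesis by (simp add: Geq)
qed

subsection \<open>Schur's test\<close>

text \<open>The graph of the convex function x^q lies above its tangent at l. Young's inequality
  with exponents q and q / (q - 1) yields this up to x = 0, without differentiation.\<close>

lemma tangent_powr:
  fixes x l q :: real
  assumes "0 \<le> x" "0 < l" "1 < q"
  shows "l powr q + q * l powr (q - 1) * (x - l) \<le> x powr q"
proof -
  have "x * l powr (q - 1) \<le> x powr q / q + (l powr (q - 1)) powr (q / (q - 1)) / (q / (q - 1))"
    by (rule Youngs_inequality) (use assms in \<open>auto simp: field_simps\<close>)
  also have "(l powr (q - 1)) powr (q / (q - 1)) = l powr q"
    using assms by (simp add: powr_powr)
  finally have "q * (x * l powr (q - 1)) \<le> x powr q + (q - 1) * l powr q"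
    using assms by (simp add: field_simps)
  moreover have "l * l powr (q - 1) = l powr q"
    using assms by (simp add: powr_diff)
  ultimately show ?thesis by (simp add: algebra_simps)
qed

text \<open>Integrating the tangent inequality against k gives Jensen's inequality for the
  unnormalised weight k. Integrability of the product follows from g \<le> 1 + g^q.\<close>

lemma weighted_jensen:
  fixes k g :: "'a \<Rightarrow> real"
  assumes [measurable]: "k \<in> borel_measurable M" "g \<in> borel_measurable M"
    and k: "\<And>x. x \<in> space M \<Longrightarrow> 0 \<le> k x" and g: "\<And>x. x \<in> space M \<Longrightarrow> 0 \<le> g x" and q: "1 < q"
    and ik: "integrable M k" and ikg: "integrable M (\<lambda>x. k x * g x powr q)"
  shows "integrable M (\<lambda>x. k x * g x)"
    and "(\<integral>x. k x * g x \<partial>M) powr q \<le> (\<integral>x. k x \<partial>M) powr (q - 1) * (\<integral>x. k x * g x powr q \<partial>M)"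
proof -
  show int: "integrable M (\<lambda>x. k x * g x)"
  proof (rule Bochner_Integration.integrable_bound)
    show "integrable M (\<lambda>x. k x + k x * g x powr q)" by (intro Bochner_Integration.integrable_add ik ikg)
    have "k x * g x \<le> k x + k x * g x powr q" if "x \<in> space M" for x
    proof (cases "g x \<le> 1")
      case True
      then have "k x * g x \<le> k x * 1" by (intro mult_left_mono k that)
      then show ?thesis using k[OF that] by (simp add: add_increasing2)
    next
      case False
      then have "g x powr 1 \<le> g x powr q" using q by (intro powr_mono) auto
      then have "k x * g x \<le> k x * g x powr q" using False by (intro mult_left_mono k that) auto
      then show ?thesis using k[OF that] by simp
    qed
    then show "AE x in M. norm (k x * g x) \<le> norm (k x + k x * g x powr q)"
      using k g by (auto simp: abs_mult)
  qed measurable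
  define A where "A = (\<integral>x. k x \<partial>M)"
  define B where "B = (\<integral>x. k x * g x \<partial>M)"
  have A0: "0 \<le> A" unfolding A_def by (rule Bochner_Integration.integral_nonneg) (simp add: k)
  have B0: "0 \<le> B" unfolding B_def by (rule Bochner_Integration.integral_nonneg) (simp add: k g)
  have I0: "0 \<le> (\<integral>x. k x * g x powr q \<partial>M)" by (rule Bochner_Integration.integral_nonneg) (simp add: k)
  show "B powr q \<le> A powr (q - 1) * (\<integral>x. k x * g x powr q \<partial>M)"
  proof (cases "A = 0 \<or> B = 0")
    case True
    have "B = 0" if "A = 0"
    proof -
      have "AE x in M. k x = 0"
        using that integral_nonneg_eq_0_iff_AE[OF ik] k unfolding A_def by auto
      then have "B = (\<integral>x. 0 \<partial>M)" unfolding B_def by (intro integral_cong_AE) auto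
      then show ?thesis by simp
    qed
    then show ?thesis using True I0 q by auto
  next
    case False
    \<comment> \<open>The mean of g with respect to k: with this tangent point the linear term
      integrates to zero.\<close>
    define l where "l = B / A"
    have pos: "A > 0" "B > 0" "l > 0" using False A0 B0 by (auto simp: l_def)
    have "A * l powr q = (\<integral>x. l powr q * k x + q * l powr (q - 1) * (k x * g x - l * k x) \<partial>M)"
      using ik int pos by (simp add: A_def[symmetric] B_def[symmetric] l_def)
    also have "\<dots> \<le> (\<integral>x. k x * g x powr q \<partial>M)"
    proof (rule integral_mono)
      fix x assume x: "x \<in> space M"
      have "k x * (l powr q + q * l powr (q - 1) * (g x - l)) \<le> k x * g x powr q"
        by (intro mult_left_mono tangent_powr k g x q pos)
      then show "l powr q * k x + q * l powr (q - 1) * (k x * g x - l * k x) \<le> k x * g x powr q"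
        by (simp add: algebra_simps)
    qed (use ik int ikg in auto)
    finally have *: "A * l powr q \<le> (\<integral>x. k x * g x powr q \<partial>M)" .
    have "B powr q = A powr (q - 1) * (A * l powr q)"
      using pos by (simp add: l_def powr_divide powr_diff)
    also have "\<dots> \<le> A powr (q - 1) * (\<integral>x. k x * g x powr q \<partial>M)"
      by (intro mult_left_mono *) auto
    finally show ?thesis .
  qed
qed

lemma integrable_of_nn_bound:
  fixes f :: "'a \<Rightarrow> real"
  assumes [measurable]: "f \<in> borel_measurable M" and "\<And>x. x \<in> space M \<Longrightarrow> 0 \<le> f x" 
    and "(\<integral>\<^sup>+x. ennreal (f x) \<partial>M) \<le> ennreal C" "0 \<le> C"
  shows "integrable M f" and "(\<integral>x. f x \<partial>M) \<le> C"
proof -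
  show *: "integrable M f"
    using assms by (intro integrableI_nonneg) (auto simp: le_less_trans[OF _ ennreal_less_top])
  have "ennreal (\<integral>x. f x \<partial>M) \<le> ennreal C"
    using assms(3) by (subst nn_integral_eq_integral[symmetric]) (use * assms(2) in auto)
  then show "(\<integral>x. f x \<partial>M) \<le> C" using assms(4) by simp
qed

text \<open>In the usual formulation with a test function h and the conjugate exponent q', \<psi> is
  h^q and \<open>\<psi> powr (1 / (q - 1))\<close> is h^q'. Writing \<open>H x y * f y\<close> as k
  times g with k = H h^q' lets Jensen's inequality and \<open>H1\<close> bound the inner integral;
  after Tonelli, \<open>H2\<close> removes the remaining \<psi>.\<close>

lemma schur_test:
  fixes H :: "'a \<Rightarrow> 'a \<Rightarrow> real"
  assumes "sigma_finite_measure M"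
    and [measurable]: "(\<lambda>(x, y). H x y) \<in> borel_measurable (M \<Otimes>\<^sub>M M)" "\<psi> \<in> borel_measurable M" "f \<in> borel_measurable M"
    and H: "\<And>x y. x \<in> space M \<Longrightarrow> y \<in> space M \<Longrightarrow> 0 \<le> H x y"
    and \<psi>: "\<And>x. x \<in> space M \<Longrightarrow> 0 < \<psi> x" and f: "\<And>x. x \<in> space M \<Longrightarrow> 0 \<le> f x"
    and q: "1 < q" and C: "0 < C1" "0 < C2"
    and H1: "\<And>x. x \<in> space M \<Longrightarrow> (\<integral>\<^sup>+y. ennreal (H x y * \<psi> y powr (1 / (q - 1))) \<partial>M) \<le> ennreal (C1 * \<psi> x powr (1 / (q - 1)))"
    and H2: "\<And>y. y \<in> space M \<Longrightarrow> (\<integral>\<^sup>+x. ennreal (H x y * \<psi> x) \<partial>M) \<le> ennreal (C2 * \<psi> y)"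
  shows "(\<integral>\<^sup>+x. ennreal ((\<integral>y. H x y * f y \<partial>M) powr q) \<partial>M) \<le> ennreal (C1 powr (q - 1) * C2) * (\<integral>\<^sup>+x. ennreal (f x powr q) \<partial>M)"
proof -
  interpret sigma_finite_measure M by fact
  interpret P: pair_sigma_finite M M ..
  define D where "D = C1 powr (q - 1)"
  have D: "D > 0" using C by (simp add: D_def)
  have [measurable]: "(\<lambda>y. H x y) \<in> borel_measurable M" if "x \<in> space M" for x
    using measurable_Pair2[OF assms(2) that] by simp
  have *: "ennreal ((\<integral>y. H x y * f y \<partial>M) powr q) \<le> ennreal (D * \<psi> x) * (\<integral>\<^sup>+y. ennreal (H x y * (f y powr q / \<psi> y)) \<partial>M)"
    if x[simp, measurable]: "x \<in> space M" for x
  \<comment> \<open>If the integral on the right diverges there is nothing to show, whatever value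
    the Bochner integral on the left takes; otherwise it supplies the integrability that Jensen's
    inequality asks for.\<close>
  proof (cases "(\<integral>\<^sup>+y. ennreal (H x y * (f y powr q / \<psi> y)) \<partial>M) = \<infinity>")
    case True
    then show ?thesis using D \<psi>[OF x] by (simp add: ennreal_mult_top)
  next
    case False
    define k where "k y = H x y * \<psi> y powr (1 / (q - 1))" for y
    define g where "g y = f y / \<psi> y powr (1 / (q - 1))" for y
    have [measurable]: "k \<in> borel_measurable M" "g \<in> borel_measurable M"
      unfolding k_def g_def by measurable
    have k0: "0 \<le> k y" if "y \<in> space M" for y using H[OF x that] by (simp add: k_def)
    have g0: "0 \<le> g y" if "y \<in> space M" for y using f[OF that] by (simp add: g_def)
    have k: "integrable M k" "(\<integral>y. k y \<partial>M) \<le> C1 * \<psi> x powr (1 / (q - 1))"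
      using integrable_of_nn_bound[of k M "C1 * \<psi> x powr (1 / (q - 1))"] H1[OF x] k0 C by (auto simp: k_def)
    \<comment> \<open>The exponents of \<psi> are 1 / (q - 1) from k and -q / (q - 1) from
      \<open>g y powr q\<close>; together they leave -1.\<close>
    have kgq: "k y * g y powr q = H x y * (f y powr q / \<psi> y)" if y: "y \<in> space M" for y
    proof -
      have "\<psi> y powr (1 / (q - 1)) / (\<psi> y powr (1 / (q - 1))) powr q = \<psi> y powr (1 / (q - 1) - 1 / (q - 1) * q)"
        by (simp add: powr_powr powr_diff)
      also have "1 / (q - 1) - 1 / (q - 1) * q = -1" using q by (simp add: field_simps)
      finally have "\<psi> y powr (1 / (q - 1)) / (\<psi> y powr (1 / (q - 1))) powr q = 1 / \<psi> y"
        using \<psi>[OF y] by (simp add: powr_minus_divide)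
      then have "H x y * f y powr q * (\<psi> y powr (1 / (q - 1)) / (\<psi> y powr (1 / (q - 1))) powr q) = H x y * f y powr q * (1 / \<psi> y)" by simp
      then show ?thesis using f[OF y] by (simp add: k_def g_def powr_divide mult_ac)
    qed
    have kg: "k y * g y = H x y * f y" if y: "y \<in> space M" for y
      using \<psi>[OF y] by (simp add: k_def g_def)
    have nonneg: "0 \<le> H x y * (f y powr q / \<psi> y)" if y: "y \<in> space M" for y
      using H[OF x y] \<psi>[OF y] by simp
    have i: "integrable M (\<lambda>y. H x y * (f y powr q / \<psi> y))"
      using False nonneg by (intro integrableI_nonneg) (auto simp: top.not_eq_extremum)
    then have i': "integrable M (\<lambda>y. k y * g y powr q)"
      by (simp cong: Bochner_Integration.integrable_cong add: kgq)
    have "(\<integral>y. H x y * f y \<partial>M) powr q = (\<integral>y. k y * g y \<partial>M) powr q"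
      by (simp add: kg cong: Bochner_Integration.integral_cong)
    also have "\<dots> \<le> (\<integral>y. k y \<partial>M) powr (q - 1) * (\<integral>y. k y * g y powr q \<partial>M)"
      by (rule weighted_jensen(2)[OF _ _ k0 g0 q k(1) i']) auto
    also have "\<dots> \<le> (C1 * \<psi> x powr (1 / (q - 1))) powr (q - 1) * (\<integral>y. k y * g y powr q \<partial>M)"
    proof (intro mult_right_mono powr_mono2)
      show "0 \<le> (\<integral>y. k y \<partial>M)" by (rule Bochner_Integration.integral_nonneg) (rule k0)
      show "0 \<le> (\<integral>y. k y * g y powr q \<partial>M)" by (rule Bochner_Integration.integral_nonneg) (simp add: k0)
    qed (use q k in auto)
    also have "(C1 * \<psi> x powr (1 / (q - 1))) powr (q - 1) = D * \<psi> x"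
      using C q \<psi>[OF x] by (simp add: D_def powr_mult powr_powr)
    also have "(\<integral>y. k y * g y powr q \<partial>M) = (\<integral>y. H x y * (f y powr q / \<psi> y) \<partial>M)"
      by (simp add: kgq cong: Bochner_Integration.integral_cong)
    finally have "ennreal ((\<integral>y. H x y * f y \<partial>M) powr q) \<le> ennreal (D * \<psi> x * (\<integral>y. H x y * (f y powr q / \<psi> y) \<partial>M))"
      by (rule ennreal_leI)
    also have "\<dots> = ennreal (D * \<psi> x) * (\<integral>\<^sup>+y. ennreal (H x y * (f y powr q / \<psi> y)) \<partial>M)"
      using i nonneg D \<psi>[OF x] by (subst nn_integral_eq_integral) (auto simp: ennreal_mult' Bochner_Integration.integral_nonneg less_imp_le)
    finally show ?thesis .
  qed
  have "(\<integral>\<^sup>+x. ennreal ((\<integral>y. H x y * f y \<partial>M) powr q) \<partial>M) \<le> (\<integral>\<^sup>+x. ennreal (D * \<psi> x) * (\<integral>\<^sup>+y. ennreal (H x y * (f y powr q / \<psi> y)) \<partial>M) \<partial>M)"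
    by (intro nn_integral_mono *)
  also have "\<dots> = (\<integral>\<^sup>+x. (\<integral>\<^sup>+y. ennreal (D * \<psi> x) * ennreal (H x y * (f y powr q / \<psi> y)) \<partial>M) \<partial>M)"
    by (intro nn_integral_cong nn_integral_cmult[symmetric]) measurable
  also have "\<dots> = (\<integral>\<^sup>+y. (\<integral>\<^sup>+x. ennreal (D * \<psi> x) * ennreal (H x y * (f y powr q / \<psi> y)) \<partial>M) \<partial>M)"
    by (rule P.Fubini') measurable
  also have "\<dots> = (\<integral>\<^sup>+y. (\<integral>\<^sup>+x. ennreal (D * f y powr q / \<psi> y) * ennreal (H x y * \<psi> x) \<partial>M) \<partial>M)"
    by (intro nn_integral_cong) (use D H \<psi> in \<open>auto simp: ennreal_mult[symmetric] less_imp_le mult_ac\<close>)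
  also have "\<dots> = (\<integral>\<^sup>+y. ennreal (D * f y powr q / \<psi> y) * (\<integral>\<^sup>+x. ennreal (H x y * \<psi> x) \<partial>M) \<partial>M)"
    by (intro nn_integral_cong nn_integral_cmult) measurable
  also have "\<dots> \<le> (\<integral>\<^sup>+y. ennreal (D * f y powr q / \<psi> y) * ennreal (C2 * \<psi> y) \<partial>M)"
    by (intro nn_integral_mono mult_left_mono H2) auto
  also have "\<dots> = (\<integral>\<^sup>+y. ennreal (D * C2) * ennreal (f y powr q) \<partial>M)"
  proof (intro nn_integral_cong)
    fix y assume y: "y \<in> space M"
    show "ennreal (D * f y powr q / \<psi> y) * ennreal (C2 * \<psi> y) = ennreal (D * C2) * ennreal (f y powr q)"
      using D C \<psi>[OF y] by (simp add: ennreal_mult[symmetric] less_imp_le)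
  qed
  also have "\<dots> = ennreal (D * C2) * (\<integral>\<^sup>+y. ennreal (f y powr q) \<partial>M)"
    by (rule nn_integral_cmult) measurable
  finally show ?thesis by (simp add: D_def)
qed

lemma nn_integral_powr_from_0:
  assumes "e > -1" "c \<ge> 0"
  shows "(\<integral>\<^sup>+x. ennreal (x powr e) * indicator {0..c} x \<partial>lborel) = ennreal (c powr (e + 1) / (e + 1))"
proof -
  have "(\<lambda>x. ennreal (x powr e) * indicator {0..c} x) = (\<lambda>x. ennreal (x powr e * indicator {0..c} x))"
    by (auto simp: fun_eq_iff split: split_indicator)
  then show ?thesis
    using nn_integral_has_integral_lebesgue[OF _ has_integral_powr_from_0[OF assms]] by (simp add: mult.commute)
qed

text \<open>The factor \<open>1 / (1 - \<sigma> * x)\<close> is at most the smaller of 1 / \<tau>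
  and 1 / (1 - x), where \<tau> = 1 - \<sigma>. Near x = 1, splitting at 1 - x = \<tau> leaves two
  elementary power integrals of order \<open>\<tau> powr (- c)\<close>: the one with 1 - x \<le>
  \<tau> needs c < 1, the other c > 0.\<close>

lemma one_dim_schur_bound:
  fixes c e :: real
  assumes c: "0 < c" "c < 1" and e: "e > -1"
  shows "\<exists>C>0. \<forall>\<sigma>\<in>{0..<1}. (\<integral>\<^sup>+x. ennreal (x powr e * (1 - x) powr (- c) / (1 - \<sigma> * x)) * indicator {0<..<1} x \<partial>lborel)
     \<le> ennreal (C * (1 - \<sigma>) powr (- c))"
proof (intro exI conjI ballI)
  \<comment> \<open>The first summand comes from x \<le> 1/2, where
    \<open>(1 - x) powr (- c)\<close> and \<open>1 / (1 - \<sigma> * x)\<close> are both at most 2.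
    The second comes from x > 1/2: there \<open>x powr e\<close> is at most 2 because e > -1, and
    the bracket bounds the integral of h.\<close>
  let ?C = "4 / (e + 1) + 2 * (1 / (1 - c) + 1 / c)"
  have "0 < e + 1" "0 < 1 - c" using c e by auto
  then have *: "0 < 4 / (e + 1)" "0 < 1 / (1 - c)" "0 < 1 / c"
    using c by (simp_all only: zero_less_divide_iff) auto
  show "?C > 0" by (rule add_pos_pos[OF *(1) mult_pos_pos[OF zero_less_numeral add_pos_pos[OF *(2,3)]]])
  fix \<sigma> :: real assume \<sigma>: "\<sigma> \<in> {0..<1}"
  define \<tau> where "\<tau> = 1 - \<sigma>"
  have \<tau>: "0 < \<tau>" "\<tau> \<le> 1" using \<sigma> by (auto simp: \<tau>_def)
  have \<tau>c: "1 \<le> \<tau> powr (- c)" using \<tau> c by (simp add: powr_minus_divide powr_le1)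
  \<comment> \<open>A majorant in the variable s = 1 - x, bounding the fraction by 1 / \<tau> for s
    up to \<tau> and by 1 / s beyond.\<close>
  define h where "h s = (s powr (- c) / \<tau>) * indicator {0..\<tau>} s + s powr (- c - 1) * indicator {\<tau>..1} s" for s
  have h0: "0 \<le> h s" for s using \<tau> by (simp add: h_def)
  have [measurable]: "h \<in> borel_measurable borel" unfolding h_def by measurable
  have bound: "x powr e * (1 - x) powr (- c) / (1 - \<sigma> * x) \<le> 4 * \<tau> powr (- c) * x powr e * indicator {0..1} x + 2 * h (1 - x)"
    if x: "0 < x" "x < 1" for x
  proof -
    have d1: "1 - \<sigma> * x \<ge> 1 - x" using x \<sigma> mult_right_mono[of \<sigma> 1 x] by auto
    have d2: "1 - \<sigma> * x \<ge> \<tau>" using x \<sigma> mult_left_mono[of x 1 \<sigma>] by (auto simp: \<tau>_def)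
    have dp: "0 < 1 - \<sigma> * x" using d2 \<tau> by linarith
    show ?thesis
    proof (cases "x \<le> 1/2")
      case True
      have "(1 - x) powr (- c) \<le> (1/2) powr (- c)" using True x c by (intro powr_mono2') auto
      also have "\<dots> \<le> 2 powr 1" using c by (simp add: powr_minus_divide powr_divide) (metis less_imp_le one_le_numeral powr_mono powr_one zero_le_numeral)
      finally have "(1 - x) powr (- c) \<le> 2" by simp
      moreover have "1 - \<sigma> * x \<ge> 1/2" using d1 True by linarith
      ultimately have "(1 - x) powr (- c) / (1 - \<sigma> * x) \<le> 2 / (1/2)" by (intro frac_le) auto
      also have "\<dots> \<le> 4 * \<tau> powr (- c)" using \<tau>c by simp
      finally have "x powr e * ((1 - x) powr (- c) / (1 - \<sigma> * x)) \<le> x powr e * (4 * \<tau> powr (- c))" by (intro mult_left_mono) auto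
      then show ?thesis using x h0[of "1 - x"] by (simp add: mult_ac)
    next
      case False
      have "x powr e \<le> 2"
      proof (cases "e \<ge> 0")
        case True then show ?thesis using x powr_le1[of e x] by simp
      next
        case F: False
        have "x powr e \<le> (1/2) powr e" using False F by (intro powr_mono2') auto
        also have "\<dots> = 2 powr (- e)" by (simp add: powr_divide powr_minus_divide)
        also have "\<dots> \<le> 2 powr 1" using e by (intro powr_mono) auto
        finally show ?thesis by simp
      qed
      moreover have "(1 - x) powr (- c) / (1 - \<sigma> * x) \<le> h (1 - x)"
      proof (cases "1 - x \<le> \<tau>")
        case True
        have "(1 - x) powr (- c) / (1 - \<sigma> * x) \<le> (1 - x) powr (- c) / \<tau>"
          using \<tau> by (intro divide_left_mono mult_pos_pos d2 dp) auto
        also have "\<dots> \<le> h (1 - x)" using True x by (simp add: h_def)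
        finally show ?thesis .
      next
        case F: False
        have "(1 - x) powr (- c) / (1 - \<sigma> * x) \<le> (1 - x) powr (- c) / (1 - x)"
          using x by (intro divide_left_mono mult_pos_pos d1 dp) auto
        also have "\<dots> = h (1 - x)" using F x by (simp add: h_def powr_diff)
        finally show ?thesis .
      qed
      ultimately have "x powr e * ((1 - x) powr (- c) / (1 - \<sigma> * x)) \<le> 2 * h (1 - x)"
        using h0 d2 \<tau> by (intro mult_mono) auto
      then have 1: "x powr e * (1 - x) powr (- c) / (1 - \<sigma> * x) \<le> 2 * h (1 - x)" by simp
      have "0 \<le> 4 * \<tau> powr (- c) * x powr e * indicator {0..1} x" by simp
      with 1 show ?thesis by linarith
    qed
  qed
  have hint: "(\<integral>\<^sup>+s. ennreal (h s) \<partial>lborel) \<le> ennreal ((1 / (1 - c) + 1 / c) * \<tau> powr (- c))"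
  proof -
    have "(\<integral>\<^sup>+s. ennreal (h s) \<partial>lborel) = (\<integral>\<^sup>+s. ennreal (1 / \<tau>) * (ennreal (s powr (- c)) * indicator {0..\<tau>} s) + ennreal (s powr (- c - 1)) * indicator {\<tau>..1} s \<partial>lborel)"
      using \<tau> by (intro nn_integral_cong) (auto simp: h_def ennreal_mult[symmetric] ennreal_plus[symmetric] simp del: ennreal_plus split: split_indicator)
    also have "\<dots> = ennreal (1 / \<tau>) * (\<integral>\<^sup>+s. ennreal (s powr (- c)) * indicator {0..\<tau>} s \<partial>lborel) + (\<integral>\<^sup>+s. ennreal (s powr (- c - 1)) * indicator {\<tau>..1} s \<partial>lborel)"
      by (subst nn_integral_add) (auto simp: nn_integral_cmult)
    also have "(\<integral>\<^sup>+s. ennreal (s powr (- c)) * indicator {0..\<tau>} s \<partial>lborel) = ennreal (\<tau> powr (- c + 1) / (- c + 1))"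
      using c \<tau> by (intro nn_integral_powr_from_0) auto
    also have "(\<integral>\<^sup>+s. ennreal (s powr (- c - 1)) * indicator {\<tau>..1} s \<partial>lborel) = ennreal (- (1 powr (- c)) / c - (- (\<tau> powr (- c)) / c))"
      using \<tau> c by (intro nn_integral_FTC_Icc) (auto intro!: derivative_eq_intros simp: )
    also have "ennreal (1 / \<tau>) * ennreal (\<tau> powr (- c + 1) / (- c + 1)) = ennreal (1 / (1 - c) * \<tau> powr (- c))"
      using \<tau> c by (simp add: ennreal_mult[symmetric] powr_diff powr_minus_divide)
    also have "ennreal (1 / (1 - c) * \<tau> powr (- c)) + ennreal (- (1 powr (- c)) / c - (- (\<tau> powr (- c)) / c)) = ennreal (1 / (1 - c) * \<tau> powr (- c) + (- (1 powr (- c)) / c - (- (\<tau> powr (- c)) / c)))"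
      using c \<tau>c by (subst ennreal_plus) (auto simp: field_simps)
    also have "\<dots> \<le> ennreal ((1 / (1 - c) + 1 / c) * \<tau> powr (- c))"
      using c by (intro ennreal_leI) (simp add: distrib_right)
    finally show ?thesis .
  qed
  have "(\<integral>\<^sup>+x. ennreal (x powr e * (1 - x) powr (- c) / (1 - \<sigma> * x)) * indicator {0<..<1} x \<partial>lborel)
    \<le> (\<integral>\<^sup>+x. ennreal (4 * \<tau> powr (- c)) * (ennreal (x powr e) * indicator {0..1} x) + 2 * ennreal (h (1 + -1 * x)) \<partial>lborel)"
  proof (rule nn_integral_mono)
    fix x :: real
    show "ennreal (x powr e * (1 - x) powr (- c) / (1 - \<sigma> * x)) * indicator {0<..<1} x
      \<le> ennreal (4 * \<tau> powr (- c)) * (ennreal (x powr e) * indicator {0..1} x) + 2 * ennreal (h (1 + -1 * x))"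
    proof (cases "0 < x \<and> x < 1")
      case True
      have "ennreal (x powr e * (1 - x) powr (- c) / (1 - \<sigma> * x)) \<le> ennreal (4 * \<tau> powr (- c) * x powr e + 2 * h (1 - x))"
        using bound[of x] True by (intro ennreal_leI) auto
      also have "\<dots> = ennreal (4 * \<tau> powr (- c)) * ennreal (x powr e) + 2 * ennreal (h (1 - x))"
        using h0[of "1 - x"] by (subst ennreal_plus) (auto simp: ennreal_mult)
      finally show ?thesis using True by simp
    qed auto
  qed
  also have "\<dots> = ennreal (4 * \<tau> powr (- c)) * (\<integral>\<^sup>+x. ennreal (x powr e) * indicator {0..1} x \<partial>lborel) + 2 * (\<integral>\<^sup>+x. ennreal (h (1 + -1 * x)) \<partial>lborel)"
    by (subst nn_integral_add) (auto simp: nn_integral_cmult)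
  also have "(\<integral>\<^sup>+x. ennreal (h (1 + -1 * x)) \<partial>lborel) = (\<integral>\<^sup>+x. ennreal (h x) \<partial>lborel)"
    using nn_integral_real_affine[of "\<lambda>x. ennreal (h x)" "-1" 1] by simp
  also have "(\<integral>\<^sup>+x. ennreal (x powr e) * indicator {0..1} x \<partial>lborel) = ennreal (1 / (e + 1))"
    using nn_integral_powr_from_0[of e 1] e by simp
  also have "ennreal (4 * \<tau> powr (- c)) * ennreal (1 / (e + 1)) + 2 * (\<integral>\<^sup>+x. ennreal (h x) \<partial>lborel)
    \<le> ennreal (4 * \<tau> powr (- c)) * ennreal (1 / (e + 1)) + 2 * ennreal ((1 / (1 - c) + 1 / c) * \<tau> powr (- c))"
    by (intro add_left_mono mult_left_mono hint) auto
  also have "\<dots> = ennreal (4 * \<tau> powr (- c) * (1 / (e + 1)) + 2 * ((1 / (1 - c) + 1 / c) * \<tau> powr (- c)))"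
  proof -
    have "ennreal (4 * \<tau> powr (- c)) * ennreal (1 / (e + 1)) = ennreal (4 * \<tau> powr (- c) * (1 / (e + 1)))"
      using e by (intro ennreal_mult[symmetric]) auto
    moreover have "2 * ennreal B = ennreal (2 * B)" for B by (simp add: ennreal_mult')
    moreover have "0 \<le> 4 * \<tau> powr (- c) * (1 / (e + 1))" "0 \<le> 2 * ((1 / (1 - c) + 1 / c) * \<tau> powr (- c))"
      using c e by auto
    ultimately show ?thesis by (simp only: ennreal_plus)
  qed
  also have "\<dots> = ennreal (?C * \<tau> powr (- c))" by (simp add: algebra_simps)
  finally show "(\<integral>\<^sup>+x. ennreal (x powr e * (1 - x) powr (- c) / (1 - \<sigma> * x)) * indicator {0<..<1} x \<partial>lborel) \<le> ennreal (?C * (1 - \<sigma>) powr (- c))"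
    by (simp add: \<tau>_def)
qed

subsection \<open>Holomorphic functions of two variables\<close>

lemma holomorphic2_on_imp_continuous_on: "holomorphic2_on f \<Omega> \<Longrightarrow> continuous_on \<Omega> f"
  unfolding holomorphic2_on_def continuous_on_eq_continuous_within by (blast intro: has_derivative_continuous)

lemma holomorphic2_on_subset: "holomorphic2_on f \<Omega> \<Longrightarrow> \<Omega>' \<subseteq> \<Omega> \<Longrightarrow> holomorphic2_on f \<Omega>'"
  unfolding holomorphic2_on_def by (meson has_derivative_subset subsetD)

lemma holomorphic2_on_cong:
  assumes "holomorphic2_on f \<Omega>" "\<And>z. z \<in> \<Omega> \<Longrightarrow> f z = g z"
  shows "holomorphic2_on g \<Omega>"
  using assms unfolding holomorphic2_on_def by (metis has_derivative_transform)

lemma holomorphic2_on_const: "holomorphic2_on (\<lambda>z. c) \<Omega>"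
  unfolding holomorphic2_on_def by (intro ballI exI[of _ 0]) simp

lemma holomorphic2_on_fst: "holomorphic2_on fst \<Omega>"
  unfolding holomorphic2_on_def
  by (intro ballI exI[of _ 1] exI[of _ 0]) (auto intro!: derivative_eq_intros simp: fun_eq_iff)

lemma holomorphic2_on_snd: "holomorphic2_on snd \<Omega>"
  unfolding holomorphic2_on_def
  by (intro ballI exI[of _ 0] exI[of _ 1]) (auto intro!: derivative_eq_intros simp: fun_eq_iff)

lemma holomorphic2_on_add:
  assumes "holomorphic2_on f \<Omega>" "holomorphic2_on g \<Omega>"
  shows "holomorphic2_on (\<lambda>z. f z + g z) \<Omega>"
  unfolding holomorphic2_on_def
proof
  fix z assume z: "z \<in> \<Omega>"
  obtain a b c d where "(f has_derivative (\<lambda>h. a * fst h + b * snd h)) (at z within \<Omega>)"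
     "(g has_derivative (\<lambda>h. c * fst h + d * snd h)) (at z within \<Omega>)"
    using assms z unfolding holomorphic2_on_def by blast
  from has_derivative_add[OF this] 
  show "\<exists>a b. ((\<lambda>z. f z + g z) has_derivative (\<lambda>h. a * fst h + b * snd h)) (at z within \<Omega>)"
    by (intro exI[of _ "a + c"] exI[of _ "b + d"]) (simp add: algebra_simps)
qed

lemma holomorphic2_on_mult:
  assumes "holomorphic2_on f \<Omega>" "holomorphic2_on g \<Omega>"
  shows "holomorphic2_on (\<lambda>z. f z * g z) \<Omega>"
  unfolding holomorphic2_on_def
proof
  fix z assume z: "z \<in> \<Omega>"
  obtain a b c d where "(f has_derivative (\<lambda>h. a * fst h + b * snd h)) (at z within \<Omega>)"
     "(g has_derivative (\<lambda>h. c * fst h + d * snd h)) (at z within \<Omega>)"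
    using assms z unfolding holomorphic2_on_def by blast
  from has_derivative_mult[OF this] 
  show "\<exists>a b. ((\<lambda>z. f z * g z) has_derivative (\<lambda>h. a * fst h + b * snd h)) (at z within \<Omega>)"
    by (intro exI[of _ "f z * c + a * g z"] exI[of _ "f z * d + b * g z"]) (simp add: algebra_simps)
qed

lemma holomorphic2_on_diff:
  assumes "holomorphic2_on f \<Omega>" "holomorphic2_on g \<Omega>"
  shows "holomorphic2_on (\<lambda>z. f z - g z) \<Omega>"
  using holomorphic2_on_add[OF assms(1) holomorphic2_on_mult[OF holomorphic2_on_const[of "-1"] assms(2)]] by simp

lemma holomorphic2_on_sum:
  "(\<And>i. i \<in> I \<Longrightarrow> holomorphic2_on (f i) \<Omega>) \<Longrightarrow> holomorphic2_on (\<lambda>z. \<Sum>i\<in>I. f i z) \<Omega>"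
  by (induction I rule: infinite_finite_induct) (auto intro: holomorphic2_on_const holomorphic2_on_add)

lemma holomorphic2_on_power: "holomorphic2_on f \<Omega> \<Longrightarrow> holomorphic2_on (\<lambda>z. f z ^ k) \<Omega>"
  by (induction k) (auto intro: holomorphic2_on_const holomorphic2_on_mult)

lemma holomorphic2_on_compose:
  assumes "holomorphic2_on f \<Omega>" "g holomorphic_on S" "open S" "\<And>z. z \<in> \<Omega> \<Longrightarrow> f z \<in> S"
  shows "holomorphic2_on (\<lambda>z. g (f z)) \<Omega>"
  unfolding holomorphic2_on_def
proof
  fix z assume z: "z \<in> \<Omega>"
  obtain a b where 1: "(f has_derivative (\<lambda>h. a * fst h + b * snd h)) (at z within \<Omega>)"
    using assms z unfolding holomorphic2_on_def by blast
  have "(g has_field_derivative deriv g (f z)) (at (f z))"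
    using assms z by (meson holomorphic_derivI)
  then have "(g has_derivative (*) (deriv g (f z))) (at (f z))" by (simp add: has_field_derivative_def)
  from has_derivative_compose[OF 1 this]
  show "\<exists>a b. ((\<lambda>z. g (f z)) has_derivative (\<lambda>h. a * fst h + b * snd h)) (at z within \<Omega>)"
    by (intro exI[of _ "deriv g (f z) * a"] exI[of _ "deriv g (f z) * b"]) (simp add: algebra_simps)
qed

lemma holomorphic2_on_inverse:
  assumes "holomorphic2_on f \<Omega>" "\<And>z. z \<in> \<Omega> \<Longrightarrow> f z \<noteq> 0"
  shows "holomorphic2_on (\<lambda>z. inverse (f z)) \<Omega>"
  by (rule holomorphic2_on_compose[OF assms(1), of _ "-{0}"]) (use assms in \<open>auto intro!: holomorphic_intros\<close>)

lemma holomorphic2_on_divide: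
  assumes "holomorphic2_on f \<Omega>" "holomorphic2_on g \<Omega>" "\<And>z. z \<in> \<Omega> \<Longrightarrow> g z \<noteq> 0"
  shows "holomorphic2_on (\<lambda>z. f z / g z) \<Omega>"
  unfolding divide_inverse by (intro holomorphic2_on_mult holomorphic2_on_inverse assms)

lemma holomorphic2_on_power_int:
  assumes "holomorphic2_on f \<Omega>" "\<And>z. z \<in> \<Omega> \<Longrightarrow> f z \<noteq> 0"
  shows "holomorphic2_on (\<lambda>z. f z powi k) \<Omega>"
proof (cases "k \<ge> 0")
  case True then show ?thesis unfolding power_int_def by (simp add: holomorphic2_on_power assms)
next
  case False then show ?thesis unfolding power_int_def
    using holomorphic2_on_power[OF holomorphic2_on_inverse[OF assms]] by simp
qed

text \<open>Restriction to a holomorphic curve, the way by which one-variable theory is applied: a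
  constant component gives a coordinate slice, affine components give a complex line.\<close>

lemma holomorphic2_on_compose_pair:
  assumes f: "holomorphic2_on f \<Omega>" "open \<Omega>" and S: "open S" "\<phi> holomorphic_on S" "\<xi> holomorphic_on S"
    and im: "\<And>\<zeta>. \<zeta> \<in> S \<Longrightarrow> (\<phi> \<zeta>, \<xi> \<zeta>) \<in> \<Omega>"
  shows "(\<lambda>\<zeta>. f (\<phi> \<zeta>, \<xi> \<zeta>)) holomorphic_on S"
proof (rule holomorphic_onI)
  fix \<zeta> assume z: "\<zeta> \<in> S"
  obtain a b where "(f has_derivative (\<lambda>h. a * fst h + b * snd h)) (at (\<phi> \<zeta>, \<xi> \<zeta>) within \<Omega>)"
    using f im[OF z] unfolding holomorphic2_on_def by blast
  then have 1: "(f has_derivative (\<lambda>h. a * fst h + b * snd h)) (at (\<phi> \<zeta>, \<xi> \<zeta>))"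
    by (simp add: at_within_open[OF im[OF z] f(2)])
  have "(\<phi> has_derivative (*) (deriv \<phi> \<zeta>)) (at \<zeta>)" "(\<xi> has_derivative (*) (deriv \<xi> \<zeta>)) (at \<zeta>)"
    using holomorphic_derivI[OF S(2,1) z] holomorphic_derivI[OF S(3,1) z] by (simp_all add: has_field_derivative_def)
  from has_derivative_Pair[OF this] have "((\<lambda>\<zeta>. (\<phi> \<zeta>, \<xi> \<zeta>)) has_derivative (\<lambda>h. (deriv \<phi> \<zeta> * h, deriv \<xi> \<zeta> * h))) (at \<zeta>)" .
  from has_derivative_compose[OF this 1]
  have "((\<lambda>\<zeta>. f (\<phi> \<zeta>, \<xi> \<zeta>)) has_field_derivative (a * deriv \<phi> \<zeta> + b * deriv \<xi> \<zeta>)) (at \<zeta>)"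
    unfolding has_field_derivative_def by (rule has_derivative_eq_rhs) (auto simp: fun_eq_iff algebra_simps)
  then show "(\<lambda>\<zeta>. f (\<phi> \<zeta>, \<xi> \<zeta>)) field_differentiable at \<zeta> within S"
    using field_differentiable_at_within field_differentiable_def by blast
qed

text \<open>Schwarz's lemma on the complex line through \<open>z0\<close> and \<open>z\<close>. The
  bound depends on f only through B, so for a family of functions with an integrable majorant the
  Lipschitz constants are integrable too.\<close>

lemma holomorphic2_lipschitz:
  assumes f: "holomorphic2_on f (ball z0 r)" and B: "\<And>z. z \<in> ball z0 r \<Longrightarrow> cmod (f z) \<le> B"
    and z: "z \<in> ball z0 r"
  shows "cmod (f z - f z0) \<le> 3 * B / r * norm (z - z0)"
proof -
  have r: "r > 0" using le_less_trans[OF zero_le_dist, of z0 z r] z by simp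
  have B0: "0 \<le> B" using order_trans[OF norm_ge_zero B[OF z]] .
  show ?thesis
  proof (cases "z = z0 \<or> B = 0")
    case True
    have "f z = 0" "f z0 = 0" if "B = 0" using B[OF z] B[of z0] r that by auto
    then show ?thesis using True by auto
  next
    case False
    define v where "v = z - z0"
    define d where "d = norm (v)"
    have d: "0 < d" "d < r" using False z by (auto simp: d_def v_def dist_norm norm_minus_commute)
    \<comment> \<open>The direction is scaled so that the unit disc of the parameter fills the part
      of the line inside the ball; \<open>z\<close> then has parameter d / r.\<close>
    define p where "p = (fst (v) * of_real (r / d), snd (v) * of_real (r / d))"
    have np: "norm (\<zeta> * fst p, \<zeta> * snd p) = cmod \<zeta> * r" for \<zeta>
    proof -
      have "norm (\<zeta> * fst p, \<zeta> * snd p) = sqrt ((cmod \<zeta> * (r / d))\<^sup>2 * ((cmod (fst (v)))\<^sup>2 + (cmod (snd (v)))\<^sup>2))"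
        using r d by (simp add: norm_Pair p_def norm_mult norm_divide power_mult_distrib power_divide algebra_simps add_divide_distrib)
      also have "\<dots> = cmod \<zeta> * (r / d) * norm (v)"
        using r d by (simp add: real_sqrt_mult norm_prod_def)
      finally show ?thesis using d by (simp add: d_def)
    qed
    define g where "g \<zeta> = f (fst z0 + \<zeta> * fst p, snd z0 + \<zeta> * snd p)" for \<zeta>
    have im: "(fst z0 + \<zeta> * fst p, snd z0 + \<zeta> * snd p) \<in> ball z0 r" if "cmod \<zeta> < 1" for \<zeta>
    proof -
      have "dist z0 (fst z0 + \<zeta> * fst p, snd z0 + \<zeta> * snd p) = norm (\<zeta> * fst p, \<zeta> * snd p)"
        by (simp add: dist_norm norm_prod_def norm_minus_commute minus_prod_def)
      then show ?thesis using that r by (simp add: np)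
    qed
    have hg: "g holomorphic_on ball 0 1" unfolding g_def
      by (rule holomorphic2_on_compose_pair[OF f]) (use im in \<open>auto intro!: holomorphic_intros\<close>)
    \<comment> \<open>The difference is at most 2 B; dividing by 3 B gives the strict bound below 1
      that Schwarz's lemma requires.\<close>
    define h where "h \<zeta> = (g \<zeta> - g 0) / (3 * B)" for \<zeta>
    have "cmod (h (of_real (d / r))) \<le> cmod (of_real (d / r))"
    proof (rule Schwarz_Lemma(1))
      show "h holomorphic_on ball 0 1" unfolding h_def using hg by (intro holomorphic_intros) (use False in auto)
      show "h 0 = 0" by (simp add: h_def)
      show "cmod (h \<zeta>) < 1" if "cmod \<zeta> < 1" for \<zeta>
      proof -
        have "cmod (g \<zeta> - g 0) \<le> B + B"
          using B[OF im[OF that]] B[OF im[of 0]] by (intro norm_triangle_le_diff) (auto simp: g_def)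
        then show ?thesis using False B0 by (simp add: h_def norm_divide norm_mult)
      qed
      show "cmod (of_real (d / r)) < 1" using d by (simp add: norm_divide)
    qed
    moreover have "g (of_real (d / r)) = f z" "g 0 = f z0"
      using d r by (simp_all add: g_def p_def v_def)
    ultimately have "cmod (f z - f z0) / (3 * B) \<le> d / r"
      using B0 d by (simp add: h_def norm_divide norm_mult)
    then show ?thesis using False B0 r by (simp add: d_def v_def field_simps)
  qed
qed

text \<open>The remainder of the first-order expansion, divided by \<open>norm h\<close>, tends to 0
  for every w and is dominated by means of the Lipschitz bound, so it still tends to 0 after
  integration. The linear part integrates to a complex linear map.\<close>

lemma holomorphic2_on_integral:
  fixes K :: "complex \<times> complex \<Rightarrow> 'a \<Rightarrow> complex"
  assumes \<Omega>: "open \<Omega>" and hol: "\<And>w. w \<in> space M \<Longrightarrow> holomorphic2_on (\<lambda>z. K z w) \<Omega>"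
    and meas: "\<And>z. z \<in> \<Omega> \<Longrightarrow> K z \<in> borel_measurable M"
    and dom: "\<And>z0. z0 \<in> \<Omega> \<Longrightarrow> \<exists>r>0. \<exists>G. ball z0 r \<subseteq> \<Omega> \<and> integrable M G \<and> (\<forall>z\<in>ball z0 r. \<forall>w\<in>space M. cmod (K z w) \<le> G w)"
  shows "holomorphic2_on (\<lambda>z. \<integral>w. K z w \<partial>M) \<Omega>"
  unfolding holomorphic2_on_def
proof
  fix z0 assume z0: "z0 \<in> \<Omega>"
  obtain r G where r: "r > 0" "ball z0 r \<subseteq> \<Omega>" and G: "integrable M G"
    and KG: "\<And>z w. z \<in> ball z0 r \<Longrightarrow> w \<in> space M \<Longrightarrow> cmod (K z w) \<le> G w"
    using dom[OF z0] by blast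
  have intK: "integrable M (K z)" if "z \<in> ball z0 r" for z
  proof (rule Bochner_Integration.integrable_bound[OF G meas])
    show "z \<in> \<Omega>" using that r by blast
    show "AE w in M. norm (K z w) \<le> norm (G w)"
      unfolding real_norm_def by (intro AE_I2 order_trans[OF KG[OF that] abs_ge_self])
  qed
  have lip: "cmod (K (z0 + h) w - K z0 w) \<le> 3 * G w / r * norm h" if "norm h < r" "w \<in> space M" for h w
    using holomorphic2_lipschitz[of "\<lambda>z. K z w" z0 r "G w" "z0 + h"] that KG hol[OF that(2)] r holomorphic2_on_subset
    by (auto simp: dist_norm)
  have "\<forall>w\<in>space M. \<exists>a b. ((\<lambda>z. K z w) has_derivative (\<lambda>h. a * fst h + b * snd h)) (at z0)"
    using hol z0 unfolding holomorphic2_on_def at_within_open[OF z0 \<Omega>, symmetric] by blast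
  then obtain a b where ab: "\<And>w. w \<in> space M \<Longrightarrow> ((\<lambda>z. K z w) has_derivative (\<lambda>h. a w * fst h + b w * snd h)) (at z0)"
    by metis
  define q where "q h w = (K (z0 + h) w - K z0 w - (a w * fst h + b w * snd h)) /\<^sub>R norm h" for h w
  have q0: "((\<lambda>h. q h w) \<longlongrightarrow> 0) (at 0)" if "w \<in> space M" for w
    using ab[OF that] unfolding has_derivative_at q_def 
    by (subst tendsto_norm_zero_iff[symmetric]) (simp add: divide_inverse mult.commute)
  \<comment> \<open>The derivatives \<open>a\<close> and \<open>b\<close> come from a choice made
    for every w. As limits of difference quotients along a fixed unit vector they are nevertheless
    measurable, and the Lipschitz bound makes them integrable.\<close>
  have dir: "c \<in> borel_measurable M \<and> integrable M c"
    if v: "norm v = 1" and c: "\<And>w t. w \<in> space M \<Longrightarrow> a w * (of_real t * fst v) + b w * (of_real t * snd v) = of_real t * c w" for v :: "complex \<times> complex" and c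
  proof -
    \<comment> \<open>The offset 2 keeps even the first step strictly below r.\<close>
    define t where "t i = r / (real i + 2)" for i
    have t: "0 < t i" "t i < r" for i using r by (auto simp: t_def field_simps add_pos_nonneg)
    have t0: "t \<longlonglongrightarrow> 0" unfolding t_def by real_asymp
    have lim: "(\<lambda>i. (K (z0 + t i *\<^sub>R v) w - K z0 w) /\<^sub>R t i) \<longlonglongrightarrow> c w" if w: "w \<in> space M" for w
    proof -
      have "v \<noteq> 0" using v by auto
      have f: "filterlim (\<lambda>i. t i *\<^sub>R v) (at 0) sequentially"
        unfolding filterlim_at using tendsto_scaleR[OF t0 tendsto_const[of v]] t \<open>v \<noteq> 0\<close> 
        by (auto intro!: always_eventually less_imp_neq simp: less_imp_neq[symmetric])
      have "(\<lambda>i. q (t i *\<^sub>R v) w) \<longlonglongrightarrow> 0" by (rule filterlim_compose[OF q0[OF w] f])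
      also have "(\<lambda>i. q (t i *\<^sub>R v) w) = (\<lambda>i. (K (z0 + t i *\<^sub>R v) w - K z0 w) /\<^sub>R t i - c w)"
      proof
        fix i
        have 1: "a w * fst (t i *\<^sub>R v) + b w * snd (t i *\<^sub>R v) = t i *\<^sub>R c w"
          using c[OF w, of "t i"] by (simp add: scaleR_conv_of_real)
        have 2: "norm (t i *\<^sub>R v) = t i" using t[of i] v by simp
        show "q (t i *\<^sub>R v) w = (K (z0 + t i *\<^sub>R v) w - K z0 w) /\<^sub>R t i - c w"
          unfolding q_def 1 2 using t[of i] by (simp add: scaleR_diff_right)
      qed
      finally show ?thesis by (simp add: LIM_zero_cancel)
    qed
    have inb: "z0 + t i *\<^sub>R v \<in> ball z0 r" for i using t[of i] v by (simp add: dist_norm)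
    have m: "c \<in> borel_measurable M"
      by (rule borel_measurable_LIMSEQ_metric[OF _ lim]) (intro borel_measurable_scaleR borel_measurable_diff borel_measurable_const meas z0 subsetD[OF r(2) inb])
    have "cmod (c w) \<le> 3 * G w / r" if w: "w \<in> space M" for w
    proof (rule LIMSEQ_le_const2[OF tendsto_norm[OF lim[OF w]]], intro exI allI impI)
      fix i
      have "cmod (K (z0 + t i *\<^sub>R v) w - K z0 w) \<le> 3 * G w / r * t i"
        using lip[of "t i *\<^sub>R v" w] t[of i] v w by simp
      then show "norm ((K (z0 + t i *\<^sub>R v) w - K z0 w) /\<^sub>R t i) \<le> 3 * G w / r"
        unfolding norm_scaleR using t[of i] by (simp add: field_simps)
    qed
    then have "norm (c w) \<le> norm (3 / r * G w)" if "w \<in> space M" for w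
      using that order_trans[OF _ abs_ge_self, of "cmod (c w)" "3 * G w / r"] by simp
    then have "integrable M c"
      by (intro Bochner_Integration.integrable_bound[OF integrable_mult_right[OF G, of "3 / r"] m] AE_I2)
    then show ?thesis using m by simp
  qed
  have a: "a \<in> borel_measurable M" "integrable M a" using dir[of "(1, 0)" a] by (auto simp: norm_Pair)
  have b: "b \<in> borel_measurable M" "integrable M b" using dir[of "(0, 1)" b] by (auto simp: norm_Pair)
  define A where "A = (\<integral>w. a w \<partial>M)"
  define B where "B = (\<integral>w. b w \<partial>M)"
  have "((\<lambda>h. \<integral>w. q h w \<partial>M) \<longlongrightarrow> 0) (at 0)"
    unfolding tendsto_at_iff_sequentially
  proof (intro allI impI)
    fix X :: "nat \<Rightarrow> complex \<times> complex" assume X: "\<forall>i. X i \<in> UNIV - {0}" "X \<longlonglongrightarrow> 0"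
    \<comment> \<open>Only a tail of the sequence lies in the ball where the domination holds; hence
      the shifted sequence below.\<close>
    obtain N where N: "\<And>i. i \<ge> N \<Longrightarrow> norm (X i) < r"
      using X(2)[unfolded LIMSEQ_iff, rule_format, OF r(1)] by auto
    have "(\<lambda>i. \<integral>w. q (X (i + N)) w \<partial>M) \<longlonglongrightarrow> (\<integral>w. 0 \<partial>M)"
    proof (rule integral_dominated_convergence[where w="\<lambda>w. 3 / r * G w + cmod (a w) + cmod (b w)"])
      show "integrable M (\<lambda>w. 3 / r * G w + cmod (a w) + cmod (b w))" using a b G by auto
      show "(\<lambda>w. q (X (i + N)) w) \<in> borel_measurable M" for i
        unfolding q_def using N[of "i + N"] r a b
        by (intro borel_measurable_scaleR borel_measurable_diff meas borel_measurable_add borel_measurable_times z0 subsetD[OF r(2)]) (auto simp: dist_norm)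
      show "AE w in M. (\<lambda>i. q (X (i + N)) w) \<longlonglongrightarrow> 0"
      proof (rule AE_I2)
        fix w assume "w \<in> space M"
        from q0[OF this] X have "((\<lambda>h. q h w) \<circ> X) \<longlonglongrightarrow> 0" unfolding tendsto_at_iff_sequentially by blast
        from LIMSEQ_ignore_initial_segment[OF this, of N] show "(\<lambda>i. q (X (i + N)) w) \<longlonglongrightarrow> 0" by simp
      qed
      show "AE w in M. norm (q (X (i + N)) w) \<le> 3 / r * G w + cmod (a w) + cmod (b w)" for i
      proof (rule AE_I2)
        fix w assume w: "w \<in> space M"
        let ?h = "X (i + N)"
        have h: "norm ?h > 0" "norm ?h < r" using X N by auto
        have "cmod (K (z0 + ?h) w - K z0 w - (a w * fst ?h + b w * snd ?h)) \<le> 3 * G w / r * norm ?h + (cmod (a w) * norm ?h + cmod (b w) * norm ?h)"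
        proof -
          have "cmod (a w * fst ?h) \<le> cmod (a w) * norm ?h" "cmod (b w * snd ?h) \<le> cmod (b w) * norm ?h"
            using norm_fst_le[of "fst ?h" "snd ?h"] norm_snd_le[of "snd ?h" "fst ?h"] by (auto simp: norm_mult intro!: mult_left_mono)
          with lip[OF h(2) w] norm_triangle_ineq4[of "K (z0 + ?h) w - K z0 w" "a w * fst ?h + b w * snd ?h"]
            norm_triangle_ineq[of "a w * fst ?h" "b w * snd ?h"]
          show ?thesis by linarith
        qed
        then show "norm (q ?h w) \<le> 3 / r * G w + cmod (a w) + cmod (b w)"
          unfolding q_def norm_scaleR using h r(1) by (simp add: field_simps)
      qed
    qed auto
    then have "(\<lambda>i. (\<lambda>h. \<integral>w. q h w \<partial>M) (X (i + N))) \<longlonglongrightarrow> 0" by simp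
    then show "((\<lambda>h. \<integral>w. q h w \<partial>M) \<circ> X) \<longlonglongrightarrow> 0"
      unfolding o_def by (rule LIMSEQ_offset)
  qed
  moreover have "\<forall>\<^sub>F h in at 0. (\<integral>w. q h w \<partial>M) = ((\<integral>w. K (z0 + h) w \<partial>M) - (\<integral>w. K z0 w \<partial>M) - (A * fst h + B * snd h)) /\<^sub>R norm h"
  proof -
    have "\<forall>\<^sub>F h :: complex \<times> complex in at 0. norm h < r" 
      unfolding eventually_at using r by (intro exI[of _ r]) auto
    then show ?thesis
    proof eventually_elim
      case (elim h)
      have "integrable M (K (z0 + h))" "integrable M (K z0)" using elim r by (auto intro!: intK simp: dist_norm)
      then show ?case unfolding q_def A_def B_def using a b
        by (simp del: scaleR_conv_of_real)
    qed
  qed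
  ultimately have "((\<lambda>h. ((\<integral>w. K (z0 + h) w \<partial>M) - (\<integral>w. K z0 w \<partial>M) - (A * fst h + B * snd h)) /\<^sub>R norm h) \<longlongrightarrow> 0) (at 0)"
    by (rule Lim_transform_eventually)
  then have "((\<lambda>z. \<integral>w. K z w \<partial>M) has_derivative (\<lambda>h. A * fst h + B * snd h)) (at z0)"
    unfolding has_derivative_at
    by (subst (asm) tendsto_norm_zero_iff[symmetric])
       (auto simp: divide_inverse mult.commute intro!: bounded_linear_intros)
  then show "\<exists>a b. ((\<lambda>z. \<integral>w. K z w \<partial>M) has_derivative (\<lambda>h. a * fst h + b * snd h)) (at z0 within \<Omega>)"
    using has_derivative_at_withinI by blast
qed

section \<open>Mean values and isolated singularities in one complex variable\<close>

lemma integral_lborel_translate: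
  fixes F :: "complex \<Rightarrow> 'a::{banach, second_countable_topology}"
  assumes [measurable]: "F \<in> borel_measurable borel"
  shows "(\<integral>z. F (c + z) \<partial>lborel) = (\<integral>z. F z \<partial>lborel)"
    and "integrable lborel F \<Longrightarrow> integrable lborel (\<lambda>z. F (c + z))"
proof -
  have "(\<integral>z. F z \<partial>lborel) = (\<integral>z. F z \<partial>distr lborel borel ((+) c))" by (simp add: lborel_distr_plus)
  also have "\<dots> = (\<integral>z. F (c + z) \<partial>lborel)" by (rule integral_distr) auto
  finally show "(\<integral>z. F (c + z) \<partial>lborel) = (\<integral>z. F z \<partial>lborel)" by simp
  assume "integrable lborel F"
  then have "integrable (distr lborel borel ((+) c)) F" by (simp add: lborel_distr_plus)
  then show "integrable lborel (\<lambda>z. F (c + z))" by (subst (asm) integrable_distr_eq) auto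
qed

lemma integral_ball_mean:
  assumes f: "f holomorphic_on ball c r" and r: "r \<ge> 0" and int: "integrable lborel (\<lambda>z. indicator (ball c r) z * f z)"
  shows "(\<integral>z. indicator (ball c r) z * f z \<partial>lborel) = f c * of_real (pi * r\<^sup>2)"
proof -
  define g where "g z = f (c + z)" for z
  have g: "g holomorphic_on ball 0 r" unfolding g_def
    by (rule holomorphic_on_compose_gen[OF _ f, unfolded o_def]) (auto intro!: holomorphic_intros simp: dist_norm)
  have eq: "indicator (ball c r) (c + z) * f (c + z) = indicator (ball 0 r) z * g z" for z
    by (auto simp: g_def indicator_def dist_norm)
  have m: "(\<lambda>z. indicator (ball c r) z * f z) \<in> borel_measurable borel"
    by (rule borel_measurable_holomorphic_indicator[OF f]) auto
  from integral_lborel_translate(2)[OF m int, of c]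
  have i: "integrable lborel (\<lambda>z. indicator (ball 0 r) z * g z)" unfolding eq .
  have "(\<integral>z. indicator (ball c r) z * f z \<partial>lborel) = (\<integral>z. indicator (ball 0 r) z * g z \<partial>lborel)"
    using integral_lborel_translate(1)[OF m, of c] unfolding eq by simp
  also have "\<dots> = g 0 * of_real (pi * r\<^sup>2)"
    using integral_ball_coeff[OF g, of "\<lambda>_. 1" 0] i r content_ball[OF r, of "0 :: complex"] by (simp add: unit_ball_vol_numeral)
  finally show ?thesis by (simp add: g_def)
qed

lemma nn_integral_ball_powr:
  assumes s: "s > -2" and R: "R \<ge> 0"
  shows "(\<integral>\<^sup>+z. ennreal (cmod z powr s) * indicator (ball 0 R) z \<partial>lborel) = ennreal (2 * pi * R powr (s + 2) / (s + 2))"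
proof -
  have "(\<integral>\<^sup>+z. ennreal (cmod z powr s) * indicator (ball 0 R) z \<partial>lborel)
     = (\<integral>\<^sup>+z. ennreal (((cmod (z::complex))\<^sup>2) powr (s / 2)) * indicator {..<R\<^sup>2} ((cmod z)\<^sup>2) \<partial>lborel)"
  proof (intro nn_integral_cong)
    fix z :: complex
    have "((cmod z)\<^sup>2) powr (s / 2) = cmod z powr s"
      using powr_powr[of "cmod z" 2 "s / 2"] by simp
    moreover have "cmod z < R \<longleftrightarrow> (cmod z)\<^sup>2 < R\<^sup>2" using R by (meson norm_ge_zero power2_less_imp_less power_strict_mono zero_less_numeral)
    ultimately show "ennreal (cmod z powr s) * indicator (ball 0 R) z = ennreal (((cmod z)\<^sup>2) powr (s / 2)) * indicator {..<R\<^sup>2} ((cmod z)\<^sup>2)"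
      by (auto simp: indicator_def)
  qed
  also have "\<dots> = ennreal pi * (\<integral>\<^sup>+x. ennreal (x powr (s / 2)) * indicator {..<R\<^sup>2} x * indicator {0..} x \<partial>lborel)"
    by (rule nn_integral_radial) measurable
  also have "(\<integral>\<^sup>+x. ennreal (x powr (s / 2)) * indicator {..<R\<^sup>2} x * indicator {0..} x \<partial>lborel) = (\<integral>\<^sup>+x. ennreal (x powr (s / 2)) * indicator {0..R\<^sup>2} x \<partial>lborel)"
    by (rule nn_integral_cong_AE, rule AE_mp[OF AE_lborel_singleton[of "R\<^sup>2"]]) (auto simp: indicator_def)
  also have "\<dots> = ennreal ((R\<^sup>2) powr (s / 2 + 1) / (s / 2 + 1))"
    using s by (intro nn_integral_powr_from_0) auto
  also have "(R\<^sup>2) powr (s / 2 + 1) / (s / 2 + 1) = 2 * R powr (s + 2) / (s + 2)"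
  proof -
    have "(R\<^sup>2) powr (s / 2 + 1) = R powr (s + 2)"
      using powr_powr[of R 2 "s / 2 + 1"] R by (simp add: algebra_simps)
    then show ?thesis using s by (simp add: field_simps)
  qed
  finally show ?thesis using s by (simp add: ennreal_mult[symmetric] mult_ac)
qed

lemma integral_ball_powr:
  assumes s: "s > -2" and R: "R \<ge> 0"
  shows "integrable lborel (\<lambda>z. indicator (ball 0 R) z * cmod z powr s)"
    and "(\<integral>z. indicator (ball 0 R) z * cmod z powr s \<partial>lborel) = 2 * pi * R powr (s + 2) / (s + 2)"
proof -
  have "(\<integral>\<^sup>+z. ennreal (indicator (ball 0 R) z * cmod z powr s) \<partial>lborel) = ennreal (2 * pi * R powr (s + 2) / (s + 2))"
    unfolding nn_integral_ball_powr[OF assms, symmetric]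
    by (intro nn_integral_cong) (auto simp: indicator_def)
  then have "integrable lborel (\<lambda>z. indicator (ball 0 R) z * cmod z powr s) \<and>
     (\<integral>z. indicator (ball 0 R) z * cmod z powr s \<partial>lborel) = 2 * pi * R powr (s + 2) / (s + 2)"
    using s by (subst nn_integral_eq_integrable[symmetric]) (measurable, auto)
  then show "integrable lborel (\<lambda>z. indicator (ball 0 R) z * cmod z powr s)"
    "(\<integral>z. indicator (ball 0 R) z * cmod z powr s \<partial>lborel) = 2 * pi * R powr (s + 2) / (s + 2)" by auto
qed

text \<open>The real part of \<open>(1 + c) / (1 - c)\<close> is \<open>(1 - \<bar>c\<bar>\<^sup>2) / \<bar>1 - c\<bar>\<^sup>2\<close>, so the mean value property evaluates
  the angular integral of \<open>1 / \<bar>1 - c\<bar>\<^sup>2\<close>.\<close>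

lemma nn_integral_angular:
  fixes \<omega> :: "real \<Rightarrow> real"
  assumes [measurable]: "\<omega> \<in> borel_measurable borel" and \<omega>: "\<And>x. 0 \<le> \<omega> x" 
    and int: "integrable lborel (\<lambda>z::complex. indicator (ball 0 R) z * \<omega> (cmod z))"
    and R: "0 < R" and A: "cmod A * R ^ m < 1" and m: "m > 0"
  shows "(\<integral>\<^sup>+w. ennreal (\<omega> (cmod w) / (cmod (1 - A * cnj w ^ m))\<^sup>2) * indicator (ball 0 R) w \<partial>lborel)
     = (\<integral>\<^sup>+w. ennreal (\<omega> (cmod (w::complex)) / (1 - (cmod A * cmod w ^ m)\<^sup>2)) * indicator (ball 0 R) w \<partial>lborel)"
proof -
  \<comment> \<open>The conjugate of \<open>A * cnj w ^ m\<close>: it is holomorphic in w, and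
    \<open>1 - c w\<close> keeps the modulus.\<close>
  define c where "c w = cnj A * w ^ m" for w
  define q where "q = cmod A * R ^ m"
  have q: "0 \<le> q" "q < 1" using A R by (auto simp: q_def)
  have nc: "cmod (c w) = cmod A * cmod w ^ m" for w by (simp add: c_def norm_mult norm_power)
  have cq: "cmod (c w) \<le> q" if "cmod w < R" for w
    unfolding nc q_def using that by (intro mult_left_mono power_mono) auto
  have c1: "c w \<noteq> 1" if "cmod w < R" for w using cq[OF that] q by auto
  define g where "g w = (1 + c w) / (1 - c w)" for w
  have g: "g holomorphic_on ball 0 R" unfolding g_def c_def
    by (intro holomorphic_intros) (use c1 in \<open>auto simp: c_def\<close>)
  \<comment> \<open>The numerator 1 - |c|^2 of the real part is radial, so it can be divided out of
    the weight in advance.\<close>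
  define \<omega>' where "\<omega>' x = \<omega> x / (1 - (cmod A * x ^ m)\<^sup>2)" for x
  have [measurable]: "\<omega>' \<in> borel_measurable borel" unfolding \<omega>'_def by measurable
  have [measurable]: "ball (0::complex) R \<in> sets borel" by simp
  have den: "1 - (cmod A * cmod w ^ m)\<^sup>2 \<ge> 1 - q\<^sup>2" if "cmod w < R" for w
    using cq[OF that] by (simp add: nc[symmetric] power_mono)
  have q2: "1 - q\<^sup>2 > 0" using q by (simp add: power_less_one_iff abs_square_less_1)
  have \<omega>'0: "0 \<le> \<omega>' (cmod w)" if "cmod w < R" for w
    using den[OF that] q2 \<omega> by (auto simp: \<omega>'_def)
  have \<omega>'b: "\<omega>' (cmod w) \<le> \<omega> (cmod w) / (1 - q\<^sup>2)" if "cmod w < R" for w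
    unfolding \<omega>'_def using den[OF that] q2 \<omega> by (intro divide_left_mono mult_pos_pos) auto
  have i\<omega>': "integrable lborel (\<lambda>z::complex. indicator (ball 0 R) z * \<omega>' (cmod z))"
  proof (rule Bochner_Integration.integrable_bound)
    show "integrable lborel (\<lambda>z::complex. indicator (ball 0 R) z * \<omega> (cmod z) / (1 - q\<^sup>2))" using int by simp
    show "AE z in lborel. norm (indicator (ball 0 R) z * \<omega>' (cmod z)) \<le> norm (indicator (ball 0 R) z * \<omega> (cmod z) / (1 - q\<^sup>2))"
      using \<omega>'0 \<omega>'b \<omega> q2 by (intro AE_I2) (auto simp: indicator_def abs_mult)
    have "(\<lambda>z::complex. indicator (ball 0 R) z * \<omega>' (cmod z)) \<in> borel_measurable borel" by measurable
    then show "(\<lambda>z::complex. indicator (ball 0 R) z * \<omega>' (cmod z)) \<in> borel_measurable lborel" by simp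
  qed
  have mg: "(\<lambda>z. indicator (ball 0 R) z * g z) \<in> borel_measurable borel"
    by (rule borel_measurable_holomorphic_indicator[OF g]) auto
  have ng: "cmod (g w) \<le> 2 / (1 - q)" if "cmod w < R" for w
  proof -
    have "cmod (1 + c w) \<le> 2" using cq[OF that] q norm_triangle_ineq[of 1 "c w"] by simp
    moreover have "cmod (1 - c w) \<ge> 1 - q" using cq[OF that] norm_triangle_ineq2[of 1 "c w"] by simp
    ultimately show ?thesis using q unfolding g_def norm_divide by (intro frac_le) auto
  qed
  have iG: "integrable lborel (\<lambda>z. indicator (ball 0 R) z * (of_real (\<omega>' (cmod z)) * g z))"
  proof (rule Bochner_Integration.integrable_bound)
    show "integrable lborel (\<lambda>z::complex. 2 / (1 - q) * (indicator (ball 0 R) z * \<omega>' (cmod z)))" using i\<omega>' by simp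
    have "(\<lambda>z. (indicator (ball 0 R) z * g z) * of_real (\<omega>' (cmod z))) \<in> borel_measurable borel" using mg by measurable
    then show "(\<lambda>z. indicator (ball 0 R) z * (of_real (\<omega>' (cmod z)) * g z)) \<in> borel_measurable lborel" by (simp add: mult_ac)
    show "AE z in lborel. norm (indicator (ball 0 R) z * (of_real (\<omega>' (cmod z)) * g z)) \<le> norm (2 / (1 - q) * (indicator (ball 0 R) z * \<omega>' (cmod z)))"
    proof (intro AE_I2)
      fix z :: complex
      show "norm (indicator (ball 0 R) z * (of_real (\<omega>' (cmod z)) * g z)) \<le> norm (2 / (1 - q) * (indicator (ball 0 R) z * \<omega>' (cmod z)))"
        using mult_left_mono[OF ng \<omega>'0, of z z] \<omega>'0[of z] q by (auto simp: indicator_def norm_mult abs_mult mult_ac)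
    qed
  qed
  have "(\<integral>z. indicator (ball 0 R) z * (of_real (\<omega>' (cmod z)) * g z * cnj z ^ 0) \<partial>lborel)
    = (deriv ^^ 0) g 0 / fact 0 * of_real (\<integral>z. indicator (ball 0 R) z * (\<omega>' (cmod (z::complex)) * cmod z ^ (2 * 0)) \<partial>lborel)"
    by (rule integral_ball_coeff[OF g]) (use iG in auto)
  note eq0 = this
  have eq: "(\<integral>z. indicator (ball 0 R) z * (of_real (\<omega>' (cmod z)) * g z) \<partial>lborel) = of_real (\<integral>z. indicator (ball 0 R) z * \<omega>' (cmod (z::complex)) \<partial>lborel)"
  proof -
    have "g 0 = 1" using m by (simp add: g_def c_def power_0_left)
    with eq0 show ?thesis by simp
  qed
  have Re_eq: "Re (indicator (ball 0 R) w * (of_real (\<omega>' (cmod w)) * g w)) = indicator (ball 0 R) w * (\<omega> (cmod w) / (cmod (1 - A * cnj w ^ m))\<^sup>2)" for w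
  proof (cases "cmod w < R")
    case True
    have 1: "cmod (1 - A * cnj w ^ m) = cmod (1 - c w)"
      by (subst complex_mod_cnj[symmetric]) (simp add: c_def)
    have "Re (g w) = (1 - (cmod (c w))\<^sup>2) / (cmod (1 - c w))\<^sup>2"
      unfolding g_def Re_divide cmod_power2 by (simp add: power2_eq_square algebra_simps)
    then show ?thesis using True den[OF True] q2 unfolding 1 by (simp add: \<omega>'_def nc)
  qed auto
  have "(\<integral>\<^sup>+w. ennreal (\<omega> (cmod w) / (cmod (1 - A * cnj w ^ m))\<^sup>2) * indicator (ball 0 R) w \<partial>lborel)
      = (\<integral>\<^sup>+w. ennreal (Re (indicator (ball 0 R) w * (of_real (\<omega>' (cmod w)) * g w))) \<partial>lborel)"
    unfolding Re_eq by (intro nn_integral_cong) (auto simp: indicator_def)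
  also have "\<dots> = ennreal (\<integral>w. Re (indicator (ball 0 R) w * (of_real (\<omega>' (cmod w)) * g w)) \<partial>lborel)"
    by (rule nn_integral_eq_integral[OF integrable_Re[OF iG]], intro AE_I2, subst Re_eq) (use \<omega> in \<open>auto simp: indicator_def\<close>)
  also have "(\<integral>w. Re (indicator (ball 0 R) w * (of_real (\<omega>' (cmod w)) * g w)) \<partial>lborel) = (\<integral>z. indicator (ball 0 R) z * \<omega>' (cmod (z::complex)) \<partial>lborel)"
    unfolding integral_Re[OF iG] eq by simp
  also have "ennreal \<dots> = (\<integral>\<^sup>+w. ennreal (indicator (ball 0 R) w * \<omega>' (cmod (w::complex))) \<partial>lborel)"
    by (rule nn_integral_eq_integral[symmetric]) (use i\<omega>' \<omega>'0 in \<open>auto simp: indicator_def\<close>)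
  also have "\<dots> = (\<integral>\<^sup>+w. ennreal (\<omega> (cmod (w::complex)) / (1 - (cmod A * cmod w ^ m)\<^sup>2)) * indicator (ball 0 R) w \<partial>lborel)"
    by (intro nn_integral_cong) (auto simp: indicator_def \<omega>'_def)
  finally show ?thesis .
qed

lemma integral_set_jensen:
  fixes f :: "'a \<Rightarrow> real"
  assumes q: "1 < q" and [measurable]: "S \<in> sets M" and fin: "emeasure M S < \<infinity>"
    and m: "(\<lambda>x. indicator S x * f x) \<in> borel_measurable M" and f: "\<And>x. 0 \<le> f x"
    and int: "integrable M (\<lambda>x. indicator S x * f x powr q)"
  shows "integrable M (\<lambda>x. indicator S x * f x)"
    and "(\<integral>x. indicator S x * f x \<partial>M) powr q \<le> measure M S powr (q - 1) * (\<integral>x. indicator S x * f x powr q \<partial>M)"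
proof -
  let ?g = "\<lambda>x. indicator S x * f x"
  have e: "indicator S x * ?g x = ?g x" "indicator S x * ?g x powr q = indicator S x * f x powr q" for x :: 'a
    by (auto simp: indicator_def)
  note * = weighted_jensen[of "indicator S" M ?g q, unfolded e]
  have i: "integrable M (indicator S :: 'a \<Rightarrow> real)" using fin by simp
  show "integrable M ?g" using *(1) m f q int i by simp
  show "(\<integral>x. ?g x \<partial>M) powr q \<le> measure M S powr (q - 1) * (\<integral>x. indicator S x * f x powr q \<partial>M)"
    using *(2) m f q int i by simp
qed

text \<open>The mean value property on \<open>ball c (cmod c / 2)\<close> bounds \<open>\<bar>f c\<bar>\<^sup>q\<close> by \<open>o(\<bar>c\<bar> powr (- \<sigma> - 2))\<close>; the little-o is
  what handles the borderline case of equality in the last hypothesis.\<close>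

lemma punctured_disc_pole_order:
  fixes q \<sigma> :: real and k :: int
  assumes f: "f holomorphic_on ball 0 1 - {0}" and q: "1 < q" 
    and int: "integrable lborel (\<lambda>z. indicator (ball 0 1) z * (cmod (f z) powr q * cmod z powr \<sigma>))"
    and k: "q * real_of_int k + \<sigma> + 2 \<le> 0"
  shows "\<exists>g. g holomorphic_on ball 0 1 \<and> (\<forall>z\<in>ball 0 1 - {0}. f z = z powi (k + 1) * g z)"
proof -
  define J where "J \<rho> = (\<integral>z. indicator (ball 0 \<rho>) z * (cmod (f z) powr q * cmod z powr \<sigma>) \<partial>lborel)" for \<rho>
  \<comment> \<open>On \<open>ball c (cmod c / 2)\<close> the modulus stays between 1/2 and 3/2 of
    \<open>cmod c\<close>; the minimum serves both signs of \<sigma>.\<close>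
  define D where "D = min ((1/2) powr \<sigma>) ((3/2) powr \<sigma>)"
  have D: "D > 0" by (simp add: D_def)
  have wlow: "D * cmod c powr \<sigma> \<le> cmod w powr \<sigma>" if "c \<noteq> 0" "w \<in> ball c (cmod c / 2)" for c w
  proof -
    have "cmod w \<le> 3/2 * cmod c" "1/2 * cmod c \<le> cmod w"
      using that norm_triangle_ineq2[of w c] norm_triangle_ineq2[of c w] by (auto simp: dist_norm norm_minus_commute)
    moreover have "0 < cmod w" "0 < cmod c" using that calculation by auto
    ultimately show ?thesis
    proof (cases "\<sigma> \<ge> 0")
      case True
      have "D * cmod c powr \<sigma> \<le> (1/2) powr \<sigma> * cmod c powr \<sigma>" by (intro mult_right_mono) (auto simp: D_def)
      also have "\<dots> = (1/2 * cmod c) powr \<sigma>" by (simp add: powr_mult[symmetric])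
      also have "\<dots> \<le> cmod w powr \<sigma>" using True \<open>1/2 * cmod c \<le> cmod w\<close> by (intro powr_mono2) auto
      finally show ?thesis .
    next
      case False
      have "D * cmod c powr \<sigma> \<le> (3/2) powr \<sigma> * cmod c powr \<sigma>" by (intro mult_right_mono) (auto simp: D_def)
      also have "\<dots> = (3/2 * cmod c) powr \<sigma>" by (simp only: powr_mult[symmetric])
      also have "\<dots> \<le> cmod w powr \<sigma>" using False \<open>cmod w \<le> 3/2 * cmod c\<close> \<open>0 < cmod w\<close> by (intro powr_mono2') auto
      finally show ?thesis .
    qed
  qed
  have meas: "(\<lambda>z. indicator (ball c r) z * (cmod (f z) powr q * cmod z powr \<sigma>)) \<in> borel_measurable borel" if sub: "ball c r \<subseteq> ball 0 1" for c r
  proof -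
    have 1: "(\<lambda>z. indicator (ball 0 1) z * (cmod (f z) powr q * cmod z powr \<sigma>)) \<in> borel_measurable borel"
      using int by (auto dest: borel_measurable_integrable)
    have "indicator (ball c r) z * (indicator (ball 0 1) z * (cmod (f z) powr q * cmod z powr \<sigma>)) = indicator (ball c r) z * (cmod (f z) powr q * cmod z powr \<sigma>)" for z
      using sub by (auto simp: indicator_def)
    moreover have "(\<lambda>z. indicator (ball c r) z * (indicator (ball 0 1) z * (cmod (f z) powr q * cmod z powr \<sigma>))) \<in> borel_measurable borel"
      by (intro borel_measurable_times 1 borel_measurable_indicator) auto
    ultimately show ?thesis by (simp only:)
  qed
  have intsub: "integrable lborel (\<lambda>z. indicator (ball c r) z * (cmod (f z) powr q * cmod z powr \<sigma>))" if "ball c r \<subseteq> ball 0 1" for c r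
  proof (rule Bochner_Integration.integrable_bound[OF int])
    show "(\<lambda>z. indicator (ball c r) z * (cmod (f z) powr q * cmod z powr \<sigma>)) \<in> borel_measurable lborel" using meas[OF that] by simp
    show "AE z in lborel. norm (indicator (ball c r) z * (cmod (f z) powr q * cmod z powr \<sigma>)) \<le> norm (indicator (ball 0 1) z * (cmod (f z) powr q * cmod z powr \<sigma>))"
      using that by (intro AE_I2) (auto simp: indicator_def)
  qed
  have bound: "cmod (f c) powr q \<le> 4 / (pi * D) * cmod c powr (- \<sigma> - 2) * J (2 * cmod c)"
    if c: "c \<noteq> 0" "cmod c < 1/2" for c
  proof -
    define r where "r = cmod c / 2"
    have r: "r > 0" using c by (simp add: r_def)
    have near: "cmod w < 3/2 * cmod c" "w \<noteq> 0" if "w \<in> ball c r" for w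
      using that norm_triangle_ineq[of c "w - c"] c by (auto simp: r_def dist_norm norm_minus_commute)
    have sub: "ball c r \<subseteq> ball 0 1 - {0}"
    proof
      fix w assume "w \<in> ball c r" from near[OF this] c show "w \<in> ball 0 1 - {0}" by simp
    qed
    have sub2: "ball c r \<subseteq> ball 0 (2 * cmod c)"
    proof
      fix w assume "w \<in> ball c r" from near(1)[OF this] have "cmod w < 2 * cmod c" using zero_less_norm_iff[of c] c(1) by linarith
      then show "w \<in> ball 0 (2 * cmod c)" by simp
    qed
    have hf: "f holomorphic_on ball c r" using f sub holomorphic_on_subset by blast
    have mf: "(\<lambda>z. indicator (ball c r) z * f z) \<in> borel_measurable borel"
      by (rule borel_measurable_holomorphic_indicator[OF hf]) auto
    have pw: "indicator (ball c r) z * cmod (f z) powr q \<le> 1 / (D * cmod c powr \<sigma>) * (indicator (ball 0 (2 * cmod c)) z * (cmod (f z) powr q * cmod z powr \<sigma>))" for z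
    proof (cases "z \<in> ball c r")
      case True
      have "D * cmod c powr \<sigma> * cmod (f z) powr q \<le> cmod z powr \<sigma> * cmod (f z) powr q"
        using wlow[of c z] True c by (intro mult_right_mono) (auto simp: r_def)
      then show ?thesis using True sub2 D c by (auto simp: field_simps)
    qed (use D in auto)
    have eq: "norm (indicator (ball c r) z * f z) = indicator (ball c r) z * cmod (f z)" for z by (auto simp: indicator_def)
    have eqq: "indicator (ball c r) z * cmod (f z) powr q = (norm (indicator (ball c r) z * f z)) powr q" for z
      using q by (auto simp: indicator_def)
    have iJ: "integrable lborel (\<lambda>z. indicator (ball 0 (2 * cmod c)) z * (cmod (f z) powr q * cmod z powr \<sigma>))"
      by (rule intsub) (use c in auto)
    have iq: "integrable lborel (\<lambda>z. indicator (ball c r) z * cmod (f z) powr q)"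
    proof (rule Bochner_Integration.integrable_bound)
      show "integrable lborel (\<lambda>z. 1 / (D * cmod c powr \<sigma>) * (indicator (ball 0 (2 * cmod c)) z * (cmod (f z) powr q * cmod z powr \<sigma>)))" 
        using iJ by simp
      have "(\<lambda>z. (norm (indicator (ball c r) z * f z)) powr q) \<in> borel_measurable borel"
        using mf by measurable
      then show "(\<lambda>z. indicator (ball c r) z * cmod (f z) powr q) \<in> borel_measurable lborel" unfolding eqq by simp
      have "norm (indicator (ball c r) z * cmod (f z) powr q) = indicator (ball c r) z * cmod (f z) powr q" for z by (simp add: abs_mult)
      then show "AE z in lborel. norm (indicator (ball c r) z * cmod (f z) powr q) \<le> norm (1 / (D * cmod c powr \<sigma>) * (indicator (ball 0 (2 * cmod c)) z * (cmod (f z) powr q * cmod z powr \<sigma>)))"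
        by (intro AE_I2) (simp only: real_norm_def, rule order_trans[OF pw abs_ge_self])
    qed
    have fin: "emeasure lborel (ball c r) < \<infinity>" by (simp add: emeasure_ball r less_imp_le)
    have m1: "(\<lambda>z. indicator (ball c r) z * cmod (f z)) \<in> borel_measurable lborel"
      using measurable_compose[OF mf borel_measurable_norm] unfolding eq by simp
    have jen: "integrable lborel (\<lambda>z. indicator (ball c r) z * cmod (f z))"
       "(\<integral>z. indicator (ball c r) z * cmod (f z) \<partial>lborel) powr q \<le> measure lborel (ball c r) powr (q - 1) * (\<integral>z. indicator (ball c r) z * cmod (f z) powr q \<partial>lborel)"
      using integral_set_jensen[OF q _ fin m1 norm_ge_zero iq] by auto
    have vol: "measure lborel (ball c r) = pi * r\<^sup>2" using content_ball[of r c] r by (simp add: unit_ball_vol_numeral)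
    have i1: "integrable lborel (\<lambda>z. indicator (ball c r) z * f z)"
      by (rule Bochner_Integration.integrable_bound[OF jen(1)]) (use mf in \<open>auto simp: eq\<close>)
    have "cmod (f c) * (pi * r\<^sup>2) = norm (\<integral>z. indicator (ball c r) z * f z \<partial>lborel)"
      unfolding integral_ball_mean[OF hf less_imp_le[OF r] i1] norm_mult norm_of_real by simp
    also have "\<dots> \<le> (\<integral>z. norm (indicator (ball c r) z * f z) \<partial>lborel)"
      by (rule integral_norm_bound)
    finally have "cmod (f c) * (pi * r\<^sup>2) \<le> (\<integral>z. indicator (ball c r) z * cmod (f z) \<partial>lborel)" unfolding eq .
    then have "(cmod (f c) * (pi * r\<^sup>2)) powr q \<le> (\<integral>z. indicator (ball c r) z * cmod (f z) \<partial>lborel) powr q"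
      using q by (intro powr_mono2) auto
    also note jen(2)
    also have "(\<integral>z. indicator (ball c r) z * cmod (f z) powr q \<partial>lborel) \<le> (\<integral>z. 1 / (D * cmod c powr \<sigma>) * (indicator (ball 0 (2 * cmod c)) z * (cmod (f z) powr q * cmod z powr \<sigma>)) \<partial>lborel)"
      by (rule integral_mono[OF iq _ pw]) (use iJ in simp)
    also have "\<dots> = 1 / (D * cmod c powr \<sigma>) * J (2 * cmod c)" by (simp add: J_def)
    finally have "(cmod (f c) * (pi * r\<^sup>2)) powr q \<le> (pi * r\<^sup>2) powr (q - 1) * (1 / (D * cmod c powr \<sigma>) * J (2 * cmod c))"
      by (simp add: vol mult_left_mono)
    moreover have "(cmod (f c) * (pi * r\<^sup>2)) powr q = cmod (f c) powr q * ((pi * r\<^sup>2) powr (q - 1) * (pi * r\<^sup>2))"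
      using r by (simp add: powr_mult powr_diff)
    ultimately have "(pi * r\<^sup>2) powr (q - 1) * (cmod (f c) powr q * (pi * r\<^sup>2)) \<le> (pi * r\<^sup>2) powr (q - 1) * (1 / (D * cmod c powr \<sigma>) * J (2 * cmod c))"
      by (simp add: mult_ac)
    then have "cmod (f c) powr q * (pi * r\<^sup>2) \<le> 1 / (D * cmod c powr \<sigma>) * J (2 * cmod c)"
      by (rule mult_left_le_imp_le) (use r in simp)
    then have "cmod (f c) powr q \<le> 1 / (D * cmod c powr \<sigma>) * J (2 * cmod c) / (pi * r\<^sup>2)"
      using r by (subst pos_le_divide_eq) simp_all
    also have "\<dots> = 4 / (pi * D) * (1 / (cmod c powr \<sigma> * (cmod c)\<^sup>2)) * J (2 * cmod c)"
      by (simp add: r_def power_divide mult_ac)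
    also have "1 / (cmod c powr \<sigma> * (cmod c)\<^sup>2) = cmod c powr (- \<sigma> - 2)"
      using c by (simp add: powr_diff powr_minus_divide)
    finally show ?thesis .
  qed
  \<comment> \<open>The little-o: the integral of one integrable function over shrinking balls tends
    to 0.\<close>
  have J0: "((\<lambda>z. J (2 * cmod z)) \<longlongrightarrow> 0) (at 0)"
    unfolding tendsto_at_iff_sequentially
  proof (intro allI impI)
    fix X :: "nat \<Rightarrow> complex" assume X: "\<forall>i. X i \<in> UNIV - {0}" "X \<longlonglongrightarrow> 0"
    obtain N where N: "\<And>i. i \<ge> N \<Longrightarrow> cmod (X i) < 1/2"
      using X(2)[unfolded LIMSEQ_iff, rule_format, of "1/2"] by auto
    have "(\<lambda>i. J (2 * cmod (X (i + N)))) \<longlonglongrightarrow> (\<integral>z. 0 \<partial>(lborel :: complex measure))"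
      unfolding J_def
    proof (rule integral_dominated_convergence[OF _ _ int])
      show "(\<lambda>z. indicator (ball 0 (2 * cmod (X (i + N)))) z * (cmod (f z) powr q * cmod z powr \<sigma>)) \<in> borel_measurable lborel" for i
        using meas[of 0 "2 * cmod (X (i + N))", OF subset_ball] N[of "i + N"] by simp
      show "AE z in lborel. norm (indicator (ball 0 (2 * cmod (X (i + N)))) z * (cmod (f z) powr q * cmod z powr \<sigma>))
         \<le> indicator (ball 0 1) z * (cmod (f z) powr q * cmod z powr \<sigma>)" for i
        using N[of "i + N"] by (intro AE_I2) (auto simp: indicator_def)
      show "AE z in lborel. (\<lambda>i. indicator (ball 0 (2 * cmod (X (i + N)))) z * (cmod (f z) powr q * cmod z powr \<sigma>)) \<longlonglongrightarrow> 0"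
      proof (intro AE_I2)
        fix z :: complex
        show "(\<lambda>i. indicator (ball 0 (2 * cmod (X (i + N)))) z * (cmod (f z) powr q * cmod z powr \<sigma>)) \<longlonglongrightarrow> 0"
        proof (cases "z = 0")
          case False
          have "(\<lambda>i. X (i + N)) \<longlonglongrightarrow> 0" using X(2) by (rule LIMSEQ_ignore_initial_segment)
          from this[unfolded LIMSEQ_iff, rule_format, of "cmod z / 2"] False 
          obtain N' where N': "\<And>i. i \<ge> N' \<Longrightarrow> cmod (X (i + N)) < cmod z / 2" by auto
          have "\<forall>\<^sub>F i in sequentially. indicator (ball 0 (2 * cmod (X (i + N)))) z * (cmod (f z) powr q * cmod z powr \<sigma>) = 0"
            unfolding eventually_sequentially 
          proof (intro exI[of _ N'] allI impI)
            fix i assume "N' \<le> i"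
            then show "indicator (ball 0 (2 * cmod (X (i + N)))) z * (cmod (f z) powr q * cmod z powr \<sigma>) = 0"
              using N'[of i] by simp
          qed
          then show ?thesis by (rule tendsto_eventually)
        qed simp
      qed
    qed auto
    then have "(\<lambda>i. J (2 * cmod (X (i + N)))) \<longlonglongrightarrow> 0" by simp
    then show "((\<lambda>z. J (2 * cmod z)) \<circ> X) \<longlonglongrightarrow> 0"
      unfolding o_def by (rule LIMSEQ_offset)
  qed
  \<comment> \<open>f divided by the claimed power of z. If z F(z) tends to 0 at the origin, the
    singularity of F is removable.\<close>
  define F where "F z = z powi (- (k + 1)) * f z" for z
  have hF: "F holomorphic_on ball 0 1 - {0}" unfolding F_def
    by (intro holomorphic_intros f) auto
  have Fq: "cmod ((z - 0) * F z) powr q \<le> 4 / (pi * D) * J (2 * cmod z)" if z: "z \<noteq> 0" "cmod z < 1/2" for z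
  proof -
    have J: "0 \<le> J x" for x unfolding J_def by (rule Bochner_Integration.integral_nonneg) auto
    have "(z - 0) * F z = z powi (- k) * f z"
    proof -
      have "z * z powi (- (k + 1)) = z powi (1 + (- (k + 1)))" using z by (subst power_int_add) auto
      then show ?thesis by (simp add: F_def mult.assoc[symmetric])
    qed
    then have "cmod ((z - 0) * F z) = cmod z powr (- real_of_int k) * cmod (f z)"
      using z powr_real_of_int'[of "cmod z" "- k"] by (simp add: norm_mult norm_power_int)
    then have "cmod ((z - 0) * F z) powr q = cmod z powr (- real_of_int k * q) * cmod (f z) powr q"
      by (simp add: powr_mult powr_powr)
    also have "\<dots> \<le> cmod z powr (- real_of_int k * q) * (4 / (pi * D) * cmod z powr (- \<sigma> - 2) * J (2 * cmod z))"
      by (intro mult_left_mono bound z) auto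
    also have "\<dots> = 4 / (pi * D) * J (2 * cmod z) * (cmod z powr (- real_of_int k * q) * cmod z powr (- \<sigma> - 2))"
      by (simp only: mult_ac)
    also have "cmod z powr (- real_of_int k * q) * cmod z powr (- \<sigma> - 2) = cmod z powr (- (q * real_of_int k + \<sigma> + 2))"
      by (simp add: powr_add[symmetric] algebra_simps)
    \<comment> \<open>By the hypothesis on k the exponent is nonnegative, so the power is at most 1
      and can be discarded; the limit 0 will come from \<open>J\<close>.\<close>
    also have "4 / (pi * D) * J (2 * cmod z) * cmod z powr (- (q * real_of_int k + \<sigma> + 2)) \<le> 4 / (pi * D) * J (2 * cmod z) * 1"
    proof (rule mult_left_mono)
      show "cmod z powr (- (q * real_of_int k + \<sigma> + 2)) \<le> 1" using k z by (intro powr_le1) auto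
    qed (use D J in simp)
    finally show ?thesis by simp
  qed
  have "((\<lambda>z. cmod ((z - 0) * F z) powr q) \<longlongrightarrow> 0) (at 0)"
  proof (rule tendsto_sandwich[of "\<lambda>_. 0"])
    show "\<forall>\<^sub>F z in at 0. cmod ((z - 0) * F z) powr q \<le> 4 / (pi * D) * J (2 * cmod z)"
      unfolding eventually_at using Fq by (intro exI[of _ "1/2"]) (auto simp: dist_norm)
    show "((\<lambda>z. 4 / (pi * D) * J (2 * cmod z)) \<longlongrightarrow> 0) (at 0)"
      using tendsto_mult_left[OF J0, of "4 / (pi * D)"] by simp
  qed auto
  from tendsto_zero_powrI[OF this tendsto_const[of "1 / q"]] q
  have "((\<lambda>z. cmod ((z - 0) * F z)) \<longlongrightarrow> 0) (at 0)" by (simp add: powr_powr)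
  then have "((\<lambda>z. (z - 0) * F z) \<longlongrightarrow> 0) (at 0)" by (rule tendsto_norm_zero_cancel)
  then obtain g where g: "g holomorphic_on ball 0 1" "\<And>z. z \<in> ball 0 1 - {0} \<Longrightarrow> g z = F z"
    using holomorphic_on_extend_lim[OF hF] by auto
  show ?thesis
  proof (intro exI conjI ballI)
    fix z :: complex assume z: "z \<in> ball 0 1 - {0}"
    have "z powi (k + 1) * z powi (- (k + 1)) = z powi (k + 1 + (- (k + 1)))" using z by (subst power_int_add) auto
    then have "z powi (k + 1) * z powi (- (k + 1)) = 1" by simp
    then show "f z = z powi (k + 1) * g z" 
      using g(2)[OF z] unfolding F_def by (simp only: mult.assoc[symmetric]) simp
  qed (rule g(1))
qed

lemma integral_ball_power:
  assumes R: "R \<ge> 0"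
  shows "(\<integral>z. indicator (ball 0 R) z * cmod z ^ (2 * k) \<partial>lborel) = pi * R ^ (2 * k + 2) / (real k + 1)"
proof -
  have [measurable]: "ball (0::complex) R \<in> sets borel" by simp
  have "(\<integral>z. indicator (ball 0 R) z * cmod z ^ (2 * k) \<partial>lborel) = (\<integral>z. indicator (ball 0 R) z * cmod z powr (2 * real k) \<partial>lborel)"
  proof (rule integral_cong_AE)
    \<comment> \<open>For k = 0 the integrands differ at the origin: \<open>0 powr 0\<close> is 0
      while \<open>0 ^ 0\<close> is 1.\<close>
    have "AE z in lborel. z \<noteq> (0 :: complex)" by (rule AE_lborel_singleton)
    then show "AE z in lborel. indicator (ball 0 R) z * cmod z ^ (2 * k) = indicator (ball 0 R) z * cmod z powr (2 * real k)"
    proof eventually_elim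
      case (elim z)
      then show ?case using powr_realpow[of "cmod z" "2 * k"] by simp
    qed
  qed measurable
  also have "\<dots> = 2 * pi * R powr (2 * real k + 2) / (2 * real k + 2)"
    by (rule integral_ball_powr) (use R in auto)
  also have "R powr (2 * real k + 2) = R ^ (2 * k + 2)"
    using powr_realpow'[OF R, of "2 * k + 2"] by (simp add: algebra_simps)
  also have "2 * pi * R ^ (2 * k + 2) / (2 * real k + 2) = pi * R ^ (2 * k + 2) / (real k + 1)"
    by (simp add: field_simps)
  finally show ?thesis .
qed

subsection \<open>Laurent expansions on the Hartogs domain\<close>

locale hartogs_domain =
  fixes m n :: nat and p :: real
  assumes m: "m > 0" and n: "n > 0" and p: "2 \<le> p"
begin

text \<open>The slice of the domain over \<open>z2\<close> is the disc of radius
  \<open>cmod z2 powr gam\<close>.\<close>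

definition gam :: real where "gam = real n / real m"

abbreviation Om where "Om \<equiv> hartogs m n"
text \<open>Lebesgue measure on Borel sets, not its completion, so that the product structure and
  Fubini's theorem apply directly.\<close>

abbreviation MM where "MM \<equiv> restrict_space lborel Om"

lemma gam: "gam > 0" using m n by (simp add: gam_def)

lemma Om_iff: "(z1, z2) \<in> Om \<longleftrightarrow> cmod z1 < cmod z2 powr gam \<and> cmod z2 < 1"
proof -
  have "cmod z1 powr (real m / real n) < cmod z2 \<longleftrightarrow> cmod z1 < cmod z2 powr gam"
  proof
    assume "cmod z1 powr (real m / real n) < cmod z2"
    then have "(cmod z1 powr (real m / real n)) powr gam < cmod z2 powr gam"
      using gam by (intro powr_less_mono2) auto
    then show "cmod z1 < cmod z2 powr gam" using m n by (simp add: powr_powr gam_def)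
  next
    assume "cmod z1 < cmod z2 powr gam"
    then have "cmod z1 powr (real m / real n) < (cmod z2 powr gam) powr (real m / real n)"
      using m n by (intro powr_less_mono2) auto
    then show "cmod z1 powr (real m / real n) < cmod z2" using m n by (simp add: powr_powr gam_def)
  qed
  then show ?thesis by (simp add: hartogs_def)
qed

lemma Om_snd: "z \<in> Om \<Longrightarrow> snd z \<noteq> 0"
  by (cases z) (auto simp: Om_iff)

lemma open_Om: "open Om"
proof -
  have "Om = {z. cmod (fst z) powr (real m / real n) < cmod (snd z)} \<inter> {z. cmod (snd z) < 1}"
    by (auto simp: hartogs_def)
  also have "open \<dots>"
    using m n by (intro open_Int open_Collect_less continuous_on_powr' continuous_intros) auto
  finally show ?thesis .
qed

lemma Om_borel [measurable]: "Om \<in> sets borel"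
  using open_Om by simp

lemma Om_bounded: "Om \<subseteq> ball 0 2"
proof
  fix z assume "z \<in> Om"
  then obtain z1 z2 where z: "z = (z1, z2)" "cmod z1 < cmod z2 powr gam" "cmod z2 < 1" by (cases z) (auto simp: Om_iff)
  have "cmod z2 powr gam \<le> 1" using z gam by (intro powr_le1) auto
  then have "(cmod z1)\<^sup>2 \<le> 1" "(cmod z2)\<^sup>2 \<le> 1" using z power_le_one[of "cmod z1" 2] power_le_one[of "cmod z2" 2] by simp_all
  then have "(norm z)\<^sup>2 < 2\<^sup>2" unfolding z norm_Pair by simp
  then have "norm z < 2" by (rule power2_less_imp_less) simp
  then show "z \<in> ball 0 2" by simp
qed

lemma emeasure_Om: "emeasure lborel Om < \<infinity>"
proof -
  have "emeasure lborel Om \<le> emeasure lborel (ball 0 2 :: (complex \<times> complex) set)"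
    by (rule emeasure_mono[OF Om_bounded]) simp
  also have "\<dots> < \<infinity>" by (simp add: emeasure_ball)
  finally show ?thesis .
qed

lemma space_MM [simp]: "space MM = Om" by (simp add: space_restrict_space)

lemma finite_MM: "finite_measure MM"
  using emeasure_Om by (intro finite_measureI) (simp add: emeasure_restrict_space space_restrict_space)

sublocale MM: finite_measure MM by (rule finite_MM)
sublocale MMP: pair_sigma_finite MM MM ..

section \<open>Iterated integration over the slices\<close>

lemma indicator_Om: "indicator Om (z1, z2) = (indicator (ball 0 1) z2 * indicator (ball 0 (cmod z2 powr gam)) z1 :: 'a::{zero_neq_one, semiring_1})"
  by (auto simp: indicator_def Om_iff)

lemma integrable_MM_iterated:
  fixes F :: "complex \<times> complex \<Rightarrow> 'a::{banach, second_countable_topology}"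
  assumes F: "integrable MM F"
  shows "(\<integral>z. F z \<partial>MM) = (\<integral>z2. \<integral>z1. indicator Om (z1, z2) *\<^sub>R F (z1, z2) \<partial>lborel \<partial>lborel)"
    and "AE z2 in lborel. integrable lborel (\<lambda>z1. indicator Om (z1, z2) *\<^sub>R F (z1, z2))"
    and "integrable lborel (\<lambda>z2. \<integral>z1. indicator Om (z1, z2) *\<^sub>R F (z1, z2) \<partial>lborel)"
proof -
  have "integrable lborel (\<lambda>z. indicator Om z *\<^sub>R F z)"
    using F by (subst (asm) integrable_restrict_space) auto
  then have i: "integrable (lborel \<Otimes>\<^sub>M lborel) (\<lambda>(z1, z2). indicator Om (z1, z2) *\<^sub>R F (z1, z2))"
    by (simp add: lborel_prod case_prod_beta')
  have "(\<integral>z. F z \<partial>MM) = (\<integral>z. indicator Om z *\<^sub>R F z \<partial>lborel)"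
    by (rule integral_restrict_space) simp
  also have "\<dots> = (\<integral>(z1, z2). indicator Om (z1, z2) *\<^sub>R F (z1, z2) \<partial>(lborel \<Otimes>\<^sub>M lborel))"
    by (simp add: lborel_prod case_prod_beta')
  also have "\<dots> = (\<integral>z2. \<integral>z1. indicator Om (z1, z2) *\<^sub>R F (z1, z2) \<partial>lborel \<partial>lborel)"
    by (rule lborel_pair.integral_snd[OF i, symmetric])
  finally show "(\<integral>z. F z \<partial>MM) = (\<integral>z2. \<integral>z1. indicator Om (z1, z2) *\<^sub>R F (z1, z2) \<partial>lborel \<partial>lborel)" .
  show "AE z2 in lborel. integrable lborel (\<lambda>z1. indicator Om (z1, z2) *\<^sub>R F (z1, z2))"
    by (rule lborel_pair.AE_integrable_snd[OF i])
  show "integrable lborel (\<lambda>z2. \<integral>z1. indicator Om (z1, z2) *\<^sub>R F (z1, z2) \<partial>lborel)"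
    by (rule lborel_pair.integrable_snd[OF i])
qed

lemma nn_integral_MM_iterated:
  assumes "F \<in> borel_measurable MM"
  shows "(\<integral>\<^sup>+z. F z \<partial>MM) = (\<integral>\<^sup>+z2. \<integral>\<^sup>+z1. F (z1, z2) * indicator Om (z1, z2) \<partial>lborel \<partial>lborel)"
proof -
  have m: "(\<lambda>z. F z * indicator Om z) \<in> borel_measurable (lborel \<Otimes>\<^sub>M lborel)"
    using assms borel_measurable_restrict_space_iff_ennreal[of Om lborel F] by (simp add: lborel_prod)
  have "(\<integral>\<^sup>+z. F z \<partial>MM) = (\<integral>\<^sup>+z. F z * indicator Om z \<partial>(lborel \<Otimes>\<^sub>M lborel))"
    by (subst nn_integral_restrict_space) (auto simp: lborel_prod)
  then show ?thesis using lborel_pair.nn_integral_snd[OF m] by simp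
qed

text \<open>\<open>z\<^sub>1\<^sup>a z\<^sub>2\<^sup>b\<close> lies in \<open>L\<^sup>p\<close> iff \<open>n a + m b \<ge> min_weight\<close>, i.e. iff \<open>b \<ge> min_exponent a = \<lceil>(min_weight - n a) / m\<rceil>\<close>.\<close>

definition min_weight :: int where "min_weight = \<lfloor>- 2 * (real m + real n) / p\<rfloor> + 1"
definition min_exponent :: "nat \<Rightarrow> int" where "min_exponent a = - ((int n * int a - min_weight) div int m)"

section \<open>Arithmetic of the admissible exponents\<close>

lemma min_weight_bounds: "real_of_int min_weight > - 2 * (real m + real n) / p" "real_of_int min_weight - 1 \<le> - 2 * (real m + real n) / p"
  \<comment> \<open>Floor plus one, not ceiling: integrability is a strict inequality, and the two
    differ when the quotient is an integer.\<close>
  unfolding min_weight_def by linarith+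

lemma min_weight_le_0: "min_weight \<le> 0"
proof -
  have "- 2 * (real m + real n) / p < 0" using m p by (simp add: divide_neg_pos)
  then show ?thesis unfolding min_weight_def by linarith
qed

text \<open>The condition for square integrability is n a + m b > -(m + n), so for p \<ge> 2 every
  admissible monomial is square integrable. Positivity of the squared norms rests on this.\<close>

lemma min_weight_gt: "min_weight > - (int m + int n)"
proof -
  have "2 * (real m + real n) / p \<le> real m + real n"
    using p by (simp add: field_simps) (metis add_increasing2 add_mono mult_left_mono mult.commute of_nat_0_le_iff)
  moreover have "- 2 * (real m + real n) / p = - (2 * (real m + real n) / p)"
    by (simp only: mult_minus_left minus_divide_left)
  ultimately have "real_of_int min_weight > - (real m + real n)" using min_weight_bounds(1) by linarith
  then show ?thesis by linarith
qed

lemma min_exponent_ge: "int m * min_exponent a + int n * int a \<ge> min_weight"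
proof -
  have "int m * ((int n * int a - min_weight) div int m) \<le> int n * int a - min_weight"
    using m by (metis mult.commute div_mult_mod_eq add.commute le_add_same_cancel2 pos_mod_sign of_nat_0_less_iff)
  then show ?thesis by (simp add: min_exponent_def)
qed

lemma min_exponent_less: "int m * (min_exponent a - 1) + int n * int a < min_weight"
proof -
  have "int n * int a - min_weight < int m * ((int n * int a - min_weight) div int m) + int m"
    using m by (metis mult.commute div_mult_mod_eq add_less_cancel_left pos_mod_bound of_nat_0_less_iff)
  then show ?thesis by (simp add: min_exponent_def algebra_simps)
qed

text \<open>Multiplication by z1^m / z2^n leaves n a + m b unchanged. This periodicity reduces the
  infinitely many thresholds to m residue classes and makes a closed form of the kernel
  possible.\<close>

lemma min_exponent_shift: "min_exponent (j * m + r) = min_exponent r - int n * int j"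
proof -
  have "int n * int (j * m + r) - min_weight = (int n * int r - min_weight) + int n * int j * int m"
    by (simp add: algebra_simps)
  then show ?thesis unfolding min_exponent_def using m by (simp only:) (subst div_mult_self1, auto)
qed

text \<open>Failure of p-th power integrability one step below the threshold, written as the
  hypothesis of \<open>punctured_disc_pole_order\<close> for the weight exponent
  \<open>gam * (real a * p + 2)\<close>.\<close>

lemma min_exponent_pole: "p * real_of_int (min_exponent a - 1) + gam * (real a * p + 2) + 2 \<le> 0"
proof -
  have "int m * (min_exponent a - 1) + int n * int a \<le> min_weight - 1" using min_exponent_less[of a] by simp
  then have "real_of_int (int m * (min_exponent a - 1) + int n * int a) \<le> real_of_int (min_weight - 1)" by (simp only: of_int_le_iff)
  then have "real m * (real_of_int (min_exponent a) - 1) + real n * real a \<le> - 2 * (real m + real n) / p" 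
    using min_weight_bounds(2) by simp
  then have "p * (real m * (real_of_int (min_exponent a) - 1) + real n * real a) \<le> - 2 * (real m + real n)"
    using p by (simp add: field_simps)
  then have "(p * (real m * (real_of_int (min_exponent a) - 1) + real n * real a) + 2 * (real m + real n)) / real m \<le> 0"
    using m by (simp add: divide_le_0_iff)
  then show ?thesis using m by (simp add: gam_def field_simps)
qed

text \<open>Slices are full discs, so only nonnegative powers of \<open>z1\<close> occur. As a
  function of \<open>z2\<close> the coefficient lives on the punctured disc; its singularity at 0
  carries the negative powers of the Laurent expansion.\<close>

definition slice_taylor :: "(complex \<times> complex \<Rightarrow> complex) \<Rightarrow> nat \<Rightarrow> complex \<Rightarrow> complex" where
  "slice_taylor h a z2 = (deriv ^^ a) (\<lambda>z1. h (z1, z2)) 0 / fact a"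

lemma slice_holomorphic:
  assumes h: "holomorphic2_on h Om" and z2: "cmod z2 < 1"
  shows "(\<lambda>z1. h (z1, z2)) holomorphic_on ball 0 (cmod z2 powr gam)"
  by (rule holomorphic2_on_compose_pair[OF h open_Om]) (use z2 in \<open>auto intro!: holomorphic_intros simp: Om_iff\<close>)

lemma slice_power_series:
  assumes h: "holomorphic2_on h Om" and z: "(z1, z2) \<in> Om"
  shows "(\<lambda>a. slice_taylor h a z2 * z1 ^ a) sums h (z1, z2)"
  using holomorphic_power_series[OF slice_holomorphic[OF h], of z2 z1] z by (simp add: slice_taylor_def Om_iff)

text \<open>The radius is left free: kept fixed while \<open>z2\<close> moves, it gives holomorphic
  dependence on \<open>z2\<close>; equal to the radius of the slice, it gives norm estimates and
  inner products.\<close>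

lemma slice_coeff:
  assumes h: "holomorphic2_on h Om" and z2: "cmod z2 < 1" and r: "0 \<le> r" "r \<le> cmod z2 powr gam"
    and int: "integrable lborel (\<lambda>z1. indicator (ball 0 r) z1 * (h (z1, z2) * cnj z1 ^ a))"
  shows "(\<integral>z1. indicator (ball 0 r) z1 * (h (z1, z2) * cnj z1 ^ a) \<partial>lborel) = slice_taylor h a z2 * of_real (pi * r ^ (2 * a + 2) / (real a + 1))"
proof -
  have "(\<lambda>z1. h (z1, z2)) holomorphic_on ball 0 r"
    by (rule holomorphic_on_subset[OF slice_holomorphic[OF h z2]]) (use r in auto)
  from integral_ball_coeff[OF this, of "\<lambda>_. 1" a] int
  show ?thesis by (simp add: slice_taylor_def integral_ball_power[OF r(1)])
qed

text \<open>Near a point \<open>c\<close> all slices contain one common disc. The coefficient is an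
  integral over that disc divided by a constant, hence holomorphic in \<open>z2\<close> by
  differentiation under the integral.\<close>

lemma slice_taylor_holomorphic:
  assumes h: "holomorphic2_on h Om"
  shows "slice_taylor h a holomorphic_on ball 0 1 - {0}"
proof -
  have "\<exists>d>0. slice_taylor h a holomorphic_on ball c d" if c: "c \<in> ball 0 1 - {0}" for c
  proof -
    define d where "d = min (cmod c / 2) (1 - cmod c)"
    have d: "d > 0" using c by (auto simp: d_def)
    \<comment> \<open>For \<open>z2\<close> in \<open>ball c d\<close> the modulus exceeds
      \<open>cmod c / 2\<close>, so this radius is smaller than that of every slice
      involved.\<close>
    define r where "r = (cmod c / 2) powr gam"
    have r: "r > 0" using c by (simp add: r_def)
    have low: "cmod z2 < 1 \<and> r < cmod z2 powr gam" if "z2 \<in> ball c d" for z2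
    proof -
      have "cmod z2 < 1" "cmod c / 2 < cmod z2"
        using that norm_triangle_ineq[of c "z2 - c"] norm_triangle_ineq2[of c "c - z2"] norm_triangle_ineq2[of c z2]
        by (auto simp: d_def dist_norm norm_minus_commute)
      then show ?thesis unfolding r_def using gam by (auto intro!: powr_less_mono2)
    qed
    have inOm: "(w, z2) \<in> Om" if "w \<in> cball 0 r" "z2 \<in> ball c d" for w z2
      using low[OF that(2)] that(1) by (auto simp: Om_iff)
    have conth: "continuous_on Om h" using h holomorphic2_on_imp_continuous_on by blast
    let ?M = "restrict_space lborel (ball (0::complex) r)"
    interpret B: finite_measure ?M
      using r by (intro finite_measureI) (simp add: emeasure_restrict_space space_restrict_space emeasure_ball)
    have mc: "(\<lambda>w. h (w, z2) * cnj w ^ a) \<in> borel_measurable ?M" if "z2 \<in> ball c d" for z2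
    proof -
      have "continuous_on (ball 0 r) (\<lambda>w. h (w, z2) * cnj w ^ a)"
        by (intro continuous_intros continuous_on_compose2[OF conth]) (use inOm that in auto)
      then show ?thesis
        by (subst measurable_cong_sets[OF sets_restrict_space_cong[OF sets_lborel] refl]) (rule borel_measurable_continuous_on_restrict)
    qed
    \<comment> \<open>A dummy first coordinate turns this integral, which depends on one variable,
      into an instance of \<open>holomorphic2_on_integral\<close>.\<close>
    have hol: "holomorphic2_on (\<lambda>\<zeta>. \<integral>w. h (w, snd \<zeta>) * cnj w ^ a \<partial>?M) (UNIV \<times> ball c d)"
    proof (rule holomorphic2_on_integral)
      show "open (UNIV \<times> ball c d :: (complex \<times> complex) set)" by (intro open_Times) auto
      show "(\<lambda>w. h (w, snd z) * cnj w ^ a) \<in> borel_measurable ?M" if "z \<in> UNIV \<times> ball c d" for z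
        using mc[of "snd z"] that by (auto simp: mem_Times_iff)
      show "holomorphic2_on (\<lambda>z. h (w, snd z) * cnj w ^ a) (UNIV \<times> ball c d)" if "w \<in> space ?M" for w
      proof (intro holomorphic2_on_mult holomorphic2_on_const)
        have w: "w \<in> cball 0 r" using that by (auto simp: space_restrict_space)
        have "(\<lambda>\<zeta>. h (w, \<zeta>)) holomorphic_on ball c d"
          by (rule holomorphic2_on_compose_pair[OF h open_Om]) (use inOm[OF w] in \<open>auto intro!: holomorphic_intros\<close>)
        then show "holomorphic2_on (\<lambda>z. h (w, snd z)) (UNIV \<times> ball c d)"
          by (rule holomorphic2_on_compose[OF holomorphic2_on_snd]) auto
      qed
      show "\<exists>\<rho>>0. \<exists>G. ball z0 \<rho> \<subseteq> UNIV \<times> ball c d \<and> integrable ?M G \<and> (\<forall>z\<in>ball z0 \<rho>. \<forall>w\<in>space ?M. cmod (h (w, snd z) * cnj w ^ a) \<le> G w)"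
        if z0: "z0 \<in> UNIV \<times> ball c d" for z0
      proof -
        obtain \<rho> where \<rho>: "\<rho> > 0" "cball (snd z0) \<rho> \<subseteq> ball c d"
        proof -
          have "snd z0 \<in> ball c d" using z0 by (auto simp: mem_Times_iff)
          then show ?thesis using that open_contains_cball[of "ball c d"] open_ball by blast
        qed
        have "compact (h ` (cball 0 r \<times> cball (snd z0) \<rho>))"
          by (intro compact_continuous_image continuous_on_subset[OF conth] compact_Times compact_cball) (use inOm \<rho> in auto)
        then obtain B where B: "\<And>w \<zeta>. w \<in> cball 0 r \<Longrightarrow> \<zeta> \<in> cball (snd z0) \<rho> \<Longrightarrow> cmod (h (w, \<zeta>)) \<le> B"
          using compact_imp_bounded bounded_iff by (metis (no_types, lifting) SigmaI image_eqI)
        have sn: "snd z \<in> cball (snd z0) \<rho>" if "z \<in> ball z0 \<rho>" for z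
          using that dist_snd_le[of z0 z] by simp
        show ?thesis
        proof (intro exI conjI ballI)
          show "\<rho> > 0" by fact
          show "ball z0 \<rho> \<subseteq> UNIV \<times> ball c d" using sn \<rho> by (auto simp: mem_Times_iff)
          show "integrable ?M (\<lambda>_. B * r ^ a)" by simp
          fix z w assume z: "z \<in> ball z0 \<rho>" and w: "w \<in> space ?M"
          have w': "w \<in> cball 0 r" using w by (auto simp: space_restrict_space)
          have "cmod (h (w, snd z)) * cmod w ^ a \<le> B * r ^ a"
            using B[OF w' sn[OF z]] w' by (intro mult_mono power_mono order_trans[OF norm_ge_zero B[OF w' sn[OF z]]]) auto
          then show "cmod (h (w, snd z) * cnj w ^ a) \<le> B * r ^ a" by (simp add: norm_mult norm_power)
        qed
      qed
    qed
    define V where "V = pi * r ^ (2 * a + 2) / (real a + 1)"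
    have V: "V > 0" using r by (simp add: V_def)
    have "(\<lambda>\<zeta>. \<integral>w. h (w, snd (0::complex, \<zeta>)) * cnj w ^ a \<partial>?M) holomorphic_on ball c d"
      by (rule holomorphic2_on_compose_pair[OF hol]) (auto intro!: open_Times holomorphic_intros)
    then have "(\<lambda>\<zeta>. (\<integral>w. h (w, \<zeta>) * cnj w ^ a \<partial>?M) / of_real V) holomorphic_on ball c d"
      using V by (auto intro!: holomorphic_intros)
    moreover have "(\<integral>w. h (w, \<zeta>) * cnj w ^ a \<partial>?M) / of_real V = slice_taylor h a \<zeta>" if \<zeta>: "\<zeta> \<in> ball c d" for \<zeta>
    proof -
      have "compact ((\<lambda>w. h (w, \<zeta>) * cnj w ^ a) ` cball 0 r)"
        by (intro compact_continuous_image continuous_intros continuous_on_compose2[OF conth]) (use inOm \<zeta> in auto)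
      then obtain B where B: "\<And>w. w \<in> cball 0 r \<Longrightarrow> cmod (h (w, \<zeta>) * cnj w ^ a) \<le> B"
        using compact_imp_bounded bounded_iff by (metis (no_types, lifting) image_eqI)
      have iM: "integrable ?M (\<lambda>w. h (w, \<zeta>) * cnj w ^ a)"
        by (rule B.integrable_const_bound[of _ B]) (use B mc[OF \<zeta>] in \<open>auto intro!: AE_I2 simp: space_restrict_space\<close>)
      have eq: "indicator (ball 0 r) w *\<^sub>R (h (w, \<zeta>) * cnj w ^ a) = indicator (ball 0 r) w * (h (w, \<zeta>) * cnj w ^ a)" for w
        by (auto simp: indicator_def)
      have i: "integrable lborel (\<lambda>w. indicator (ball 0 r) w * (h (w, \<zeta>) * cnj w ^ a))"
        using iM by (subst (asm) integrable_restrict_space) (auto simp: eq)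
      have "(\<integral>w. h (w, \<zeta>) * cnj w ^ a \<partial>?M) = (\<integral>w. indicator (ball 0 r) w * (h (w, \<zeta>) * cnj w ^ a) \<partial>lborel)"
        by (subst integral_restrict_space) (auto simp: eq)
      also have "\<dots> = slice_taylor h a \<zeta> * of_real V"
        unfolding V_def using low[OF \<zeta>] r by (intro slice_coeff[OF h _ _ _ i]) auto
      finally show ?thesis using V by simp
    qed
    ultimately have "slice_taylor h a holomorphic_on ball c d" by (rule holomorphic_transform)
    then show ?thesis using d by blast
  qed
  then have "slice_taylor h a analytic_on ball 0 1 - {0}" unfolding analytic_on_def by blast
  then show ?thesis by (rule analytic_imp_holomorphic)
qed

end

section \<open>Square integrability and the critical exponent\<close>

lemma measurable_fst_snd_borel [measurable]:
  "(fst :: complex \<times> complex \<Rightarrow> complex) \<in> borel_measurable borel"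
  "(snd :: complex \<times> complex \<Rightarrow> complex) \<in> borel_measurable borel"
  by (intro borel_measurable_continuous_onI continuous_intros)+

lemma powr_square: "(x powr y)\<^sup>2 = (x :: real) powr (2 * y)"
  unfolding power2_eq_square powr_add[symmetric] mult_2 ..

lemma integrable_mult_of_L2:
  fixes f g :: "'a \<Rightarrow> complex"
  assumes [measurable]: "f \<in> borel_measurable M" "g \<in> borel_measurable M"
    and f: "integrable M (\<lambda>x. (cmod (f x))\<^sup>2)" and g: "integrable M (\<lambda>x. (cmod (g x))\<^sup>2)"
  shows "integrable M (\<lambda>x. f x * g x)"
proof (rule Bochner_Integration.integrable_bound)
  show "integrable M (\<lambda>x. (cmod (f x))\<^sup>2 + (cmod (g x))\<^sup>2)" by (intro Bochner_Integration.integrable_add f g)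
  have "cmod (f x) * cmod (g x) \<le> (cmod (f x))\<^sup>2 + (cmod (g x))\<^sup>2" for x
  proof -
    have "0 \<le> cmod (f x) * cmod (g x)" by simp
    then show ?thesis using sum_squares_bound[of "cmod (f x)" "cmod (g x)"] unfolding mult.assoc by linarith
  qed
  then show "AE x in M. norm (f x * g x) \<le> norm ((cmod (f x))\<^sup>2 + (cmod (g x))\<^sup>2)"
    by (simp add: norm_mult)
qed measurable

lemma (in finite_measure) integrable_powr_mono:
  fixes f :: "'a \<Rightarrow> complex"
  assumes [measurable]: "f \<in> borel_measurable M" and f: "integrable M (\<lambda>x. cmod (f x) powr q)" and r: "0 \<le> r" "r \<le> q"
  shows "integrable M (\<lambda>x. cmod (f x) powr r)"
proof (rule Bochner_Integration.integrable_bound)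
  show "integrable M (\<lambda>x. 1 + cmod (f x) powr q)" using f by simp
  have "cmod (f x) powr r \<le> 1 + cmod (f x) powr q" for x
  proof (cases "cmod (f x) \<le> 1")
    case True
    then have "cmod (f x) powr r \<le> 1" using r by (intro powr_le1) auto
    then show ?thesis using powr_ge_zero[of "cmod (f x)" q] by linarith
  next
    case False
    then have "cmod (f x) powr r \<le> cmod (f x) powr q" using r by (intro powr_mono) auto
    then show ?thesis by simp
  qed
  then show "AE x in M. norm (cmod (f x) powr r) \<le> norm (1 + cmod (f x) powr q)" by simp
qed measurable

context hartogs_domain
begin

text \<open>The squared \<open>L\<^sup>2\<close> norm of \<open>z\<^sub>1\<^sup>a z\<^sub>2\<^bsup>min_exponent a + i\<^esup>\<close> is \<open>\<pi>\<^sup>2 m / ((a + 1) (m i + norm_offset a))\<close>.\<close>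

definition norm_offset :: "nat \<Rightarrow> int" where "norm_offset a = int m * min_exponent a + int n * int a + int m + int n"

lemma norm_offset_pos: "norm_offset a > 0"
  using min_exponent_ge[of a] min_weight_gt by (simp add: norm_offset_def)

lemma norm_offset_shift: "norm_offset (j * m + r) = norm_offset r"
  unfolding norm_offset_def min_exponent_shift by (simp add: algebra_simps)

text \<open>The exponent \<kappa> of the estimates: a lower bound for gam a + b over all admissible
  monomials. Since \<open>cmod z1 < cmod z2 powr gam\<close>, each of them is at most
  \<open>cmod z2 powr crit_exponent\<close> in modulus.\<close>

definition crit_exponent :: real where "crit_exponent = real_of_int min_weight / real m"

lemma crit_exponent_le_0: "crit_exponent \<le> 0" using min_weight_le_0 m by (simp add: crit_exponent_def divide_nonpos_pos)

text \<open>Equivalent to p-th power integrability of \<open>cmod z2 powr crit_exponent\<close>; the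
  summand \<open>2 * gam\<close> is contributed by the area of the slices.\<close>

lemma crit_exponent_gt: "p * crit_exponent + 2 * gam > - 2"
proof -
  have "p * real_of_int min_weight > - 2 * (real m + real n)"
    using min_weight_bounds(1) p by (simp add: divide_less_eq mult.commute)
  then have "(p * real_of_int min_weight + 2 * (real m + real n)) / real m > 0" using m by simp
  then show ?thesis using m by (simp add: crit_exponent_def gam_def field_simps)
qed

lemma crit_exponent_le_bet: "crit_exponent \<le> gam * real a + real_of_int (min_exponent a)"
proof -
  have "real_of_int min_weight \<le> real_of_int (int m * min_exponent a + int n * int a)" using min_exponent_ge[of a] by (simp only: of_int_le_iff)
  then have "real_of_int min_weight / real m \<le> (real m * real_of_int (min_exponent a) + real n * real a) / real m"
    using m by (intro divide_right_mono) auto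
  then show ?thesis using m by (simp add: crit_exponent_def gam_def add_divide_distrib)
qed

lemma measurable_MM_I: "f \<in> borel_measurable borel \<Longrightarrow> f \<in> borel_measurable MM"
  by (rule measurable_restrict_space1) simp

lemma measurable_MM_continuous: "continuous_on Om f \<Longrightarrow> f \<in> borel_measurable MM"
  by (subst measurable_cong_sets[OF sets_restrict_space_cong[OF sets_lborel] refl]) (rule borel_measurable_continuous_on_restrict)

lemma measurable_MM_hol: "holomorphic2_on f Om \<Longrightarrow> f \<in> borel_measurable MM"
  by (intro measurable_MM_continuous holomorphic2_on_imp_continuous_on)

lemma integrable_snd_powr:
  assumes s: "s + 2 * gam > - 2"
  shows "integrable MM (\<lambda>w. cmod (snd w) powr s)"
proof (rule integrableI_nonneg)
  have [measurable]: "ball (0::complex) 1 \<in> sets borel" by simp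
  show m: "(\<lambda>w. cmod (snd w) powr s) \<in> borel_measurable MM" by (intro measurable_MM_I) measurable
  have "(\<integral>\<^sup>+w. ennreal (cmod (snd w) powr s) \<partial>MM) = (\<integral>\<^sup>+z2. \<integral>\<^sup>+z1. ennreal (cmod z2 powr s) * indicator Om (z1, z2) \<partial>lborel \<partial>lborel)"
    using m by (subst nn_integral_MM_iterated) auto
  also have "\<dots> = (\<integral>\<^sup>+z2. ennreal pi * (ennreal (cmod z2 powr (s + 2 * gam)) * indicator (ball 0 1) z2) \<partial>lborel)"
  proof (intro nn_integral_cong)
    fix z2 :: complex
    have "(\<integral>\<^sup>+z1. ennreal (cmod z2 powr s) * indicator Om (z1, z2) \<partial>lborel)
      = (\<integral>\<^sup>+z1. (ennreal (cmod z2 powr s) * indicator (ball 0 1) z2) * indicator (ball 0 (cmod z2 powr gam)) (z1 :: complex) \<partial>lborel)"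
      by (simp add: indicator_Om mult.assoc)
    also have "\<dots> = (ennreal (cmod z2 powr s) * indicator (ball 0 1) z2) * ennreal (pi * (cmod z2 powr gam)\<^sup>2)"
      by (subst nn_integral_cmult_indicator) (auto simp: emeasure_ball unit_ball_vol_numeral)
    also have "\<dots> = ennreal pi * (ennreal (cmod z2 powr s * (cmod z2 powr gam)\<^sup>2) * indicator (ball 0 1) z2)"
      by (simp add: ennreal_mult mult_ac)
    also have "cmod z2 powr s * (cmod z2 powr gam)\<^sup>2 = cmod z2 powr (s + 2 * gam)"
      unfolding powr_square powr_add[symmetric] ..
    finally show "(\<integral>\<^sup>+z1. ennreal (cmod z2 powr s) * indicator Om (z1, z2) \<partial>lborel) = ennreal pi * (ennreal (cmod z2 powr (s + 2 * gam)) * indicator (ball 0 1) z2)" .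
  qed
  also have "\<dots> = ennreal pi * (\<integral>\<^sup>+z2. ennreal (cmod z2 powr (s + 2 * gam)) * indicator (ball 0 1) z2 \<partial>(lborel :: complex measure))"
    by (rule nn_integral_cmult) measurable
  also have "\<dots> < \<infinity>" using nn_integral_ball_powr[OF s, of 1] by (simp add: ennreal_mult_less_top)
  finally show "(\<integral>\<^sup>+w. ennreal (cmod (snd w) powr s) \<partial>MM) < \<infinity>" .
qed auto

text \<open>Both factors are square integrable: h because the domain has finite measure and q \<ge>
  2, g because \<open>crit_exponent \<le> 0\<close> passes the critical inequality from the exponent
  p down to 2.\<close>

lemma integrable_mult_kap:
  fixes h g :: "complex \<times> complex \<Rightarrow> complex"
  assumes "h \<in> borel_measurable MM" "g \<in> borel_measurable MM"
    and h: "integrable MM (\<lambda>w. cmod (h w) powr q)" "2 \<le> q"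
    and g: "\<And>w. w \<in> Om \<Longrightarrow> cmod (g w) \<le> C * cmod (snd w) powr crit_exponent"
  shows "integrable MM (\<lambda>w. g w * h w)"
proof (rule integrable_mult_of_L2[OF assms(2,1)])
  have "integrable MM (\<lambda>x. cmod (h x) powr 2)"
    using MM.integrable_powr_mono[OF assms(1) h(1), of 2] h(2) by simp
  then show "integrable MM (\<lambda>x. (cmod (h x))\<^sup>2)" by simp
  have k2: "2 * crit_exponent + 2 * gam > - 2"
    using crit_exponent_gt crit_exponent_le_0 p mult_right_mono_neg[of 2 p crit_exponent] by linarith
  show "integrable MM (\<lambda>x. (cmod (g x))\<^sup>2)"
  proof (rule Bochner_Integration.integrable_bound)
    show "integrable MM (\<lambda>w. C\<^sup>2 * cmod (snd w) powr (2 * crit_exponent))"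
      using integrable_snd_powr[OF k2] by simp
    show "AE w in MM. norm ((cmod (g w))\<^sup>2) \<le> norm (C\<^sup>2 * cmod (snd w) powr (2 * crit_exponent))"
    proof (intro AE_I2)
      fix w assume "w \<in> space MM"
      then have "(cmod (g w))\<^sup>2 \<le> (C * cmod (snd w) powr crit_exponent)\<^sup>2" using g[of w] by (intro power_mono) auto
      also have "\<dots> = C\<^sup>2 * cmod (snd w) powr (2 * crit_exponent)"
        unfolding power_mult_distrib powr_square ..
      finally show "norm ((cmod (g w))\<^sup>2) \<le> norm (C\<^sup>2 * cmod (snd w) powr (2 * crit_exponent))" by simp
    qed
  qed (use assms(2) in measurable)
qed

text \<open>On a full slice of radius R, the coefficient formula bounds the coefficient times R^(a +
  2) by a multiple of the integral of |h|. Jensen's inequality turns the p-th power into the slice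
  integral of |h|^p, which is integrable in \<open>z2\<close> by Fubini.\<close>

lemma slice_taylor_weighted:
  assumes h: "holomorphic2_on h Om" and int: "integrable MM (\<lambda>z. cmod (h z) powr p)"
  shows "integrable lborel (\<lambda>z2. indicator (ball 0 1) z2 * (cmod (slice_taylor h a z2) powr p * cmod z2 powr (gam * (real a * p + 2))))"
proof -
  define \<Phi> where "\<Phi> z2 = (\<integral>z1. indicator Om (z1, z2) *\<^sub>R cmod (h (z1, z2)) powr p \<partial>lborel)" for z2
  \<comment> \<open>The first factor normalises the coefficient integral, the second comes from the
    slice area \<pi> R^2 in Jensen's inequality.\<close>
  define C where "C = ((real a + 1) / pi) powr p * pi powr (p - 1)"
  note it = integrable_MM_iterated[OF int]
  have hol: "slice_taylor h a holomorphic_on ball 0 1 - {0}" by (rule slice_taylor_holomorphic[OF h])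
  have bound: "cmod (slice_taylor h a z2) powr p * cmod z2 powr (gam * (real a * p + 2)) \<le> C * \<Phi> z2"
    if z2: "cmod z2 < 1" "z2 \<noteq> 0" and i: "integrable lborel (\<lambda>z1. indicator Om (z1, z2) *\<^sub>R cmod (h (z1, z2)) powr p)" for z2
  proof -
    define R where "R = cmod z2 powr gam"
    have R: "R > 0" using z2 by (simp add: R_def)
    have iO: "indicator Om (z1, z2) = (indicator (ball 0 R) z1 :: real)" for z1 using z2 by (simp add: indicator_Om R_def)
    have \<Phi>: "\<Phi> z2 = (\<integral>z1. indicator (ball 0 R) z1 * cmod (h (z1, z2)) powr p \<partial>lborel)" by (simp add: \<Phi>_def iO)
    have i1: "integrable lborel (\<lambda>z1. indicator (ball 0 R) z1 * cmod (h (z1, z2)) powr p)" using i by (simp add: iO)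
    have mh: "(\<lambda>z1. indicator (ball 0 R) z1 * h (z1, z2)) \<in> borel_measurable borel"
      using borel_measurable_holomorphic_indicator[OF slice_holomorphic[OF h z2(1)]] by (simp add: R_def)
    have eq: "norm (indicator (ball 0 R) z1 * h (z1, z2)) = indicator (ball 0 R) z1 * cmod (h (z1, z2))" for z1 by (auto simp: indicator_def)
    have mn: "(\<lambda>z1. indicator (ball 0 R) z1 * cmod (h (z1, z2))) \<in> borel_measurable lborel"
      using measurable_compose[OF mh borel_measurable_norm] unfolding eq by simp
    have fin: "emeasure lborel (ball (0::complex) R) < \<infinity>" using R by (simp add: emeasure_ball)
    have jen: "integrable lborel (\<lambda>z1. indicator (ball 0 R) z1 * cmod (h (z1, z2)))"
       "(\<integral>z1. indicator (ball 0 R) z1 * cmod (h (z1, z2)) \<partial>lborel) powr p \<le> measure lborel (ball (0::complex) R) powr (p - 1) * (\<integral>z1. indicator (ball 0 R) z1 * cmod (h (z1, z2)) powr p \<partial>lborel)"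
      using integral_set_jensen[OF _ _ fin mn norm_ge_zero i1] p by auto
    define I where "I = (\<integral>z1. indicator (ball 0 R) z1 * cmod (h (z1, z2)) \<partial>lborel)"
    have vol: "measure lborel (ball (0::complex) R) = pi * R\<^sup>2" using content_ball[of R "0::complex"] R by (simp add: unit_ball_vol_numeral)
    have pw: "norm (indicator (ball 0 R) z1 * (h (z1, z2) * cnj z1 ^ a)) \<le> R ^ a * (indicator (ball 0 R) z1 * cmod (h (z1, z2)))" for z1
      using power_mono[of "cmod z1" R a] R by (auto simp: indicator_def norm_mult norm_power mult.commute intro!: mult_right_mono)
    have mc: "(\<lambda>z1. indicator (ball 0 R) z1 * (h (z1, z2) * cnj z1 ^ a)) \<in> borel_measurable borel"
    proof -
      have "(\<lambda>z1. (indicator (ball 0 R) z1 * h (z1, z2)) * cnj z1 ^ a) \<in> borel_measurable borel"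
        by (intro borel_measurable_times mh borel_measurable_continuous_onI continuous_intros)
      then show ?thesis by (simp add: mult.assoc)
    qed
    have ic: "integrable lborel (\<lambda>z1. indicator (ball 0 R) z1 * (h (z1, z2) * cnj z1 ^ a))"
    proof (rule Bochner_Integration.integrable_bound)
      show "integrable lborel (\<lambda>z1. R ^ a * (indicator (ball 0 R) z1 * cmod (h (z1, z2))))" using jen(1) by simp
      show "AE z1 in lborel. norm (indicator (ball 0 R) z1 * (h (z1, z2) * cnj z1 ^ a)) \<le> norm (R ^ a * (indicator (ball 0 R) z1 * cmod (h (z1, z2))))"
        unfolding real_norm_def by (intro AE_I2 order_trans[OF pw abs_ge_self])
    qed (use mc in simp)
    define V where "V = pi * R ^ (2 * a + 2) / (real a + 1)"
    have "cmod (slice_taylor h a z2) * V = norm (\<integral>z1. indicator (ball 0 R) z1 * (h (z1, z2) * cnj z1 ^ a) \<partial>lborel)"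
      using slice_coeff[OF h z2(1) _ _ ic] R by (simp add: R_def[symmetric] V_def norm_mult norm_divide norm_power del: of_real_add)
    also have "\<dots> \<le> (\<integral>z1. norm (indicator (ball 0 R) z1 * (h (z1, z2) * cnj z1 ^ a)) \<partial>lborel)" by (rule integral_norm_bound)
    also have "\<dots> \<le> (\<integral>z1. R ^ a * (indicator (ball 0 R) z1 * cmod (h (z1, z2))) \<partial>lborel)"
      by (rule integral_mono[OF _ _ pw]) (use ic jen(1) in auto)
    also have "\<dots> = R ^ a * I" by (simp add: I_def)
    finally have "R ^ a * (cmod (slice_taylor h a z2) * R ^ (a + 2)) \<le> R ^ a * ((real a + 1) / pi * I)"
      by (simp add: V_def field_simps power_add power_mult power2_eq_square)
    then have "cmod (slice_taylor h a z2) * R ^ (a + 2) \<le> (real a + 1) / pi * I"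
      by (rule mult_left_le_imp_le) (use R in simp)
    then have "(cmod (slice_taylor h a z2) * R ^ (a + 2)) powr p \<le> ((real a + 1) / pi * I) powr p"
      using p R by (intro powr_mono2) auto
    also have "\<dots> = ((real a + 1) / pi) powr p * I powr p"
      by (rule powr_mult)
    also have "\<dots> \<le> ((real a + 1) / pi) powr p * ((pi * R\<^sup>2) powr (p - 1) * \<Phi> z2)"
      using jen(2) by (intro mult_left_mono) (auto simp: I_def \<Phi> vol)
    also have "(pi * R\<^sup>2) powr (p - 1) = pi powr (p - 1) * R powr (2 * (p - 1))"
    proof -
      have "(R\<^sup>2) powr (p - 1) = R powr (2 * (p - 1))" using powr_powr[of R 2 "p - 1"] R by simp
      then show ?thesis by (simp add: powr_mult)
    qed
    also have "(cmod (slice_taylor h a z2) * R ^ (a + 2)) powr p = cmod (slice_taylor h a z2) powr p * R powr ((real a + 2) * p)"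
    proof -
      have "R ^ (a + 2) = R powr (real a + 2)" using powr_realpow[OF R, of "a + 2"] by (simp add: add.commute)
      then have "(R ^ (a + 2)) powr p = R powr ((real a + 2) * p)" by (simp add: powr_powr)
      then show ?thesis by (simp add: powr_mult)
    qed
    \<comment> \<open>The power R^(2 (p - 1)) is the one produced by Jensen's inequality and
      cancels; what remains is the weight of the statement.\<close>
    also have "R powr ((real a + 2) * p) = R powr (2 * (p - 1)) * R powr (real a * p + 2)"
      by (simp add: powr_add[symmetric] algebra_simps)
    finally have "R powr (2 * (p - 1)) * (cmod (slice_taylor h a z2) powr p * R powr (real a * p + 2)) \<le> R powr (2 * (p - 1)) * (C * \<Phi> z2)"
      by (simp only: C_def mult_ac)
    then have "cmod (slice_taylor h a z2) powr p * R powr (real a * p + 2) \<le> C * \<Phi> z2"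
      by (rule mult_left_le_imp_le) (use R in simp)
    then show ?thesis by (simp add: R_def powr_powr)
  qed
  show ?thesis
  proof (rule Bochner_Integration.integrable_bound)
    show "integrable lborel (\<lambda>z2. C * \<Phi> z2)" using it(3) by (simp add: \<Phi>_def)
    have eq: "indicator (ball 0 1) z2 * (cmod (slice_taylor h a z2) powr p * cmod z2 powr (gam * (real a * p + 2)))
      = norm (indicator (ball 0 1 - {0}) z2 * slice_taylor h a z2) powr p * cmod z2 powr (gam * (real a * p + 2))" for z2
      using p by (auto simp: indicator_def)
    have [measurable]: "(\<lambda>z2. indicator (ball 0 1 - {0}) z2 * slice_taylor h a z2) \<in> borel_measurable borel"
      by (rule borel_measurable_holomorphic_indicator[OF hol]) (intro open_Diff; simp)
    have "(\<lambda>z2. norm (indicator (ball 0 1 - {0}) z2 * slice_taylor h a z2) powr p * cmod z2 powr (gam * (real a * p + 2))) \<in> borel_measurable borel"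
      by measurable
    then show "(\<lambda>z2. indicator (ball 0 1) z2 * (cmod (slice_taylor h a z2) powr p * cmod z2 powr (gam * (real a * p + 2)))) \<in> borel_measurable lborel"
      unfolding eq by simp
    from it(2) show "AE z2 in lborel. norm (indicator (ball 0 1) z2 * (cmod (slice_taylor h a z2) powr p * cmod z2 powr (gam * (real a * p + 2)))) \<le> norm (C * \<Phi> z2)"
    proof eventually_elim
      case (elim z2)
      show ?case
      proof (cases "cmod z2 < 1 \<and> z2 \<noteq> 0")
        case True
        with bound[OF _ _ elim] have "cmod (slice_taylor h a z2) powr p * cmod z2 powr (gam * (real a * p + 2)) \<le> C * \<Phi> z2" by blast
        then show ?thesis using True abs_ge_self[of "C * \<Phi> z2"] by (auto simp: abs_mult)
      qed auto
    qed
  qed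
qed

text \<open>The power one below the threshold is not integrable, so it can serve as k in
  \<open>punctured_disc_pole_order\<close>; the exponent k + 1 returned there is the threshold
  itself.\<close>

lemma slice_taylor_factor:
  assumes h: "holomorphic2_on h Om" and int: "integrable MM (\<lambda>z. cmod (h z) powr p)"
  shows "\<exists>g. g holomorphic_on ball 0 1 \<and> (\<forall>z2\<in>ball 0 1 - {0}. slice_taylor h a z2 = z2 powi min_exponent a * g z2)"
proof -
  have "p * real_of_int (min_exponent a - 1) + gam * (real a * p + 2) + 2 \<le> 0" by (rule min_exponent_pole)
  from punctured_disc_pole_order[OF slice_taylor_holomorphic[OF h] _ slice_taylor_weighted[OF h int] this] p
  show ?thesis by simp
qed

end

subsection \<open>The reproducing kernel\<close>

lemma sums_integral_dominated:
  fixes f :: "nat \<Rightarrow> 'a \<Rightarrow> complex"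
  assumes f: "\<And>i. f i \<in> borel_measurable M" and G: "integrable M G" and D: "summable D"
    and le: "\<And>i x. x \<in> space M \<Longrightarrow> cmod (f i x) \<le> D i * G x"
  shows "(\<lambda>i. \<integral>x. f i x \<partial>M) sums (\<integral>x. (\<Sum>i. f i x) \<partial>M)"
proof (rule sums_integral)
  have ni: "norm (f i x) \<le> norm (D i * G x)" if "x \<in> space M" for i x
    using order_trans[OF le[OF that] abs_ge_self] by simp
  show fi: "integrable M (f i)" for i
    by (rule Bochner_Integration.integrable_bound[OF integrable_mult_right[OF G, of "D i"] f AE_I2]) (rule ni)
  show "AE x in M. summable (\<lambda>i. norm (f i x))"
    by (intro AE_I2 summable_comparison_test[OF _ summable_mult2[OF D]]) (use le in auto)
  show "summable (\<lambda>i. \<integral>x. norm (f i x) \<partial>M)"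
  proof (rule summable_comparison_test[OF _ summable_mult2[OF D]], intro exI allI impI)
    fix i
    have "norm (\<integral>x. norm (f i x) \<partial>M) = (\<integral>x. norm (f i x) \<partial>M)" by simp
    also have "\<dots> \<le> (\<integral>x. D i * G x \<partial>M)"
      by (rule integral_mono) (use fi G le in auto)
    finally show "norm (\<integral>x. norm (f i x) \<partial>M) \<le> D i * (\<integral>x. G x \<partial>M)" by simp
  qed
qed

lemma arith_geometric_sums:
  fixes A B x :: complex
  assumes "cmod x < 1"
  shows "(\<lambda>i. (A * of_nat i + B) * x ^ i) sums ((B + (A - B) * x) / (1 - x)\<^sup>2)"
proof -
  have x: "1 - x \<noteq> 0" using assms by auto
  have "(\<lambda>i. A * (of_nat (Suc i) * x ^ i) + (B - A) * x ^ i) sums (A * (1 / (1 - x)\<^sup>2) + (B - A) * (1 / (1 - x)))"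
    by (intro sums_add sums_mult geometric_deriv_sums geometric_sums assms)
  also have "(\<lambda>i. A * (of_nat (Suc i) * x ^ i) + (B - A) * x ^ i) = (\<lambda>i. (A * of_nat i + B) * x ^ i)"
    by (auto simp: algebra_simps)
  also have "A * (1 / (1 - x)\<^sup>2) + (B - A) * (1 / (1 - x)) = (A + (B - A) * (1 - x)) / (1 - x)\<^sup>2"
    using x by (simp add: add_divide_distrib power2_eq_square)
  also have "A + (B - A) * (1 - x) = B + (A - B) * x" by (simp add: algebra_simps)
  finally show ?thesis .
qed

lemma summable_arith_geometric:
  fixes A B x :: real
  assumes "0 \<le> x" "x < 1"
  shows "summable (\<lambda>i. (A * real i + B) * x ^ i)"
proof -
  have "(\<lambda>i. A * (real (Suc i) * x ^ i) + (B - A) * x ^ i) sums (A * (1 / (1 - x)\<^sup>2) + (B - A) * (1 / (1 - x)))"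
    using assms geometric_deriv_sums[of x] by (intro sums_add sums_mult geometric_sums) auto
  then show ?thesis by (auto simp: algebra_simps dest: sums_summable)
qed

context hartogs_domain
begin

text \<open>Formulated for a pair s, t rather than a point of the domain: it then serves a single
  point and also the coordinatewise product of one point with the conjugate of another, for which
  \<open>stu\<close> provides the hypotheses.\<close>

lemma monomial_bound:
  assumes S: "cmod s \<le> cmod t powr gam" and t: "t \<noteq> 0" "cmod t \<le> 1"
  shows "cmod (s ^ a * t powi min_exponent a) \<le> cmod t powr crit_exponent"
proof -
  have "cmod (s ^ a * t powi min_exponent a) = cmod s ^ a * cmod t powr (real_of_int (min_exponent a))"
    using t powr_real_of_int'[of "cmod t" "min_exponent a"] by (simp add: norm_mult norm_power norm_power_int)
  also have "cmod s ^ a \<le> (cmod t powr gam) ^ a" by (intro power_mono S) auto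
  also have "(cmod t powr gam) ^ a = cmod t powr (gam * real a)"
    using t powr_realpow[of "cmod t powr gam" a] by (simp add: powr_powr)
  also have "cmod t powr (gam * real a) * cmod t powr (real_of_int (min_exponent a)) = cmod t powr (gam * real a + real_of_int (min_exponent a))"
    by (simp add: powr_add)
  also have "\<dots> \<le> cmod t powr crit_exponent"
    using t crit_exponent_le_bet by (intro powr_mono') auto
  finally show ?thesis by (simp add: mult_right_mono)
qed

text \<open>The slice integral isolates the a-th Taylor coefficient in \<open>z1\<close>, the
  integral over \<open>z2\<close> the i-th coefficient of g. The remaining real factor is the
  squared norm of the monomial.\<close>

lemma coeff_formula:
  assumes h: "holomorphic2_on h Om" and int: "integrable MM (\<lambda>z. cmod (h z) powr p)"
    and g: "g holomorphic_on ball 0 1" "\<And>z2. z2 \<in> ball 0 1 - {0} \<Longrightarrow> slice_taylor h a z2 = z2 powi min_exponent a * g z2"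
  shows "(\<integral>w. h w * cnj (fst w ^ a * snd w powi (min_exponent a + int i)) \<partial>MM) 
     = (deriv ^^ i) g 0 / fact i * of_real (pi\<^sup>2 * real m / ((real a + 1) * (real m * real i + real_of_int (norm_offset a))))"
proof -
  define b where "b = min_exponent a + int i"
  define F where "F w = cnj (fst w ^ a * snd w powi b) * h w" for w
  have iF: "integrable MM F" unfolding F_def
  proof (rule integrable_mult_kap[OF measurable_MM_hol[OF h] _ int p, of _ 1])
    show "(\<lambda>w. cnj (fst w ^ a * snd w powi b)) \<in> borel_measurable MM"
      by (intro measurable_MM_continuous continuous_intros continuous_on_power_int) (auto dest: Om_snd)
    fix w assume w: "w \<in> Om"
    then have w': "cmod (fst w) \<le> cmod (snd w) powr gam" "snd w \<noteq> 0" "cmod (snd w) \<le> 1"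
      by (cases w; auto simp: Om_iff)+
    have "cmod (cnj (fst w ^ a * snd w powi b)) = cmod (fst w ^ a * snd w powi min_exponent a) * cmod (snd w) ^ i"
      unfolding complex_mod_cnj using w'(2) by (simp add: b_def power_int_add norm_mult norm_power)
    also have "\<dots> \<le> cmod (snd w) powr crit_exponent * 1"
      by (intro mult_mono monomial_bound w' power_le_one) auto
    finally show "cmod (cnj (fst w ^ a * snd w powi b)) \<le> 1 * cmod (snd w) powr crit_exponent" by simp
  qed
  note it = integrable_MM_iterated[OF iF]
  \<comment> \<open>The radial weight left by the slice integral:
    \<open>z2 powi min_exponent a\<close> and its conjugate give the first exponent, the slice
    radius to the power 2 a + 2 the second.\<close>
  define \<omega> where "\<omega> x = pi / (real a + 1) * x powr (2 * real_of_int (min_exponent a) + gam * (2 * real a + 2))" for x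
  have inner: "(\<integral>z1. indicator Om (z1, z2) *\<^sub>R F (z1, z2) \<partial>lborel) = indicator (ball 0 1) z2 * (of_real (\<omega> (cmod z2)) * g z2 * cnj z2 ^ i)"
    if i: "integrable lborel (\<lambda>z1. indicator Om (z1, z2) *\<^sub>R F (z1, z2))" and z2: "z2 \<noteq> 0" for z2
  proof (cases "cmod z2 < 1")
    case True
    define R where "R = cmod z2 powr gam"
    have R: "R > 0" using z2 by (simp add: R_def)
    define k where "k = cnj z2 powi b"
    have k: "k \<noteq> 0" using z2 by (simp add: k_def)
    have e: "indicator Om (z1, z2) *\<^sub>R F (z1, z2) = k * (indicator (ball 0 R) z1 * (h (z1, z2) * cnj z1 ^ a))" for z1
      using True by (auto simp: Om_iff R_def F_def k_def indicator_def)
    have i2: "integrable lborel (\<lambda>z1. indicator (ball 0 R) z1 * (h (z1, z2) * cnj z1 ^ a))"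
      using integrable_mult_right[OF i[unfolded e], of "1 / k"] k by simp
    have "(\<integral>z1. indicator Om (z1, z2) *\<^sub>R F (z1, z2) \<partial>lborel) = k * (\<integral>z1. indicator (ball 0 R) z1 * (h (z1, z2) * cnj z1 ^ a) \<partial>lborel)"
      unfolding e by simp
    also have "\<dots> = k * (slice_taylor h a z2 * of_real (pi * R ^ (2 * a + 2) / (real a + 1)))"
      using slice_coeff[OF h True _ _ i2] R by (simp add: R_def)
    also have "slice_taylor h a z2 = z2 powi min_exponent a * g z2" using g(2)[of z2] True z2 by simp
    also have "k = cnj z2 powi min_exponent a * cnj z2 ^ i" using z2 by (simp add: k_def b_def power_int_add)
    also have "cnj z2 powi min_exponent a * cnj z2 ^ i * (z2 powi min_exponent a * g z2 * of_real (pi * R ^ (2 * a + 2) / (real a + 1)))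
      = (z2 powi min_exponent a * cnj z2 powi min_exponent a) * of_real (pi * R ^ (2 * a + 2) / (real a + 1)) * g z2 * cnj z2 ^ i"
      by (simp only: mult_ac)
    also have "z2 powi min_exponent a * cnj z2 powi min_exponent a = of_real (cmod z2 powr (2 * real_of_int (min_exponent a)))"
    proof -
      have "z2 powi min_exponent a * cnj z2 powi min_exponent a = (z2 * cnj z2) powi min_exponent a" by (simp add: power_int_mult_distrib)
      also have "\<dots> = of_real (((cmod z2)\<^sup>2) powi min_exponent a)" by (simp add: complex_norm_square[symmetric])
      also have "((cmod z2)\<^sup>2) powi min_exponent a = ((cmod z2)\<^sup>2) powr real_of_int (min_exponent a)" using z2 by (subst powr_real_of_int') auto
      also have "\<dots> = cmod z2 powr (2 * real_of_int (min_exponent a))" using powr_powr[of "cmod z2" 2 "real_of_int (min_exponent a)"] by simp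
      finally show ?thesis .
    qed
    also have "R ^ (2 * a + 2) = cmod z2 powr (gam * (2 * real a + 2))"
    proof -
      have "R ^ (2 * a + 2) = R powr (2 * real a + 2)" using powr_realpow[OF R, of "2 * a + 2"] by (simp add: algebra_simps)
      then show ?thesis by (simp add: R_def powr_powr)
    qed
    also have "complex_of_real (cmod z2 powr (2 * real_of_int (min_exponent a))) * of_real (pi * cmod z2 powr (gam * (2 * real a + 2)) / (real a + 1)) = of_real (\<omega> (cmod z2))"
      unfolding \<omega>_def powr_add of_real_mult[symmetric] by (simp add: mult_ac)
    finally show ?thesis using True by simp
  qed (auto simp: indicator_Om)
  let ?E = "\<lambda>z2. indicator (ball 0 1) z2 * (complex_of_real (\<omega> (cmod z2)) * g z2 * cnj z2 ^ i)"
  \<comment> \<open>Excluded are the origin and the \<open>z2\<close> over which the slice integral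
    diverges.\<close>
  have AE_E: "AE z2 in lborel. (\<integral>z1. indicator Om (z1, z2) *\<^sub>R F (z1, z2) \<partial>lborel) = ?E z2"
    using it(2) AE_lborel_singleton[of "0::complex"] by eventually_elim (rule inner)
  have mE: "?E \<in> borel_measurable borel"
  proof -
    have "(\<lambda>z2. (indicator (ball 0 1) z2 * g z2) * (complex_of_real (\<omega> (cmod z2)) * cnj z2 ^ i)) \<in> borel_measurable borel"
    proof (intro borel_measurable_times[OF borel_measurable_holomorphic_indicator[OF g(1)]] borel_measurable_times)
      show "(\<lambda>z2. complex_of_real (\<omega> (cmod z2))) \<in> borel_measurable borel" unfolding \<omega>_def by measurable
      show "(\<lambda>x. cnj x ^ i) \<in> borel_measurable borel" by (intro borel_measurable_continuous_onI continuous_intros)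
    qed auto
    then show ?thesis by (simp add: mult_ac)
  qed
  have iE: "integrable lborel ?E"
    by (rule integrable_cong_AE_imp[OF it(3) _ AE_E]) (use mE in simp)
  have exp: "2 * real_of_int (min_exponent a) + gam * (2 * real a + 2) + 2 * real i + 2 = 2 * (real m * real i + real_of_int (norm_offset a)) / real m"
    using m by (simp add: norm_offset_def gam_def field_simps)
  have den: "real m * real i + real_of_int (norm_offset a) > 0" using norm_offset_pos[of a] by (intro add_nonneg_pos) auto
  define s where "s = 2 * real_of_int (min_exponent a) + gam * (2 * real a + 2) + 2 * real i"
  have s2: "s + 2 = 2 * (real m * real i + real_of_int (norm_offset a)) / real m" using exp by (simp add: s_def)
  then have "s + 2 > 0" using den m by simp
  then have s: "s > -2" by simp
  have "(\<integral>w. F w \<partial>MM) = (\<integral>z2. ?E z2 \<partial>lborel)"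
    unfolding it(1) by (rule integral_cong_AE[OF _ _ AE_E]) (use it(3) mE in \<open>auto intro: borel_measurable_integrable\<close>)
  also have "\<dots> = (deriv ^^ i) g 0 / fact i * of_real (\<integral>z. indicator (ball 0 1) z * (\<omega> (cmod z) * cmod z ^ (2 * i)) \<partial>lborel)"
    by (rule integral_ball_coeff[OF g(1) _ iE]) (simp add: \<omega>_def)
  also have "(\<integral>z. indicator (ball 0 1) z * (\<omega> (cmod z) * cmod z ^ (2 * i)) \<partial>lborel) = (\<integral>z. pi / (real a + 1) * (indicator (ball 0 1) z * cmod z powr s) \<partial>lborel)"
  proof (rule integral_cong_AE)
    have "AE z in lborel. z \<noteq> (0 :: complex)" by (rule AE_lborel_singleton)
    then show "AE z in lborel. indicator (ball 0 1) z * (\<omega> (cmod z) * cmod z ^ (2 * i)) = pi / (real a + 1) * (indicator (ball 0 1) z * cmod z powr s)"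
    proof eventually_elim
      case (elim z)
      then have "cmod z ^ (2 * i) = cmod z powr (2 * real i)" using powr_realpow[of "cmod z" "2 * i"] by simp
      then show ?case by (simp add: \<omega>_def s_def powr_add)
    qed
    have [measurable]: "ball (0::complex) 1 \<in> sets borel" by simp
    show "(\<lambda>z. indicator (ball 0 1) z * (\<omega> (cmod z) * cmod z ^ (2 * i))) \<in> borel_measurable (lborel :: complex measure)"
      unfolding \<omega>_def by measurable
    show "(\<lambda>z. pi / (real a + 1) * (indicator (ball 0 1) z * cmod z powr s)) \<in> borel_measurable (lborel :: complex measure)"
      by measurable
  qed
  also have "\<dots> = pi / (real a + 1) * (2 * pi / (s + 2))"
    using integral_ball_powr[OF s, of 1] by simp
  also have "\<dots> = pi\<^sup>2 * real m / ((real a + 1) * (real m * real i + real_of_int (norm_offset a)))"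
  proof -
    define d where "d = real m * real i + real_of_int (norm_offset a)"
    have "s + 2 = 2 * d / real m" by (simp only: s2 d_def)
    then have "2 * pi / (s + 2) = pi * real m / d" by simp
    then show ?thesis unfolding d_def[symmetric] by (simp add: power2_eq_square)
  qed
  finally show ?thesis by (simp add: F_def b_def mult.commute)
qed

text \<open>The sum of \<open>z\<^sup>\<alpha> cnj w\<^sup>\<alpha> / \<parallel>z\<^sup>\<alpha>\<parallel>\<^sup>2\<close> over \<open>\<alpha> = (j m + r, min_exponent r - n j + i)\<close> with \<open>r < m\<close> and \<open>i, j \<ge> 0\<close>: the
  sums over \<open>j\<close> and \<open>i\<close> are arithmetic-geometric series in \<open>u\<close> and \<open>t\<close>.\<close>

definition kernel :: "complex \<times> complex \<Rightarrow> complex \<times> complex \<Rightarrow> complex" where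
  "kernel z w = (let s = fst z * cnj (fst w); t = snd z * cnj (snd w); u = s ^ m / t ^ n in
     (\<Sum>r<m. s ^ r * t powi min_exponent r * ((of_nat r + 1 + (of_nat m - of_nat r - 1) * u) / (1 - u)\<^sup>2)
        * ((of_int (norm_offset r) + (of_nat m - of_int (norm_offset r)) * t) / (1 - t)\<^sup>2)) / of_real (pi\<^sup>2 * real m))"

text \<open>The domain is stable under coordinatewise multiplication by conjugates of its points.
  The bounds for t and u by quantities of \<open>z\<close> alone keep the denominators of the kernel
  away from 0 uniformly in \<open>w\<close>.\<close>

lemma stu:
  assumes z: "z \<in> Om" and w: "w \<in> Om"
  defines "s \<equiv> fst z * cnj (fst w)" and "t \<equiv> snd z * cnj (snd w)"
  defines "u \<equiv> s ^ m / t ^ n"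
  shows "t \<noteq> 0" "cmod t \<le> cmod (snd z)" "cmod t < 1" "cmod s \<le> cmod t powr gam"
    "cmod u \<le> cmod (fst z ^ m / snd z ^ n)" "cmod (fst z ^ m / snd z ^ n) < 1" "cmod u < 1" 
    "cmod t powr crit_exponent = cmod (snd z) powr crit_exponent * cmod (snd w) powr crit_exponent"
proof -
  obtain z1 z2 w1 w2 where zw: "z = (z1, z2)" "w = (w1, w2)" by (metis surj_pair)
  have z': "cmod z1 < cmod z2 powr gam" "cmod z2 < 1" "z2 \<noteq> 0" using z by (auto simp: zw Om_iff)
  have w': "cmod w1 < cmod w2 powr gam" "cmod w2 < 1" "w2 \<noteq> 0" using w by (auto simp: zw Om_iff)
  have v: "cmod (x1 ^ m / x2 ^ n) < 1" if "cmod x1 < cmod x2 powr gam" "x2 \<noteq> 0" for x1 x2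
  proof -
    have "cmod x1 ^ m < (cmod x2 powr gam) ^ m" using that m by (intro power_strict_mono) auto
    also have "\<dots> = cmod x2 ^ n"
      using that m powr_realpow[of "cmod x2 powr gam" m] powr_realpow[of "cmod x2" n] by (simp add: powr_powr gam_def)
    finally show ?thesis using that by (simp add: norm_divide norm_power)
  qed
  show "t \<noteq> 0" using z' w' by (simp add: t_def zw)
  show "cmod t \<le> cmod (snd z)" using w' by (simp add: t_def zw norm_mult mult_left_le)
  then show "cmod t < 1" using z' by (simp add: zw)
  show "cmod s \<le> cmod t powr gam"
    using z' w' by (simp add: s_def t_def zw norm_mult powr_mult mult_mono)
  show v1: "cmod (fst z ^ m / snd z ^ n) < 1" using v[OF z'(1,3)] by (simp add: zw)
  have "u = (z1 ^ m / z2 ^ n) * cnj (w1 ^ m / w2 ^ n)" by (simp add: u_def s_def t_def zw power_mult_distrib)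
  then have "cmod u = cmod (z1 ^ m / z2 ^ n) * cmod (w1 ^ m / w2 ^ n)" by (simp only: norm_mult complex_mod_cnj)
  then show *: "cmod u \<le> cmod (fst z ^ m / snd z ^ n)" using v[OF w'(1,3)] by (simp add: zw mult_left_le)
  show "cmod u < 1" using * v1 by linarith
  show "cmod t powr crit_exponent = cmod (snd z) powr crit_exponent * cmod (snd w) powr crit_exponent" by (simp add: t_def norm_mult powr_mult)
qed

text \<open>For fixed a the terms in powers of t are integrated one by one: the squared norms cancel
  and the Taylor series of g at \<open>snd z\<close> is left. Summing before integrating gives the
  closed form in t instead.\<close>

lemma reproducing_slice:
  assumes h: "holomorphic2_on h Om" and int: "integrable MM (\<lambda>z. cmod (h z) powr p)" and z: "z \<in> Om"
  shows "(\<integral>w. (of_nat a + 1) * (fst z * cnj (fst w)) ^ a * (snd z * cnj (snd w)) powi min_exponent a 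
      * ((of_int (norm_offset a) + (of_nat m - of_int (norm_offset a)) * (snd z * cnj (snd w))) / (1 - snd z * cnj (snd w))\<^sup>2) / of_real (pi\<^sup>2 * real m) * h w \<partial>MM)
     = slice_taylor h a (snd z) * fst z ^ a"
    and "integrable MM (\<lambda>w. (of_nat a + 1) * (fst z * cnj (fst w)) ^ a * (snd z * cnj (snd w)) powi min_exponent a 
      * ((of_int (norm_offset a) + (of_nat m - of_int (norm_offset a)) * (snd z * cnj (snd w))) / (1 - snd z * cnj (snd w))\<^sup>2) / of_real (pi\<^sup>2 * real m) * h w)"
proof -
  obtain g where g: "g holomorphic_on ball 0 1" "\<And>z2. z2 \<in> ball 0 1 - {0} \<Longrightarrow> slice_taylor h a z2 = z2 powi min_exponent a * g z2"
    using slice_taylor_factor[OF h int] by blast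
  have z2: "snd z \<noteq> 0" "cmod (snd z) < 1" using z by (cases z; auto simp: Om_iff)+
  let ?s = "\<lambda>w. fst z * cnj (fst w)" and ?t = "\<lambda>w. snd z * cnj (snd w)"
  define q where "q = complex_of_real (pi\<^sup>2 * real m)"
  have q: "q \<noteq> 0" using m by (simp add: q_def)
  \<comment> \<open>The kernel term of the monomial with exponents a and
    \<open>min_exponent a + i\<close>, times h.\<close>
  define f where "f i w = (of_nat a + 1) / q * (?s w ^ a * ?t w powi min_exponent a) * ((of_nat m * of_nat i + of_int (norm_offset a)) * ?t w ^ i) * h w" for i w
  define D where "D i = cmod ((of_nat a + 1) / q) * ((real m * real i + real_of_int (norm_offset a)) * cmod (snd z) ^ i)" for i
  define G where "G w = cmod ((?s w ^ a * ?t w powi min_exponent a) * h w)" for w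
  have ipre: "integrable MM (\<lambda>w. X w * h w)"
    if "continuous_on Om X" "\<And>w. w \<in> Om \<Longrightarrow> cmod (X w) \<le> C * cmod (?s w ^ a * ?t w powi min_exponent a)" "0 \<le> C" for C X
  proof (rule integrable_mult_kap[OF measurable_MM_hol[OF h] measurable_MM_continuous[OF that(1)] int p])
    fix w assume w: "w \<in> Om"
    note S = stu[OF z w]
    have "cmod (X w) \<le> C * cmod (?s w ^ a * ?t w powi min_exponent a)" using that(2) w by blast
    also have "\<dots> \<le> C * (cmod (snd z) powr crit_exponent * cmod (snd w) powr crit_exponent)"
      using monomial_bound[OF S(4,1), of a] S(3,8) that(3) by (intro mult_left_mono) auto
    finally show "cmod (X w) \<le> (C * cmod (snd z) powr crit_exponent) * cmod (snd w) powr crit_exponent" by simp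
  qed
  have cm: "continuous_on Om (\<lambda>w. ?s w ^ a * ?t w powi min_exponent a)"
    using z2 by (intro continuous_intros continuous_on_power_int) (auto dest: Om_snd)
  have ct1: "1 - ?t w \<noteq> 0" if "w \<in> Om" for w using stu(3)[OF z that] by auto
  have iG: "integrable MM G" unfolding G_def
    by (intro integrable_norm ipre[of _ 1] cm) auto
  have fmeas: "f i \<in> borel_measurable MM" for i unfolding f_def
    by (intro borel_measurable_times measurable_MM_hol[OF h] measurable_MM_continuous cm continuous_intros)
  have fb: "cmod (f i w) \<le> D i * G w" if "w \<in> space MM" for i w
  proof -
    have w: "w \<in> Om" using that by simp
    have e: "cmod (of_nat m * of_nat i + of_int (norm_offset a)) = real m * real i + real_of_int (norm_offset a)"
    proof -
      have "(of_nat m * of_nat i + of_int (norm_offset a) :: complex) = of_real (real m * real i + real_of_int (norm_offset a))" by simp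
      moreover have "real m * real i + real_of_int (norm_offset a) \<ge> 0" using norm_offset_pos[of a] by simp
      ultimately show ?thesis by (simp only: norm_of_real abs_of_nonneg)
    qed
    have "cmod (?t w ^ i) \<le> cmod (snd z) ^ i" unfolding norm_power by (intro power_mono stu(2)[OF z w]) auto
    then have X: "(real m * real i + real_of_int (norm_offset a)) * cmod (?t w ^ i) \<le> (real m * real i + real_of_int (norm_offset a)) * cmod (snd z) ^ i"
      using norm_offset_pos[of a] by (intro mult_left_mono) auto
    have "cmod ((of_nat a + 1) / q) * ((real m * real i + real_of_int (norm_offset a)) * cmod (?t w ^ i)) * G w \<le> D i * G w"
      unfolding D_def by (rule mult_right_mono[OF mult_left_mono[OF X]]) (auto simp: G_def)
    moreover have "cmod (f i w) = cmod ((of_nat a + 1) / q) * ((real m * real i + real_of_int (norm_offset a)) * cmod (?t w ^ i)) * G w"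
      unfolding f_def G_def norm_mult e by (simp only: mult_ac)
    ultimately show ?thesis by simp
  qed
  have sD: "summable D" unfolding D_def
    by (intro summable_mult summable_arith_geometric) (use z2 in auto)
  have sums1: "(\<lambda>i. \<integral>w. f i w \<partial>MM) sums (\<integral>w. (\<Sum>i. f i w) \<partial>MM)"
    by (rule sums_integral_dominated[OF fmeas iG sD fb])
  have sumf: "(\<Sum>i. f i w) = (of_nat a + 1) * ?s w ^ a * ?t w powi min_exponent a 
      * ((of_int (norm_offset a) + (of_nat m - of_int (norm_offset a)) * ?t w) / (1 - ?t w)\<^sup>2) / q * h w" if w: "w \<in> Om" for w
  proof -
    have "(\<lambda>i. (of_nat a + 1) / q * (?s w ^ a * ?t w powi min_exponent a) * h w * ((of_nat m * of_nat i + of_int (norm_offset a)) * ?t w ^ i)) sums 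
       ((of_nat a + 1) / q * (?s w ^ a * ?t w powi min_exponent a) * h w * ((of_int (norm_offset a) + (of_nat m - of_int (norm_offset a)) * ?t w) / (1 - ?t w)\<^sup>2))"
      by (intro sums_mult arith_geometric_sums stu(3)[OF z w])
    then have "f' sums y" if "f' = (\<lambda>i. f i w)" "y = (of_nat a + 1) * ?s w ^ a * ?t w powi min_exponent a 
      * ((of_int (norm_offset a) + (of_nat m - of_int (norm_offset a)) * ?t w) / (1 - ?t w)\<^sup>2) / q * h w" for f' y
      unfolding that f_def by (simp add: mult_ac)
    then show ?thesis by (simp add: sums_iff)
  qed
  have intf: "(\<integral>w. f i w \<partial>MM) = fst z ^ a * snd z powi min_exponent a * ((deriv ^^ i) g 0 / fact i * snd z ^ i)" for i
  proof -
    \<comment> \<open>Chosen so that q / N is the squared norm of the monomial.\<close>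
    define N where "N = complex_of_real ((real a + 1) * (real m * real i + real_of_int (norm_offset a)))"
    have "(real a + 1) * (real m * real i + real_of_int (norm_offset a)) > 0"
      using norm_offset_pos[of a] by (intro mult_pos_pos add_nonneg_pos) auto
    then have N: "N \<noteq> 0" unfolding N_def by (simp only: of_real_eq_0_iff)
    have I: "(\<integral>w. h w * cnj (fst w ^ a * snd w powi (min_exponent a + int i)) \<partial>MM) = (deriv ^^ i) g 0 / fact i * (q / N)"
      using coeff_formula[OF h int g, of i] by (simp only: q_def N_def of_real_divide)
    have "(\<integral>w. f i w \<partial>MM) = (\<integral>w. N / q * fst z ^ a * snd z powi min_exponent a * snd z ^ i * (h w * cnj (fst w ^ a * snd w powi (min_exponent a + int i))) \<partial>MM)"
    proof (rule Bochner_Integration.integral_cong[OF refl])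
      fix w assume "w \<in> space MM"
      then have "snd w \<noteq> 0" using Om_snd by auto
      then show "f i w = N / q * fst z ^ a * snd z powi min_exponent a * snd z ^ i * (h w * cnj (fst w ^ a * snd w powi (min_exponent a + int i)))"
        using q by (simp add: f_def N_def power_int_add power_int_mult_distrib power_mult_distrib mult_ac)
    qed
    also have "\<dots> = N / q * fst z ^ a * snd z powi min_exponent a * snd z ^ i * ((deriv ^^ i) g 0 / fact i * (q / N))"
      unfolding integral_mult_right_zero I ..
    also have "\<dots> = fst z ^ a * snd z powi min_exponent a * ((deriv ^^ i) g 0 / fact i * snd z ^ i)"
      using q N by (simp add: field_simps)
    finally show ?thesis .
  qed
  have sums2: "(\<lambda>i. \<integral>w. f i w \<partial>MM) sums (fst z ^ a * snd z powi min_exponent a * g (snd z))"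
    unfolding intf using holomorphic_power_series[OF g(1), of "snd z"] z2 by (intro sums_mult) simp
  have "(\<integral>w. (\<Sum>i. f i w) \<partial>MM) = fst z ^ a * snd z powi min_exponent a * g (snd z)"
    by (rule sums_unique2[OF sums1 sums2])
  also have "\<dots> = slice_taylor h a (snd z) * fst z ^ a" using g(2)[of "snd z"] z2 by simp
  finally have *: "(\<integral>w. (\<Sum>i. f i w) \<partial>MM) = slice_taylor h a (snd z) * fst z ^ a" .
  have "(\<integral>w. (\<Sum>i. f i w) \<partial>MM) = (\<integral>w. (of_nat a + 1) * ?s w ^ a * ?t w powi min_exponent a 
      * ((of_int (norm_offset a) + (of_nat m - of_int (norm_offset a)) * ?t w) / (1 - ?t w)\<^sup>2) / q * h w \<partial>MM)"
    by (rule Bochner_Integration.integral_cong[OF refl]) (simp add: sumf)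
  with * show "(\<integral>w. (of_nat a + 1) * ?s w ^ a * ?t w powi min_exponent a 
      * ((of_int (norm_offset a) + (of_nat m - of_int (norm_offset a)) * ?t w) / (1 - ?t w)\<^sup>2) / of_real (pi\<^sup>2 * real m) * h w \<partial>MM)
     = slice_taylor h a (snd z) * fst z ^ a" by (simp add: q_def)
  define E where "E = (cmod (of_int (norm_offset a)) + cmod (of_nat m - of_int (norm_offset a))) / (1 - cmod (snd z))\<^sup>2"
  have Eb: "cmod ((of_int (norm_offset a) + (of_nat m - of_int (norm_offset a)) * ?t w) / (1 - ?t w)\<^sup>2) \<le> E" if w: "w \<in> Om" for w
  proof -
    have "cmod (of_int (norm_offset a) + (of_nat m - of_int (norm_offset a)) * ?t w) \<le> cmod (of_int (norm_offset a)) + cmod (of_nat m - of_int (norm_offset a)) * 1"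
    proof (intro order_trans[OF norm_triangle_ineq] add_left_mono)
      show "cmod ((of_nat m - of_int (norm_offset a)) * ?t w) \<le> cmod (of_nat m - of_int (norm_offset a)) * 1"
        by (subst norm_mult, rule mult_left_mono) (use stu(3)[OF z w] in simp_all)
    qed
    moreover have "1 - cmod (snd z) \<le> cmod (1 - ?t w)" using stu(2)[OF z w] norm_triangle_ineq2[of 1 "?t w"] by simp
    then have "(1 - cmod (snd z))\<^sup>2 \<le> (cmod (1 - ?t w))\<^sup>2" using z2 by (intro power_mono) auto
    ultimately show ?thesis unfolding E_def norm_divide norm_power using z2 by (intro frac_le) auto
  qed
  show "integrable MM (\<lambda>w. (of_nat a + 1) * ?s w ^ a * ?t w powi min_exponent a 
      * ((of_int (norm_offset a) + (of_nat m - of_int (norm_offset a)) * ?t w) / (1 - ?t w)\<^sup>2) / of_real (pi\<^sup>2 * real m) * h w)"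
  proof (rule ipre[of _ "cmod ((of_nat a + 1) / q) * E"])
    show "continuous_on Om (\<lambda>w. (of_nat a + 1) * ?s w ^ a * ?t w powi min_exponent a 
      * ((of_int (norm_offset a) + (of_nat m - of_int (norm_offset a)) * ?t w) / (1 - ?t w)\<^sup>2) / of_real (pi\<^sup>2 * real m))"
      using z2 ct1 m by (intro continuous_intros continuous_on_power_int) (auto dest: Om_snd)
    show "0 \<le> cmod ((of_nat a + 1) / q) * E" unfolding E_def by (intro mult_nonneg_nonneg divide_nonneg_nonneg) auto
    fix w assume w: "w \<in> Om"
    have "cmod ((of_nat a + 1) * ?s w ^ a * ?t w powi min_exponent a * ((of_int (norm_offset a) + (of_nat m - of_int (norm_offset a)) * ?t w) / (1 - ?t w)\<^sup>2) / of_real (pi\<^sup>2 * real m))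
      = cmod ((of_nat a + 1) / q) * cmod ((of_int (norm_offset a) + (of_nat m - of_int (norm_offset a)) * ?t w) / (1 - ?t w)\<^sup>2) * cmod (?s w ^ a * ?t w powi min_exponent a)"
      unfolding q_def norm_mult norm_divide by (simp only: divide_inverse mult_ac)
    also have "\<dots> \<le> cmod ((of_nat a + 1) / q) * E * cmod (?s w ^ a * ?t w powi min_exponent a)"
      by (intro mult_right_mono mult_left_mono Eb w) auto
    finally show "cmod ((of_nat a + 1) * ?s w ^ a * ?t w powi min_exponent a * ((of_int (norm_offset a) + (of_nat m - of_int (norm_offset a)) * ?t w) / (1 - ?t w)\<^sup>2) / of_real (pi\<^sup>2 * real m))
      \<le> cmod ((of_nat a + 1) / q) * E * cmod (?s w ^ a * ?t w powi min_exponent a)" .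
  qed
qed

end

subsection \<open>Boundedness\<close>

text \<open>Integrating out the angle leaves a radial integral, and x = (|w| / R)^2 turns it into
  the one-dimensional bound with e = s / 2. The constant is uniform in R, A, m and \<tau>; this is
  needed on slices, whose radius and A vary with the other coordinate.\<close>

lemma disc_schur:
  fixes c s :: real
  assumes c: "0 < c" "c < 1" and s: "s > -2"
  shows "\<exists>C>0. \<forall>R A m \<tau>. 0 < R \<longrightarrow> 0 < m \<longrightarrow> 0 \<le> \<tau> \<longrightarrow> \<tau> < 1 \<longrightarrow> (cmod A * R ^ m)\<^sup>2 \<le> \<tau> ^ m \<longrightarrow>
     (\<integral>\<^sup>+w. ennreal ((1 - (cmod w / R)\<^sup>2) powr (- c) * (cmod w / R) powr s / (cmod (1 - A * cnj w ^ m))\<^sup>2) * indicator (ball 0 R) w \<partial>lborel)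
      \<le> ennreal (C * R\<^sup>2 * (1 - \<tau>) powr (- c))"
proof -
  have "s / 2 > -1" using s by simp
  from one_dim_schur_bound[OF c this] obtain C0 where C0: "C0 > 0"
    and b: "\<And>\<sigma>. \<sigma> \<in> {0..<1} \<Longrightarrow> (\<integral>\<^sup>+x. ennreal (x powr (s / 2) * (1 - x) powr (- c) / (1 - \<sigma> * x)) * indicator {0<..<1} x \<partial>lborel) \<le> ennreal (C0 * (1 - \<sigma>) powr (- c))"
    by blast
  \<comment> \<open>The radial integral in the form it takes for m = 1.\<close>
  have main: "(\<integral>\<^sup>+w. ennreal ((1 - (cmod w / R)\<^sup>2) powr (- c) * (cmod w / R) powr s / (1 - \<tau> * (cmod w / R)\<^sup>2)) * indicator (ball 0 R) w \<partial>lborel)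
      \<le> ennreal (pi * C0 * R\<^sup>2 * (1 - \<tau>) powr (- c))" if R: "0 < R" and \<tau>: "0 \<le> \<tau>" "\<tau> < 1" for R \<tau>
  proof -
    define \<phi> where "\<phi> x = ennreal ((x / R\<^sup>2) powr (s / 2) * (1 - x / R\<^sup>2) powr (- c) / (1 - \<tau> * (x / R\<^sup>2))) * indicator {0<..<1} (x / R\<^sup>2)" for x
    have [measurable]: "\<phi> \<in> borel_measurable borel" unfolding \<phi>_def by measurable
    have "(\<integral>\<^sup>+w. ennreal ((1 - (cmod w / R)\<^sup>2) powr (- c) * (cmod w / R) powr s / (1 - \<tau> * (cmod w / R)\<^sup>2)) * indicator (ball 0 R) w \<partial>lborel)
      = (\<integral>\<^sup>+w. \<phi> ((cmod (w :: complex))\<^sup>2) \<partial>lborel)"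
    proof (rule nn_integral_cong_AE, rule AE_mp[OF AE_lborel_singleton[of "0::complex"]], intro AE_I2 impI)
      fix w :: complex assume w: "w \<noteq> 0"
      have 1: "((cmod w)\<^sup>2 / R\<^sup>2) powr (s / 2) = (cmod w / R) powr s"
        using powr_powr[of "cmod w / R" 2 "s / 2"] w R by (simp add: power_divide)
      have 2: "(cmod w)\<^sup>2 / R\<^sup>2 < 1 \<longleftrightarrow> cmod w < R" using R by (simp add: power_divide[symmetric] abs_square_less_1)
      have 3: "0 < (cmod w)\<^sup>2 / R\<^sup>2" using w R by simp
      show "ennreal ((1 - (cmod w / R)\<^sup>2) powr (- c) * (cmod w / R) powr s / (1 - \<tau> * (cmod w / R)\<^sup>2)) * indicator (ball 0 R) w = \<phi> ((cmod w)\<^sup>2)"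
        unfolding \<phi>_def 1 using 2 3 by (simp add: indicator_def power_divide mult.commute)
    qed
    also have "\<dots> = ennreal pi * (\<integral>\<^sup>+x. \<phi> x * indicator {0..} x \<partial>lborel)" by (rule nn_integral_radial) measurable
    also have "(\<integral>\<^sup>+x. \<phi> x * indicator {0..} x \<partial>lborel) = (\<integral>\<^sup>+x. \<phi> x \<partial>lborel)"
      using R by (intro nn_integral_cong) (auto simp: \<phi>_def indicator_def zero_less_divide_iff)
    also have "\<dots> = ennreal (R\<^sup>2) * (\<integral>\<^sup>+x. \<phi> (0 + R\<^sup>2 * x) \<partial>lborel)"
      using nn_integral_real_affine[of \<phi> "R\<^sup>2" 0] R by simp
    also have "(\<integral>\<^sup>+x. \<phi> (0 + R\<^sup>2 * x) \<partial>lborel) = (\<integral>\<^sup>+x. ennreal (x powr (s / 2) * (1 - x) powr (- c) / (1 - \<tau> * x)) * indicator {0<..<1} x \<partial>lborel)"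
      using R by (intro nn_integral_cong) (simp add: \<phi>_def)
    also have "ennreal pi * (ennreal (R\<^sup>2) * (\<integral>\<^sup>+x. ennreal (x powr (s / 2) * (1 - x) powr (- c) / (1 - \<tau> * x)) * indicator {0<..<1} x \<partial>lborel))
      \<le> ennreal pi * (ennreal (R\<^sup>2) * ennreal (C0 * (1 - \<tau>) powr (- c)))"
      by (intro mult_left_mono b) (use \<tau> in auto)
    also have "\<dots> = ennreal (pi * C0 * R\<^sup>2 * (1 - \<tau>) powr (- c))"
      using C0 by (simp add: ennreal_mult[symmetric] mult_ac)
    finally show ?thesis .
  qed
  show ?thesis
  proof (intro exI conjI allI impI)
    show "pi * C0 > 0" using C0 by simp
    fix R A \<tau> and m :: nat
    assume R: "0 < R" and m: "0 < m" and \<tau>: "0 \<le> \<tau>" "\<tau> < 1" and A: "(cmod A * R ^ m)\<^sup>2 \<le> \<tau> ^ m"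
    define \<omega> where "\<omega> x = (1 - (x / R)\<^sup>2) powr (- c) * (x / R) powr s" for x
    have [measurable]: "\<omega> \<in> borel_measurable borel" unfolding \<omega>_def by measurable
    have [measurable]: "ball (0::complex) R \<in> sets borel" by simp
    have \<omega>0: "0 \<le> \<omega> x" for x by (simp add: \<omega>_def)
    have "(\<integral>\<^sup>+w. ennreal (indicator (ball 0 R) w * \<omega> (cmod w)) \<partial>(lborel :: complex measure)) \<le> ennreal (pi * C0 * R\<^sup>2 * (1 - 0) powr (- c))"
      by (rule order_trans[OF eq_refl main[OF R, of 0]]) (auto simp: \<omega>_def indicator_def intro!: nn_integral_cong)
    then have int: "integrable lborel (\<lambda>w::complex. indicator (ball 0 R) w * \<omega> (cmod w))"
      using \<omega>0 C0 by (intro integrable_of_nn_bound(1)[where C="pi * C0 * R\<^sup>2 * (1 - 0) powr (- c)"]) auto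
    have "\<tau> ^ m < 1" using \<tau> m by (simp add: power_less_one_iff)
    then have "(cmod A * R ^ m)\<^sup>2 < 1" using A by linarith
    then have A1: "cmod A * R ^ m < 1" using R by (simp add: power_less_one_iff abs_square_less_1)
    have "(\<integral>\<^sup>+w. ennreal (\<omega> (cmod w) / (cmod (1 - A * cnj w ^ m))\<^sup>2) * indicator (ball 0 R) w \<partial>lborel)
      = (\<integral>\<^sup>+w. ennreal (\<omega> (cmod w) / (1 - (cmod A * cmod w ^ m)\<^sup>2)) * indicator (ball 0 R) w \<partial>(lborel :: complex measure))"
      by (rule nn_integral_angular[OF _ \<omega>0 int R A1 m]) measurable
    also have "\<dots> \<le> (\<integral>\<^sup>+w. ennreal (\<omega> (cmod w) / (1 - \<tau> * (cmod w / R)\<^sup>2)) * indicator (ball 0 R) w \<partial>(lborel :: complex measure))"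
    proof (rule nn_integral_mono)
      fix w :: complex
      show "ennreal (\<omega> (cmod w) / (1 - (cmod A * cmod w ^ m)\<^sup>2)) * indicator (ball 0 R) w \<le> ennreal (\<omega> (cmod w) / (1 - \<tau> * (cmod w / R)\<^sup>2)) * indicator (ball 0 R) w"
      proof (cases "cmod w < R")
        case True
        define \<rho> where "\<rho> = (cmod w / R)\<^sup>2"
        have \<rho>: "0 \<le> \<rho>" "\<rho> < 1" using True R by (auto simp: \<rho>_def power_less_one_iff)
        have "\<tau> * \<rho> \<le> \<tau>" using \<tau> \<rho> by (simp add: mult_left_le)
        then have \<tau>\<rho>: "0 \<le> \<tau> * \<rho>" "\<tau> * \<rho> < 1" using \<tau> \<rho> by auto
        have "(cmod A * cmod w ^ m)\<^sup>2 = (cmod A * R ^ m)\<^sup>2 * \<rho> ^ m"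
          using R by (simp add: \<rho>_def power_mult_distrib power_divide power_mult[symmetric] mult.commute)
        also have "\<dots> \<le> \<tau> ^ m * \<rho> ^ m" using A \<rho> by (intro mult_right_mono) auto
        also have "\<dots> = (\<tau> * \<rho>) ^ m" by (simp add: power_mult_distrib)
        \<comment> \<open>As \<tau> \<rho> < 1, the m-th power can be traded for the first, so no
          constant depending on m arises.\<close>
        also have "\<dots> \<le> (\<tau> * \<rho>) ^ 1" using \<tau>\<rho> m by (intro power_decreasing) auto
        finally have "1 - \<tau> * \<rho> \<le> 1 - (cmod A * cmod w ^ m)\<^sup>2" by simp
        then have "\<omega> (cmod w) / (1 - (cmod A * cmod w ^ m)\<^sup>2) \<le> \<omega> (cmod w) / (1 - \<tau> * \<rho>)"
          using \<omega>0 \<tau>\<rho> by (intro divide_left_mono mult_pos_pos) auto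
        then show ?thesis unfolding \<rho>_def by (intro mult_right_mono ennreal_leI) auto
      qed auto
    qed
    also have "\<dots> \<le> ennreal (pi * C0 * R\<^sup>2 * (1 - \<tau>) powr (- c))"
      unfolding \<omega>_def by (rule main[OF R \<tau>])
    finally show "(\<integral>\<^sup>+w. ennreal ((1 - (cmod w / R)\<^sup>2) powr (- c) * (cmod w / R) powr s / (cmod (1 - A * cnj w ^ m))\<^sup>2) * indicator (ball 0 R) w \<partial>lborel)
      \<le> ennreal (pi * C0 * R\<^sup>2 * (1 - \<tau>) powr (- c))" by (simp add: \<omega>_def)
  qed
qed

context hartogs_domain
begin

text \<open>The map \<open>(w\<^sub>1, w\<^sub>2) \<mapsto> (fibre_radius2 w, \<bar>w\<^sub>2\<bar>\<^sup>2)\<close> sends the domain to the unit square, and the squared modulus of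
  \<open>u\<close> is \<open>(fibre_radius2 z * fibre_radius2 w)\<^sup>m\<close>, so Schur's test decouples into two one-dimensional estimates.\<close>

definition fibre_radius2 :: "complex \<times> complex \<Rightarrow> real" where "fibre_radius2 w = (cmod (fst w) / cmod (snd w) powr gam)\<^sup>2"
text \<open>The exponent c governs the two boundary pieces |z1| = |z2|^gam and |z2| = 1, the
  exponent d the boundary point where \<open>z2\<close> vanishes.\<close>

definition schur_weight :: "real \<Rightarrow> real \<Rightarrow> complex \<times> complex \<Rightarrow> real" where
  "schur_weight c d w = (1 - fibre_radius2 w) powr (- c) * (1 - (cmod (snd w))\<^sup>2) powr (- c) * cmod (snd w) powr (- d)"
definition majorant :: "complex \<times> complex \<Rightarrow> complex \<times> complex \<Rightarrow> real" where
  "majorant z w = (let t = snd z * cnj (snd w); u = (fst z * cnj (fst w)) ^ m / t ^ n in 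
      cmod t powr crit_exponent / ((cmod (1 - u))\<^sup>2 * (cmod (1 - t))\<^sup>2))"

lemma fibre_radius2_bounds: 
  assumes "w \<in> Om" shows "0 \<le> fibre_radius2 w \<and> fibre_radius2 w < 1"
proof -
  have 1: "cmod (fst w) < cmod (snd w) powr gam" using assms by (cases w) (auto simp: Om_iff)
  then have "0 < cmod (snd w) powr gam" using le_less_trans[OF norm_ge_zero] by blast
  then show ?thesis using 1 by (simp add: fibre_radius2_def abs_square_less_1)
qed

lemma borel_cnj [measurable]: "cnj \<in> borel_measurable borel"
  by (intro borel_measurable_continuous_onI continuous_intros)

lemma fst_snd_MM [measurable]: "fst \<in> borel_measurable MM" "snd \<in> borel_measurable MM"
  by (intro measurable_MM_I; measurable)+

lemma schur_weight_measurable [measurable]: "schur_weight c d \<in> borel_measurable MM"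
  unfolding schur_weight_def fibre_radius2_def by measurable

lemma schur_weight_pos: 
  assumes w: "w \<in> Om" shows "0 < schur_weight c d w"
proof -
  have "cmod (snd w) < 1" using w by (cases w) (auto simp: Om_iff)
  then have "(cmod (snd w))\<^sup>2 < 1" by (simp add: abs_square_less_1)
  then show ?thesis unfolding schur_weight_def using fibre_radius2_bounds[OF w] Om_snd[OF w] by (intro mult_pos_pos) auto
qed

lemma majorant_measurable: "majorant z \<in> borel_measurable MM"
  unfolding majorant_def Let_def by measurable

text \<open>Of the conditions on d, the first makes the integral converge at
  \<open>snd w = 0\<close> once the slice has contributed \<open>2 * gam\<close>; the second lets
  the factor \<open>cmod z2 powr crit_exponent\<close> coming from the kernel be absorbed into the
  weight at \<open>z\<close>.\<close>

lemma majorant_integral: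
  assumes c: "0 < c" "c < 1" and d: "crit_exponent - d + 2 * gam > -2" "- d \<le> crit_exponent"
  shows "\<exists>C>0. \<forall>z\<in>Om. (\<integral>\<^sup>+w. ennreal (majorant z w * schur_weight c d w) \<partial>MM) \<le> ennreal (C * schur_weight c d z)"
proof -
  define s where "s = crit_exponent - d + 2 * gam"
  obtain C1 where C1: "C1 > 0" and b1: "\<And>R A m \<tau>. 0 < R \<Longrightarrow> 0 < m \<Longrightarrow> 0 \<le> \<tau> \<Longrightarrow> \<tau> < 1 \<Longrightarrow> (cmod A * R ^ m)\<^sup>2 \<le> \<tau> ^ m \<Longrightarrow>
     (\<integral>\<^sup>+w. ennreal ((1 - (cmod w / R)\<^sup>2) powr (- c) * (cmod w / R) powr 0 / (cmod (1 - A * cnj w ^ m))\<^sup>2) * indicator (ball 0 R) w \<partial>lborel)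
      \<le> ennreal (C1 * R\<^sup>2 * (1 - \<tau>) powr (- c))"
    using disc_schur[OF c, of 0] by auto
  obtain C2 where C2: "C2 > 0" and b2: "\<And>R A m \<tau>. 0 < R \<Longrightarrow> 0 < m \<Longrightarrow> 0 \<le> \<tau> \<Longrightarrow> \<tau> < 1 \<Longrightarrow> (cmod A * R ^ m)\<^sup>2 \<le> \<tau> ^ m \<Longrightarrow>
     (\<integral>\<^sup>+w. ennreal ((1 - (cmod w / R)\<^sup>2) powr (- c) * (cmod w / R) powr s / (cmod (1 - A * cnj w ^ m))\<^sup>2) * indicator (ball 0 R) w \<partial>lborel)
      \<le> ennreal (C2 * R\<^sup>2 * (1 - \<tau>) powr (- c))"
    using disc_schur[OF c, of s] d by (auto simp: s_def)
  show ?thesis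
  proof (intro exI conjI ballI)
    show "C1 * C2 > 0" using C1 C2 by simp
    fix z assume z: "z \<in> Om"
    obtain z1 z2 where zz: "z = (z1, z2)" by (cases z)
    have z': "cmod z1 < cmod z2 powr gam" "cmod z2 < 1" "z2 \<noteq> 0" using z by (auto simp: zz Om_iff)
    have X: "0 \<le> fibre_radius2 z" "fibre_radius2 z < 1" using fibre_radius2_bounds[OF z] by auto
    \<comment> \<open>The part of the integrand that is constant on a slice.\<close>
    define K where "K w2 = cmod (z2 * cnj w2) powr crit_exponent / (cmod (1 - z2 * cnj w2))\<^sup>2 * (1 - (cmod w2)\<^sup>2) powr (- c) * cmod w2 powr (- d)" for w2
    have K0: "0 \<le> K w2" for w2 by (simp add: K_def)
    define P where "P = C1 * (1 - fibre_radius2 z) powr (- c) * cmod z2 powr crit_exponent"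
    have P0: "0 \<le> P" using C1 by (simp add: P_def)
    have inner: "(\<integral>\<^sup>+w1. ennreal (majorant z (w1, w2) * schur_weight c d (w1, w2)) * indicator Om (w1, w2) \<partial>lborel)
       \<le> ennreal (P) * (ennreal ((1 - (cmod w2 / 1)\<^sup>2) powr (- c) * (cmod w2 / 1) powr s / (cmod (1 - z2 * cnj w2 ^ 1))\<^sup>2) * indicator (ball 0 1) w2)" for w2
    proof (cases "cmod w2 < 1 \<and> w2 \<noteq> 0")
      case True
      define R where "R = cmod w2 powr gam"
      have R: "R > 0" using True by (simp add: R_def)
      \<comment> \<open>With this constant the u of the kernel is \<open>A * cnj w1 ^ m\<close>, and
        \<open>A * R ^ m\<close> has squared modulus \<open>fibre_radius2 z ^ m\<close>.\<close>
      define A where "A = z1 ^ m / (z2 * cnj w2) ^ n"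
      have Rm: "R ^ m = cmod w2 ^ n" if "x2 \<noteq> 0" for x2 :: complex
        using True m powr_realpow[of R m] powr_realpow[of "cmod w2" n] by (simp add: R_def powr_powr gam_def)
      have z2m: "(cmod z2 powr gam) ^ m = cmod z2 ^ n"
        using z' m powr_realpow[of "cmod z2 powr gam" m] powr_realpow[of "cmod z2" n] by (simp add: powr_powr gam_def)
      have "cmod A * R ^ m = cmod z1 ^ m / cmod z2 ^ n"
        using True z' Rm[OF z'(3)] by (simp add: A_def norm_divide norm_power norm_mult power_mult_distrib)
      also have "\<dots> = (cmod z1 / cmod z2 powr gam) ^ m" by (simp add: power_divide z2m)
      finally have A: "(cmod A * R ^ m)\<^sup>2 \<le> fibre_radius2 z ^ m"
        by (simp add: fibre_radius2_def zz power_mult[symmetric] mult.commute)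
      have iO: "indicator Om (w1, w2) = (indicator (ball 0 R) w1 :: ennreal)" for w1 using True by (simp add: indicator_Om R_def)
      have "(\<integral>\<^sup>+w1. ennreal (majorant z (w1, w2) * schur_weight c d (w1, w2)) * indicator Om (w1, w2) \<partial>lborel)
        = (\<integral>\<^sup>+w1. ennreal (K w2) * (ennreal ((1 - (cmod w1 / R)\<^sup>2) powr (- c) * (cmod w1 / R) powr 0 / (cmod (1 - A * cnj w1 ^ m))\<^sup>2) * indicator (ball 0 R) w1) \<partial>lborel)"
      \<comment> \<open>The factor with exponent 0 equals 1 only away from
        \<open>w1 = 0\<close>.\<close>
      proof (rule nn_integral_cong_AE, rule AE_mp[OF AE_lborel_singleton[of "0::complex"]], intro AE_I2 impI)
        fix w1 :: complex assume w1: "w1 \<noteq> 0"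
        have "(z1 * cnj w1) ^ m / (z2 * cnj w2) ^ n = A * cnj w1 ^ m" by (simp add: A_def power_mult_distrib)
        then have "majorant z (w1, w2) * schur_weight c d (w1, w2) = K w2 * ((1 - (cmod w1 / R)\<^sup>2) powr (- c) * (cmod w1 / R) powr 0 / (cmod (1 - A * cnj w1 ^ m))\<^sup>2)"
          using w1 R by (simp add: majorant_def schur_weight_def fibre_radius2_def Let_def zz K_def R_def mult_ac)
        then show "ennreal (majorant z (w1, w2) * schur_weight c d (w1, w2)) * indicator Om (w1, w2) = ennreal (K w2) * (ennreal ((1 - (cmod w1 / R)\<^sup>2) powr (- c) * (cmod w1 / R) powr 0 / (cmod (1 - A * cnj w1 ^ m))\<^sup>2) * indicator (ball 0 R) w1)"
          unfolding iO using K0 by (simp add: ennreal_mult'[symmetric] mult.assoc[symmetric])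
      qed
      also have "\<dots> = ennreal (K w2) * (\<integral>\<^sup>+w1. ennreal ((1 - (cmod w1 / R)\<^sup>2) powr (- c) * (cmod w1 / R) powr 0 / (cmod (1 - A * cnj w1 ^ m))\<^sup>2) * indicator (ball 0 R) w1 \<partial>lborel)"
      proof (rule nn_integral_cmult)
        have [measurable]: "ball (0::complex) R \<in> sets borel" by simp
        show "(\<lambda>w1. ennreal ((1 - (cmod w1 / R)\<^sup>2) powr (- c) * (cmod w1 / R) powr 0 / (cmod (1 - A * cnj w1 ^ m))\<^sup>2) * indicator (ball 0 R) w1) \<in> borel_measurable lborel"
          by measurable
      qed
      also have "\<dots> \<le> ennreal (K w2) * ennreal (C1 * R\<^sup>2 * (1 - fibre_radius2 z) powr (- c))"
        by (intro mult_left_mono b1[OF R m X A]) auto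
      also have "\<dots> = ennreal (K w2 * (C1 * R\<^sup>2 * (1 - fibre_radius2 z) powr (- c)))"
        using K0 by (simp add: ennreal_mult')
      also have "K w2 * (C1 * R\<^sup>2 * (1 - fibre_radius2 z) powr (- c)) = (P) * ((1 - (cmod w2 / 1)\<^sup>2) powr (- c) * (cmod w2 / 1) powr s / (cmod (1 - z2 * cnj w2 ^ 1))\<^sup>2)"
      proof -
        have "cmod w2 powr s = cmod w2 powr crit_exponent * cmod w2 powr (- d) * R\<^sup>2"
          unfolding R_def powr_square powr_add[symmetric] by (simp add: s_def)
        then show ?thesis by (simp add: K_def P_def norm_mult powr_mult mult_ac)
      qed
      finally show ?thesis using True P0 by (simp only: ennreal_mult') simp
    next
      case False
      have "indicator Om (w1, w2) = (0 :: ennreal)" for w1 using False Om_snd[of "(w1, w2)"] by (auto simp: indicator_def Om_iff)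
      then show ?thesis by simp
    qed
    have "(\<integral>\<^sup>+w. ennreal (majorant z w * schur_weight c d w) \<partial>MM) = (\<integral>\<^sup>+w2. \<integral>\<^sup>+w1. ennreal (majorant z (w1, w2) * schur_weight c d (w1, w2)) * indicator Om (w1, w2) \<partial>lborel \<partial>lborel)"
      by (rule nn_integral_MM_iterated) (use majorant_measurable in measurable)
    also have "\<dots> \<le> (\<integral>\<^sup>+w2. ennreal (P) * (ennreal ((1 - (cmod w2 / 1)\<^sup>2) powr (- c) * (cmod w2 / 1) powr s / (cmod (1 - z2 * cnj w2 ^ 1))\<^sup>2) * indicator (ball 0 1) w2) \<partial>lborel)"
      by (intro nn_integral_mono inner)
    also have "\<dots> = ennreal (P) * (\<integral>\<^sup>+w2. ennreal ((1 - (cmod w2 / 1)\<^sup>2) powr (- c) * (cmod w2 / 1) powr s / (cmod (1 - z2 * cnj w2 ^ 1))\<^sup>2) * indicator (ball 0 1) w2 \<partial>lborel)"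
    proof (rule nn_integral_cmult)
      have [measurable]: "ball (0::complex) 1 \<in> sets borel" by simp
      show "(\<lambda>w2. ennreal ((1 - (cmod w2 / 1)\<^sup>2) powr (- c) * (cmod w2 / 1) powr s / (cmod (1 - z2 * cnj w2 ^ 1))\<^sup>2) * indicator (ball 0 1) w2) \<in> borel_measurable lborel"
        by measurable
    qed
    also have "\<dots> \<le> ennreal (P) * ennreal (C2 * 1\<^sup>2 * (1 - (cmod z2)\<^sup>2) powr (- c))"
      by (intro mult_left_mono b2) (use z' in \<open>auto simp: power_less_one_iff\<close>)
    also have "\<dots> = ennreal (C1 * C2 * ((1 - fibre_radius2 z) powr (- c) * (1 - (cmod z2)\<^sup>2) powr (- c) * cmod z2 powr crit_exponent))"
      using P0 C2 by (simp add: ennreal_mult'[symmetric] P_def mult_ac)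
    also have "\<dots> \<le> ennreal (C1 * C2 * schur_weight c d z)"
    proof (intro ennreal_leI mult_left_mono)
      have "cmod z2 powr crit_exponent \<le> cmod z2 powr (- d)" using z' d(2) by (intro powr_mono') auto
      then show "(1 - fibre_radius2 z) powr (- c) * (1 - (cmod z2)\<^sup>2) powr (- c) * cmod z2 powr crit_exponent \<le> schur_weight c d z"
        unfolding schur_weight_def zz snd_conv by (intro mult_left_mono) auto
    qed (use C1 C2 in auto)
    finally show "(\<integral>\<^sup>+w. ennreal (majorant z w * schur_weight c d w) \<partial>MM) \<le> ennreal (C1 * C2 * schur_weight c d z)" .
  qed
qed

end

section \<open>Pointwise bounds for the kernel and its reproducing property\<close>

context hartogs_domain
begin

lemma kernel_cnj: "kernel w z = cnj (kernel z w)"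
  unfolding kernel_def Let_def by (simp add: mult.commute)

text \<open>The factor m bounds the numerator in u and the bracket the numerator in t, for u and t
  in the unit disc. The summand 1 secures positivity.\<close>

definition kernel_const :: real where
  "kernel_const = 1 + (\<Sum>r<m. real m * (cmod (of_int (norm_offset r)) + cmod (of_nat m - of_int (norm_offset r)))) / (pi\<^sup>2 * real m)"

lemma kernel_const_pos: "kernel_const > 0"
  unfolding kernel_const_def by (intro add_pos_nonneg divide_nonneg_nonneg sum_nonneg mult_nonneg_nonneg add_nonneg_nonneg) auto

lemma kernel_bound:
  assumes z: "z \<in> Om" and w: "w \<in> Om"
  shows "cmod (kernel z w) \<le> kernel_const * majorant z w"
proof -
  define s where "s = fst z * cnj (fst w)"
  define t where "t = snd z * cnj (snd w)"
  define u where "u = s ^ m / t ^ n"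
  note S = stu[OF z w, folded s_def t_def, folded u_def]
  define E where "E r = cmod (of_int (norm_offset r)) + cmod (of_nat m - of_int (norm_offset r))" for r
  have majorant: "majorant z w = cmod t powr crit_exponent / ((cmod (1 - u))\<^sup>2 * (cmod (1 - t))\<^sup>2)"
    by (simp add: majorant_def Let_def s_def t_def u_def)
  have HH0: "0 \<le> majorant z w" unfolding majorant by simp
  have trm: "cmod (s ^ r * t powi min_exponent r * ((of_nat r + 1 + (of_nat m - of_nat r - 1) * u) / (1 - u)\<^sup>2)
        * ((of_int (norm_offset r) + (of_nat m - of_int (norm_offset r)) * t) / (1 - t)\<^sup>2)) \<le> real m * E r * majorant z w" if r: "r < m" for r
  proof -
    have "of_nat r + 1 + (of_nat m - of_nat r - 1) * u = complex_of_real (real r + 1) + complex_of_real (real m - real r - 1) * u" by simp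
    also have "cmod \<dots> \<le> cmod (complex_of_real (real r + 1)) + cmod (complex_of_real (real m - real r - 1)) * cmod u"
      by (rule order_trans[OF norm_triangle_ineq]) (simp add: norm_mult)
    also have "\<dots> \<le> (real r + 1) + (real m - real r - 1) * 1"
      unfolding norm_of_real using r S(7) by (intro add_mono mult_mono) auto
    finally have 1: "cmod (of_nat r + 1 + (of_nat m - of_nat r - 1) * u) \<le> real m" by simp
    have "cmod (of_int (norm_offset r) + (of_nat m - of_int (norm_offset r)) * t) \<le> cmod (of_int (norm_offset r)) + cmod (of_nat m - of_int (norm_offset r)) * cmod t"
      by (rule order_trans[OF norm_triangle_ineq]) (simp add: norm_mult)
    also have "\<dots> \<le> E r" unfolding E_def using S(3) by (intro add_left_mono mult_left_le) auto
    finally have 2: "cmod (of_int (norm_offset r) + (of_nat m - of_int (norm_offset r)) * t) \<le> E r" .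
    have "cmod (s ^ r * t powi min_exponent r * ((of_nat r + 1 + (of_nat m - of_nat r - 1) * u) / (1 - u)\<^sup>2)
        * ((of_int (norm_offset r) + (of_nat m - of_int (norm_offset r)) * t) / (1 - t)\<^sup>2))
      = cmod (s ^ r * t powi min_exponent r) * (cmod (of_nat r + 1 + (of_nat m - of_nat r - 1) * u) / (cmod (1 - u))\<^sup>2)
        * (cmod (of_int (norm_offset r) + (of_nat m - of_int (norm_offset r)) * t) / (cmod (1 - t))\<^sup>2)"
      by (simp only: norm_mult norm_divide norm_power)
    also have "\<dots> \<le> cmod t powr crit_exponent * (real m / (cmod (1 - u))\<^sup>2) * (E r / (cmod (1 - t))\<^sup>2)"
      using monomial_bound[OF S(4,1)] S(3) by (intro mult_mono divide_right_mono 1 2) (auto simp: E_def)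
    also have "\<dots> = real m * E r * majorant z w" by (simp add: majorant)
    finally show ?thesis .
  qed
  have "cmod (kernel z w) = cmod (\<Sum>r<m. s ^ r * t powi min_exponent r * ((of_nat r + 1 + (of_nat m - of_nat r - 1) * u) / (1 - u)\<^sup>2)
        * ((of_int (norm_offset r) + (of_nat m - of_int (norm_offset r)) * t) / (1 - t)\<^sup>2)) / (pi\<^sup>2 * real m)"
    unfolding kernel_def Let_def s_def[symmetric] t_def[symmetric] u_def[symmetric] norm_divide norm_of_real by simp
  also have "\<dots> \<le> (\<Sum>r<m. real m * E r * majorant z w) / (pi\<^sup>2 * real m)"
    by (intro divide_right_mono order_trans[OF norm_sum] sum_mono trm) auto
  also have "\<dots> = (\<Sum>r<m. real m * E r) / (pi\<^sup>2 * real m) * majorant z w" by (simp add: sum_distrib_right)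
  also have "\<dots> \<le> kernel_const * majorant z w" using HH0 by (intro mult_right_mono) (auto simp: kernel_const_def E_def)
  finally show ?thesis .
qed

text \<open>The denominators are replaced by lower bounds valid for all \<open>w\<close>, which
  leaves a factor continuous in \<open>z\<close> and separated from \<open>w\<close>. It is meant
  for integrability in \<open>w\<close> and for domination locally uniform in \<open>z\<close>, not
  for norm estimates.\<close>

definition kernel_growth :: "complex \<times> complex \<Rightarrow> real" where
  "kernel_growth z = kernel_const * (cmod (snd z) powr crit_exponent / ((1 - cmod (fst z ^ m / snd z ^ n))\<^sup>2 * (1 - cmod (snd z))\<^sup>2))"

lemma kernel_bound': 
  assumes z: "z \<in> Om" and w: "w \<in> Om"
  shows "cmod (kernel z w) \<le> kernel_growth z * cmod (snd w) powr crit_exponent"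
proof -
  define s where "s = fst z * cnj (fst w)"
  define t where "t = snd z * cnj (snd w)"
  define u where "u = s ^ m / t ^ n"
  note S = stu[OF z w, folded s_def t_def, folded u_def]
  have z2: "cmod (snd z) < 1" using z by (cases z) (auto simp: Om_iff)
  have 1: "1 - cmod (fst z ^ m / snd z ^ n) \<le> cmod (1 - u)" using S(5) norm_triangle_ineq2[of 1 u] by simp
  have 2: "1 - cmod (snd z) \<le> cmod (1 - t)" using S(2) norm_triangle_ineq2[of 1 t] by simp
  have p: "0 < 1 - cmod (fst z ^ m / snd z ^ n)" "0 < 1 - cmod (snd z)" using S(6) z2 by auto
  have "majorant z w = cmod t powr crit_exponent / ((cmod (1 - u))\<^sup>2 * (cmod (1 - t))\<^sup>2)"
    by (simp add: majorant_def Let_def s_def t_def u_def)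
  also have "\<dots> \<le> cmod t powr crit_exponent / ((1 - cmod (fst z ^ m / snd z ^ n))\<^sup>2 * (1 - cmod (snd z))\<^sup>2)"
    using 1 2 p by (intro divide_left_mono mult_mono power_mono mult_pos_pos zero_less_power) auto
  finally have "kernel_const * majorant z w \<le> kernel_const * (cmod t powr crit_exponent / ((1 - cmod (fst z ^ m / snd z ^ n))\<^sup>2 * (1 - cmod (snd z))\<^sup>2))"
    using kernel_const_pos by (intro mult_left_mono) auto
  with kernel_bound[OF z w] show ?thesis unfolding kernel_growth_def S(8) by simp
qed

lemma kernel_growth_continuous: "continuous_on Om kernel_growth"
  unfolding kernel_growth_def
proof (intro continuous_intros ballI)
  fix z assume z: "z \<in> Om"
  have "cmod (snd z) < 1" using z by (cases z) (auto simp: Om_iff)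
  moreover have "1 - cmod (fst z ^ m / snd z ^ n) \<noteq> 0" using stu(6)[OF z z] by auto
  ultimately show "(1 - cmod (fst z ^ m / snd z ^ n))\<^sup>2 * (1 - cmod (snd z))\<^sup>2 \<noteq> 0" by simp
qed (auto dest: Om_snd)

lemma kernel_hol:
  assumes w: "w \<in> Om"
  shows "holomorphic2_on (\<lambda>z. kernel z w) Om"
proof -
  have s: "holomorphic2_on (\<lambda>z. fst z * cnj (fst w)) Om" and t: "holomorphic2_on (\<lambda>z. snd z * cnj (snd w)) Om"
    by (intro holomorphic2_on_mult holomorphic2_on_fst holomorphic2_on_snd holomorphic2_on_const)+
  have t0: "snd z * cnj (snd w) \<noteq> 0" if "z \<in> Om" for z using stu(1)[OF that w] .
  have t1: "1 - snd z * cnj (snd w) \<noteq> 0" if "z \<in> Om" for z using stu(3)[OF that w] by auto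
  have u1: "1 - (fst z * cnj (fst w)) ^ m / (snd z * cnj (snd w)) ^ n \<noteq> 0" if "z \<in> Om" for z using stu(7)[OF that w] by (metis eq_iff_diff_eq_0 norm_one order_less_irrefl)
  have u: "holomorphic2_on (\<lambda>z. (fst z * cnj (fst w)) ^ m / (snd z * cnj (snd w)) ^ n) Om"
    by (intro holomorphic2_on_divide holomorphic2_on_power s t) (use t0 in auto)
  have 1: "holomorphic2_on (\<lambda>z. (fst z * cnj (fst w)) ^ r * (snd z * cnj (snd w)) powi min_exponent r) Om" for r
    by (rule holomorphic2_on_mult[OF holomorphic2_on_power[OF s] holomorphic2_on_power_int[OF t t0]])
  have 2: "holomorphic2_on (\<lambda>z. (c + d * x z) / (1 - x z)\<^sup>2) Om"
    if x: "holomorphic2_on x Om" "\<And>z. z \<in> Om \<Longrightarrow> 1 - x z \<noteq> 0" for c d x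
  proof (rule holomorphic2_on_divide)
    show "holomorphic2_on (\<lambda>z. c + d * x z) Om"
      by (rule holomorphic2_on_add[OF holomorphic2_on_const holomorphic2_on_mult[OF holomorphic2_on_const x(1)]])
    show "holomorphic2_on (\<lambda>z. (1 - x z)\<^sup>2) Om"
      by (rule holomorphic2_on_power[OF holomorphic2_on_diff[OF holomorphic2_on_const x(1)]])
  qed (use x(2) in simp)
  have "holomorphic2_on (\<lambda>z. (1 / of_real (pi\<^sup>2 * real m)) * (\<Sum>r<m. (fst z * cnj (fst w)) ^ r * (snd z * cnj (snd w)) powi min_exponent r 
      * ((of_nat r + 1 + (of_nat m - of_nat r - 1) * ((fst z * cnj (fst w)) ^ m / (snd z * cnj (snd w)) ^ n)) / (1 - (fst z * cnj (fst w)) ^ m / (snd z * cnj (snd w)) ^ n)\<^sup>2)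
      * ((of_int (norm_offset r) + (of_nat m - of_int (norm_offset r)) * (snd z * cnj (snd w))) / (1 - snd z * cnj (snd w))\<^sup>2))) Om"
    by (rule holomorphic2_on_mult[OF holomorphic2_on_const holomorphic2_on_sum[OF holomorphic2_on_mult[OF holomorphic2_on_mult[OF 1 2[OF u u1]] 2[OF t t1]]]])
  then show ?thesis unfolding kernel_def Let_def by simp
qed

lemma measurable_power_int_complex [measurable]:
  fixes f :: "'a \<Rightarrow> complex"
  assumes [measurable]: "f \<in> borel_measurable M"
  shows "(\<lambda>x. f x powi k) \<in> borel_measurable M"
  unfolding power_int_def by measurable

lemma kernel_measurable2: "(\<lambda>(z, w). kernel z w) \<in> borel_measurable (MM \<Otimes>\<^sub>M MM)"
  unfolding kernel_def Let_def by measurable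

lemma kernel_measurable: "kernel z \<in> borel_measurable MM" 
  unfolding kernel_def Let_def by measurable

lemma integrable_Ker_mult:
  assumes z: "z \<in> Om" and "h \<in> borel_measurable MM" "integrable MM (\<lambda>w. cmod (h w) powr q)" "2 \<le> q"
  shows "integrable MM (\<lambda>w. kernel z w * h w)"
  by (rule integrable_mult_kap[OF assms(2) kernel_measurable assms(3,4), of z "kernel_growth z"]) (rule kernel_bound'[OF z])

lemma proj_holomorphic:
  assumes f: "f \<in> borel_measurable MM" "integrable MM (\<lambda>w. cmod (f w) powr q)" "2 \<le> q"
  shows "holomorphic2_on (\<lambda>z. \<integral>w. kernel z w * f w \<partial>MM) Om"
proof (rule holomorphic2_on_integral[OF open_Om])
  show "holomorphic2_on (\<lambda>z. kernel z w * f w) Om" if "w \<in> space MM" for w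
    using that by (intro holomorphic2_on_mult holomorphic2_on_const kernel_hol) simp
  show "(\<lambda>w. kernel z w * f w) \<in> borel_measurable MM" for z
    by (intro borel_measurable_times kernel_measurable f)
  fix z0 assume z0: "z0 \<in> Om"
  obtain r where r: "r > 0" "cball z0 r \<subseteq> Om" using open_Om z0 open_contains_cball by blast
  \<comment> \<open>Compactness gives one majorant for all \<open>z\<close> near
    \<open>z0\<close>.\<close>
  have "compact (kernel_growth ` cball z0 r)"
    by (intro compact_continuous_image continuous_on_subset[OF kernel_growth_continuous r(2)] compact_cball)
  then obtain B where B: "\<And>z. z \<in> cball z0 r \<Longrightarrow> norm (kernel_growth z) \<le> B"
    using compact_imp_bounded bounded_iff by (metis (no_types, lifting) image_eqI)
  have "integrable MM (\<lambda>w. of_real (cmod (snd w) powr crit_exponent) * f w)"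
    by (rule integrable_mult_kap[OF f(1) _ f(2,3), of _ 1]) auto
  then have iG: "integrable MM (\<lambda>w. B * cmod (of_real (cmod (snd w) powr crit_exponent) * f w))" by auto
  show "\<exists>r>0. \<exists>G. ball z0 r \<subseteq> Om \<and> integrable MM G \<and> (\<forall>z\<in>ball z0 r. \<forall>w\<in>space MM. cmod (kernel z w * f w) \<le> G w)"
  proof (intro exI conjI ballI, rule r(1))
    show "ball z0 r \<subseteq> Om" using r ball_subset_cball by blast
    show "integrable MM (\<lambda>w. B * cmod (of_real (cmod (snd w) powr crit_exponent) * f w))" by (rule iG)
    fix z w assume z: "z \<in> ball z0 r" and w: "w \<in> space MM"
    have zc: "z \<in> cball z0 r" using z by simp
    have "cmod (kernel z w) \<le> kernel_growth z * cmod (snd w) powr crit_exponent" using kernel_bound'[of z w] zc r w by auto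
    also have "\<dots> \<le> B * cmod (snd w) powr crit_exponent" using B[OF zc] by (intro mult_right_mono) auto
    finally have "cmod (kernel z w) * cmod (f w) \<le> B * cmod (snd w) powr crit_exponent * cmod (f w)" by (rule mult_right_mono) simp
    then show "cmod (kernel z w * f w) \<le> B * cmod (of_real (cmod (snd w) powr crit_exponent) * f w)" by (simp add: norm_mult mult.assoc)
  qed
qed

text \<open>The Taylor series of h in \<open>z1\<close> is summed in blocks of m consecutive powers.
  In block j the residue r contributes \<open>uu w ^ j\<close>, a factor linear in j and a quantity
  independent of j, so summation over j under the integral gives the closed form of the
  kernel.\<close>

lemma reproducing:
  assumes h: "holomorphic2_on h Om" and int: "integrable MM (\<lambda>z. cmod (h z) powr p)" and z: "z \<in> Om"
  shows "(\<integral>w. kernel z w * h w \<partial>MM) = h z"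
proof -
  let ?s = "\<lambda>w. fst z * cnj (fst w)" and ?t = "\<lambda>w. snd z * cnj (snd w)"
  define uu where "uu w = ?s w ^ m / ?t w ^ n" for w
  define q where "q = complex_of_real (pi\<^sup>2 * real m)"
  have q: "q \<noteq> 0" using m by (simp add: q_def)
  define T where "T r w = ((of_int (norm_offset r) + (of_nat m - of_int (norm_offset r)) * ?t w) / (1 - ?t w)\<^sup>2)" for r and w :: "complex \<times> complex"
  define L where "L a w = (of_nat a + 1) * ?s w ^ a * ?t w powi min_exponent a * T a w / q * h w" for a w
  define x where "x = cmod (fst z ^ m / snd z ^ n)"
  have x: "0 \<le> x" "x < 1" using stu(6)[OF z z] by (auto simp: x_def)
  have z2: "snd z \<noteq> 0" "cmod (snd z) < 1" using z by (cases z; auto simp: Om_iff)+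
  have int_L: "(\<integral>w. L a w \<partial>MM) = slice_taylor h a (snd z) * fst z ^ a" and iL: "integrable MM (L a)" for a
    using reproducing_slice[OF h int z, of a] by (simp_all add: L_def[abs_def] T_def q_def)
  \<comment> \<open>Periodicity of thresholds and norm offsets, with a = j m + r.\<close>
  have shift: "L (j * m + r) w = (of_nat m * of_nat j + (of_nat r + 1)) * uu w ^ j * (?s w ^ r * ?t w powi min_exponent r * T r w / q * h w)"
    if w: "w \<in> Om" for j r w
  proof -
    have t0: "?t w \<noteq> 0" using stu(1)[OF z w] .
    have "?s w ^ (j * m + r) * ?t w powi min_exponent (j * m + r) = ?s w ^ r * ?t w powi min_exponent r * uu w ^ j"
    proof -
      have "?t w powi min_exponent (j * m + r) = ?t w powi min_exponent r / ?t w powi (int n * int j)"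
        unfolding min_exponent_shift using t0 by (rule power_int_diff[OF disjI1])
      also have "?t w powi (int n * int j) = (?t w ^ n) ^ j" by (metis of_nat_mult power_int_of_nat power_mult)
      finally show ?thesis by (simp add: uu_def power_add power_divide power_mult[symmetric] mult.commute)
    qed
    moreover have "T (j * m + r) w = T r w" by (simp add: T_def norm_offset_shift)
    moreover have "of_nat (j * m + r) + 1 = (of_nat m * of_nat j + (of_nat r + 1) :: complex)" by simp
    ultimately show ?thesis unfolding L_def by (simp only: mult_ac times_divide_eq_left times_divide_eq_right)
  qed
  define f where "f j w = (\<Sum>r<m. L (j * m + r) w)" for j w
  define G where "G w = (\<Sum>r<m. cmod (T r w)) * cmod (of_real (cmod (snd w) powr crit_exponent) * h w)" for w
  define TB where "TB = (\<Sum>r<m. (cmod (of_int (norm_offset r)) + cmod (of_nat m - of_int (norm_offset r))) / (1 - cmod (snd z))\<^sup>2)"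
  define D where "D j = (real m * real j + real m) * x ^ j * (cmod (snd z) powr crit_exponent / cmod q)" for j
  define G' where "G' w = TB * cmod (of_real (cmod (snd w) powr crit_exponent) * h w)" for w
  have TBb: "(\<Sum>r<m. cmod (T r w)) \<le> TB" if w: "w \<in> Om" for w
    unfolding TB_def T_def
  proof (rule sum_mono)
    fix r
    have "cmod (of_int (norm_offset r) + (of_nat m - of_int (norm_offset r)) * ?t w) \<le> cmod (of_int (norm_offset r)) + cmod (of_nat m - of_int (norm_offset r)) * cmod (?t w)"
      by (rule order_trans[OF norm_triangle_ineq]) (simp add: norm_mult)
    also have "\<dots> \<le> cmod (of_int (norm_offset r)) + cmod (of_nat m - of_int (norm_offset r))" using stu(3)[OF z w] by (intro add_left_mono mult_left_le) auto
    finally have 1: "cmod (of_int (norm_offset r) + (of_nat m - of_int (norm_offset r)) * ?t w) \<le> cmod (of_int (norm_offset r)) + cmod (of_nat m - of_int (norm_offset r))" .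
    have "1 - cmod (snd z) \<le> cmod (1 - ?t w)" using stu(2)[OF z w] norm_triangle_ineq2[of 1 "?t w"] by simp
    then have "(1 - cmod (snd z))\<^sup>2 \<le> (cmod (1 - ?t w))\<^sup>2" using z2 by (intro power_mono) auto
    then show "cmod ((of_int (norm_offset r) + (of_nat m - of_int (norm_offset r)) * ?t w) / (1 - ?t w)\<^sup>2) \<le> (cmod (of_int (norm_offset r)) + cmod (of_nat m - of_int (norm_offset r))) / (1 - cmod (snd z))\<^sup>2"
      unfolding norm_divide norm_power using 1 z2 by (intro frac_le) auto
  qed
  have iG: "integrable MM G'" unfolding G'_def
    by (intro integrable_mult_right integrable_norm integrable_mult_kap[OF measurable_MM_hol[OF h] _ int p, of _ 1]) auto
  have fb: "cmod (f j w) \<le> D j * G' w" if "w \<in> space MM" for j w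
  proof -
    have w: "w \<in> Om" using that by simp
    note S = stu[OF z w, folded uu_def]
    have "cmod (f j w) \<le> (\<Sum>r<m. cmod (L (j * m + r) w))" unfolding f_def by (rule norm_sum)
    also have "\<dots> \<le> (\<Sum>r<m. (real m * real j + real m) * x ^ j * ((cmod (snd z) powr crit_exponent * cmod (snd w) powr crit_exponent) * cmod (T r w) / cmod q * cmod (h w)))"
    proof (rule sum_mono)
      fix r assume r: "r \<in> {..<m}"
      have "of_nat m * of_nat j + (of_nat r + 1) = (of_nat (m * j + (r + 1)) :: complex)" by simp
      then have "cmod (of_nat m * of_nat j + (of_nat r + 1)) = real (m * j + (r + 1))" by (metis norm_of_nat)
      also have "\<dots> \<le> real (m * j + m)" using r by (intro of_nat_mono) simp
      finally have 1: "cmod (of_nat m * of_nat j + (of_nat r + 1)) \<le> real m * real j + real m" by simp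
      have 2: "cmod (uu w) ^ j \<le> x ^ j" using S(5) by (intro power_mono) (auto simp: x_def)
      have 3: "cmod (?s w ^ r * ?t w powi min_exponent r) \<le> cmod (snd z) powr crit_exponent * cmod (snd w) powr crit_exponent"
        using monomial_bound[OF S(4,1), of r] S(3,8) by simp
      have "cmod (L (j * m + r) w) = cmod (of_nat m * of_nat j + (of_nat r + 1)) * cmod (uu w) ^ j * (cmod (?s w ^ r * ?t w powi min_exponent r) * cmod (T r w) / cmod q * cmod (h w))"
        unfolding shift[OF w] by (simp only: norm_mult norm_divide norm_power)
      also have "\<dots> \<le> (real m * real j + real m) * x ^ j * ((cmod (snd z) powr crit_exponent * cmod (snd w) powr crit_exponent) * cmod (T r w) / cmod q * cmod (h w))"
        using x by (intro mult_mono mult_right_mono divide_right_mono 1 2 3) auto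
      finally show "cmod (L (j * m + r) w) \<le> \<dots>" .
    qed
    also have "\<dots> = D j * G w" unfolding D_def G_def 
      by (simp add: norm_mult sum_distrib_left sum_distrib_right sum_divide_distrib mult_ac)
    also have "\<dots> \<le> D j * G' w" unfolding G_def G'_def
      by (intro mult_left_mono mult_right_mono TBb w) (use x in \<open>auto simp: D_def\<close>)
    finally show ?thesis .
  qed
  have fm: "f j \<in> borel_measurable MM" for j unfolding f_def
    by (intro borel_measurable_sum borel_measurable_integrable iL)
  have sD: "summable D" unfolding D_def by (intro summable_mult2 summable_arith_geometric x)
  have sums1: "(\<lambda>j. \<integral>w. f j w \<partial>MM) sums (\<integral>w. (\<Sum>j. f j w) \<partial>MM)"
    by (rule sums_integral_dominated[OF fm iG sD fb])
  have sumf: "(\<Sum>j. f j w) = kernel z w * h w" if w: "w \<in> Om" for w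
  proof -
    note S = stu[OF z w, folded uu_def]
    have "(\<lambda>j. \<Sum>r<m. (?s w ^ r * ?t w powi min_exponent r * T r w / q * h w) * ((of_nat m * of_nat j + (of_nat r + 1)) * uu w ^ j)) sums
      (\<Sum>r<m. (?s w ^ r * ?t w powi min_exponent r * T r w / q * h w) * ((of_nat r + 1 + (of_nat m - (of_nat r + 1)) * uu w) / (1 - uu w)\<^sup>2))"
      by (intro sums_sum sums_mult arith_geometric_sums S(7))
    also have "(\<lambda>j. \<Sum>r<m. (?s w ^ r * ?t w powi min_exponent r * T r w / q * h w) * ((of_nat m * of_nat j + (of_nat r + 1)) * uu w ^ j)) = (\<lambda>j. f j w)"
      unfolding f_def shift[OF w] by (simp only: mult_ac)
    also have "(\<Sum>r<m. (?s w ^ r * ?t w powi min_exponent r * T r w / q * h w) * ((of_nat r + 1 + (of_nat m - (of_nat r + 1)) * uu w) / (1 - uu w)\<^sup>2)) = kernel z w * h w"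
      unfolding kernel_def Let_def sum_divide_distrib sum_distrib_right uu_def T_def q_def
      by (intro sum.cong[OF refl]) (simp add: diff_diff_eq mult_ac)
    finally show ?thesis by (simp add: sums_iff)
  qed
  \<comment> \<open>Grouping the convergent Taylor series into blocks of length m does not change
    its sum.\<close>
  have "(\<lambda>j. \<Sum>a\<in>{j * m..<j * m + m}. slice_taylor h a (snd z) * fst z ^ a) sums h z"
    using sums_group[OF slice_power_series[OF h, of "fst z" "snd z"] m] z by simp
  moreover have "(\<integral>w. f j w \<partial>MM) = (\<Sum>a\<in>{j * m..<j * m + m}. slice_taylor h a (snd z) * fst z ^ a)" for j
  proof -
    have "(\<integral>w. f j w \<partial>MM) = (\<Sum>r<m. slice_taylor h (j * m + r) (snd z) * fst z ^ (j * m + r))"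
      unfolding f_def using iL by (simp add: int_L)
    also have "\<dots> = (\<Sum>a\<in>{j * m..<j * m + m}. slice_taylor h a (snd z) * fst z ^ a)"
      by (subst sum.atLeastLessThan_shift_0) (simp add: lessThan_atLeast0)
    finally show ?thesis .
  qed
  ultimately have "(\<lambda>j. \<integral>w. f j w \<partial>MM) sums h z" by simp
  from sums_unique2[OF sums1 this] have "(\<integral>w. (\<Sum>j. f j w) \<partial>MM) = h z" .
  also have "(\<integral>w. (\<Sum>j. f j w) \<partial>MM) = (\<integral>w. kernel z w * h w \<partial>MM)"
    by (rule Bochner_Integration.integral_cong[OF refl]) (simp add: sumf)
  finally show ?thesis .
qed

text \<open>Schur's test with a weight \<psi> whose power 1 / (q - 1) is again of the form
  \<open>schur_weight\<close>. Both have to meet the conditions of \<open>majorant_integral\<close>: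
  d = -\<kappa> for the power leads to the critical inequality at exponent 2, d = -\<kappa> (q - 1)
  for \<psi> to the one assumed at exponent q.\<close>

lemma kernel_Lq:
  assumes q: "2 \<le> q" "q * crit_exponent + 2 * gam > -2"
  shows "\<exists>C>0. \<forall>f\<in>borel_measurable MM. (\<forall>w\<in>Om. 0 \<le> f w) \<longrightarrow>
    (\<integral>\<^sup>+z. ennreal ((\<integral>w. cmod (kernel z w) * f w \<partial>MM) powr q) \<partial>MM) \<le> ennreal C * (\<integral>\<^sup>+w. ennreal (f w powr q) \<partial>MM)"
proof -
  \<comment> \<open>The boundary exponent 1/2 of \<psi> divided by q - 1; since q \<ge> 2 it stays
    in (0, 1).\<close>
  define c where "c = 1 / (2 * (q - 1))"
  define \<psi> where "\<psi> = schur_weight (1/2) (- crit_exponent * (q - 1))"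
  have c: "0 < c" "c < 1" using q by (auto simp: c_def)
  have k2: "2 * crit_exponent + 2 * gam > -2" using q crit_exponent_le_0 mult_right_mono_neg[of 2 q crit_exponent] by linarith
  have \<psi>1: "\<psi> w powr (1 / (q - 1)) = schur_weight c (- crit_exponent) w" for w
    using q by (simp add: \<psi>_def schur_weight_def powr_mult powr_powr c_def)
  obtain C1 where C1: "C1 > 0" "\<And>z. z \<in> Om \<Longrightarrow> (\<integral>\<^sup>+w. ennreal (majorant z w * schur_weight c (- crit_exponent) w) \<partial>MM) \<le> ennreal (C1 * schur_weight c (- crit_exponent) z)"
    using majorant_integral[OF c, of "- crit_exponent"] k2 by auto
  have "- (- crit_exponent * (q - 1)) \<le> crit_exponent" using q crit_exponent_le_0 mult_left_mono_neg[of 1 "q - 1" crit_exponent] by auto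
  moreover have "crit_exponent - (- crit_exponent * (q - 1)) + 2 * gam > -2" using q(2) by (simp add: algebra_simps)
  ultimately obtain C2 where C2: "C2 > 0" "\<And>z. z \<in> Om \<Longrightarrow> (\<integral>\<^sup>+w. ennreal (majorant z w * \<psi> w) \<partial>MM) \<le> ennreal (C2 * \<psi> z)"
    using majorant_integral[of "1/2" "- crit_exponent * (q - 1)"] unfolding \<psi>_def by auto
  have bnd: "(\<integral>\<^sup>+w. ennreal (cmod (kernel z w) * schur_weight c' d w) \<partial>MM) \<le> ennreal (kernel_const * C * schur_weight c' d z)"
    if z: "z \<in> Om" and le: "(\<integral>\<^sup>+w. ennreal (majorant z w * schur_weight c' d w) \<partial>MM) \<le> ennreal (C * schur_weight c' d z)" for z c' d C
  proof -
    have "(\<integral>\<^sup>+w. ennreal (cmod (kernel z w) * schur_weight c' d w) \<partial>MM) \<le> (\<integral>\<^sup>+w. ennreal kernel_const * ennreal (majorant z w * schur_weight c' d w) \<partial>MM)"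
    proof (rule nn_integral_mono)
      fix w assume "w \<in> space MM"
      then have w: "w \<in> Om" by simp
      have "cmod (kernel z w) * schur_weight c' d w \<le> kernel_const * majorant z w * schur_weight c' d w"
        using kernel_bound[OF z w] schur_weight_pos[OF w, of c' d] by (intro mult_right_mono) auto
      then have "ennreal (cmod (kernel z w) * schur_weight c' d w) \<le> ennreal (kernel_const * (majorant z w * schur_weight c' d w))"
        by (intro ennreal_leI) (simp add: mult.assoc)
      also have "\<dots> = ennreal kernel_const * ennreal (majorant z w * schur_weight c' d w)" using kernel_const_pos by (simp add: ennreal_mult')
      finally show "ennreal (cmod (kernel z w) * schur_weight c' d w) \<le> ennreal kernel_const * ennreal (majorant z w * schur_weight c' d w)" .
    qed
    also have "\<dots> = ennreal kernel_const * (\<integral>\<^sup>+w. ennreal (majorant z w * schur_weight c' d w) \<partial>MM)"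
      by (rule nn_integral_cmult) (use majorant_measurable in measurable)
    also have "\<dots> \<le> ennreal kernel_const * ennreal (C * schur_weight c' d z)" by (intro mult_left_mono le) auto
    also have "\<dots> = ennreal (kernel_const * C * schur_weight c' d z)" using kernel_const_pos by (simp add: ennreal_mult'[symmetric] mult.assoc)
    finally show ?thesis .
  qed
  \<comment> \<open>By Hermitian symmetry both integrals of the test become integrals over the
    second variable.\<close>
  have sym: "cmod (kernel z w) = cmod (kernel w z)" for z w by (subst kernel_cnj) (rule complex_mod_cnj)
  show ?thesis
  proof (intro exI conjI ballI impI)
    show "(kernel_const * C1) powr (q - 1) * (kernel_const * C2) > 0" using kernel_const_pos C1 C2 by simp
    fix f :: "complex \<times> complex \<Rightarrow> real" assume f: "f \<in> borel_measurable MM" "\<forall>w\<in>Om. 0 \<le> f w"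
    show "(\<integral>\<^sup>+z. ennreal ((\<integral>w. cmod (kernel z w) * f w \<partial>MM) powr q) \<partial>MM) \<le> ennreal ((kernel_const * C1) powr (q - 1) * (kernel_const * C2)) * (\<integral>\<^sup>+w. ennreal (f w powr q) \<partial>MM)"
    proof (rule schur_test[where \<psi>=\<psi>])
      show "sigma_finite_measure MM" by unfold_locales
      show "(\<lambda>(z, w). cmod (kernel z w)) \<in> borel_measurable (MM \<Otimes>\<^sub>M MM)"
        using measurable_compose[OF kernel_measurable2 borel_measurable_norm] by (simp add: case_prod_beta')
      show "\<psi> \<in> borel_measurable MM" by (simp add: \<psi>_def)
      show "0 < \<psi> x" if "x \<in> space MM" for x using that schur_weight_pos by (simp add: \<psi>_def)
      show "(\<integral>\<^sup>+y. ennreal (cmod (kernel x y) * \<psi> y powr (1 / (q - 1))) \<partial>MM) \<le> ennreal (kernel_const * C1 * \<psi> x powr (1 / (q - 1)))" if "x \<in> space MM" for x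
        unfolding \<psi>1 using that by (intro bnd C1) auto
      show "(\<integral>\<^sup>+x. ennreal (cmod (kernel x y) * \<psi> x) \<partial>MM) \<le> ennreal (kernel_const * C2 * \<psi> y)" if "y \<in> space MM" for y
        unfolding sym[of _ y] \<psi>_def using that by (intro bnd C2[unfolded \<psi>_def]) auto
    qed (use f q kernel_const_pos C1 C2 in auto)
  qed
qed

end

subsection \<open>The orthogonal projection\<close>

context hartogs_domain
begin

lemma indicator_scaleR_lborel:
  fixes F :: "complex \<times> complex \<Rightarrow> 'a::{banach, second_countable_topology}"
  assumes "F \<in> borel_measurable MM"
  shows "(\<lambda>x. indicator Om x *\<^sub>R F x) \<in> borel_measurable lborel"
  using assms by (subst (asm) borel_measurable_restrict_space_iff) auto

lemma lebesgue_on_Om: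
  fixes F :: "complex \<times> complex \<Rightarrow> 'a::{banach, second_countable_topology}"
  assumes F: "F \<in> borel_measurable MM"
  shows "F \<in> borel_measurable (lebesgue_on Om)"
    and "integrable (lebesgue_on Om) F \<longleftrightarrow> integrable MM F"
    and "(\<integral>x. F x \<partial>lebesgue_on Om) = (\<integral>x. F x \<partial>MM)"
proof -
  note m = indicator_scaleR_lborel[OF F]
  show "F \<in> borel_measurable (lebesgue_on Om)"
    by (subst borel_measurable_restrict_space_iff) (auto intro: measurable_completion m)
  show "integrable (lebesgue_on Om) F \<longleftrightarrow> integrable MM F"
    by (simp add: integrable_restrict_space integrable_completion[OF m])
  show "(\<integral>x. F x \<partial>lebesgue_on Om) = (\<integral>x. F x \<partial>MM)"
    by (simp add: integral_restrict_space integral_completion[OF m])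
qed

lemma borel_version:
  fixes f :: "complex \<times> complex \<Rightarrow> complex"
  assumes f: "f \<in> borel_measurable (lebesgue_on Om)"
  shows "\<exists>f'\<in>borel_measurable MM. AE x in lebesgue_on Om. f x = f' x"
proof -
  have m: "(\<lambda>x. indicator Om x *\<^sub>R f x) \<in> borel_measurable lebesgue"
    using f by (subst (asm) borel_measurable_restrict_space_iff) auto
  have "(\<lambda>x. Re (indicator Om x *\<^sub>R f x)) \<in> borel_measurable lebesgue" "(\<lambda>x. Im (indicator Om x *\<^sub>R f x)) \<in> borel_measurable lebesgue"
    by (rule measurable_compose[OF m], intro borel_measurable_continuous_onI continuous_intros)+
  from completion_ex_borel_measurable_real[OF this(1)] completion_ex_borel_measurable_real[OF this(2)]
  obtain g1 g2 where g: "g1 \<in> borel_measurable lborel" "g2 \<in> borel_measurable lborel"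
    "AE x in lborel. Re (indicator Om x *\<^sub>R f x) = g1 x" "AE x in lborel. Im (indicator Om x *\<^sub>R f x) = g2 x" by blast
  define f' where "f' x = complex_of_real (g1 x) + \<i> * complex_of_real (g2 x)" for x
  have "f' \<in> borel_measurable borel" unfolding f'_def using g(1,2) by simp
  then have mf: "f' \<in> borel_measurable MM" by (rule measurable_MM_I)
  have "AE x in lborel. x \<in> Om \<longrightarrow> f x = f' x"
    using g(3,4) by eventually_elim (auto simp: f'_def complex_eq_iff)
  then have "AE x in lebesgue. x \<in> Om \<longrightarrow> f x = f' x" by (rule AE_completion)
  then have "AE x in lebesgue_on Om. f x = f' x" by (subst AE_restrict_space_iff) auto
  then show ?thesis using mf by blast
qed

definition borel_Lp :: "real \<Rightarrow> (complex \<times> complex \<Rightarrow> complex) \<Rightarrow> bool" where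
  "borel_Lp q f \<longleftrightarrow> f \<in> borel_measurable MM \<and> integrable MM (\<lambda>z. cmod (f z) powr q)"

lemma borel_Lp_measurable: "borel_Lp q f \<Longrightarrow> f \<in> borel_measurable MM" by (simp add: borel_Lp_def)

lemma borel_Lp_powr_measurable: 
  assumes [measurable]: "f \<in> borel_measurable MM" 
  shows "(\<lambda>z. cmod (f z) powr q) \<in> borel_measurable MM"
  by measurable

lemma borel_Lp_integrable_2: "borel_Lp 2 f \<Longrightarrow> integrable MM (\<lambda>z. (cmod (f z))\<^sup>2)"
  by (simp add: borel_Lp_def)

lemma borel_Lp_imp_Lp: 
  assumes "borel_Lp q f" shows "f \<in> Lp Om q"
proof -
  have m: "f \<in> borel_measurable MM" and i: "integrable MM (\<lambda>z. cmod (f z) powr q)" using assms by (auto simp: borel_Lp_def)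
  have "integrable (lebesgue_on Om) (\<lambda>z. cmod (f z) powr q)" by (rule lebesgue_on_Om(2)[OF borel_Lp_powr_measurable[OF m], THEN iffD2, OF i])
  then show ?thesis using lebesgue_on_Om(1)[OF m] by (simp add: Lp_def)
qed

lemma borel_Lp_Lp_norm: 
  assumes "borel_Lp q f" shows "Lp_norm Om q f = (\<integral>z. cmod (f z) powr q \<partial>MM) powr (1 / q)"
  unfolding Lp_norm_def by (subst lebesgue_on_Om(3)[OF borel_Lp_powr_measurable[OF borel_Lp_measurable[OF assms]]]) (rule refl)

lemma Lp_borel_version:
  assumes "f \<in> Lp Om q"
  shows "\<exists>f'. borel_Lp q f' \<and> (AE x in lebesgue_on Om. f x = f' x) \<and> Lp_norm Om q f = Lp_norm Om q f'"
proof -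
  have f: "f \<in> borel_measurable (lebesgue_on Om)" "integrable (lebesgue_on Om) (\<lambda>z. cmod (f z) powr q)"
    using assms by (auto simp: Lp_def)
  obtain f' where f': "f' \<in> borel_measurable MM" and ae: "AE x in lebesgue_on Om. f x = f' x"
    using borel_version[OF f(1)] by blast
  note m = lebesgue_on_Om[OF borel_Lp_powr_measurable[OF f', of q]]
  have ae': "AE x in lebesgue_on Om. cmod (f x) powr q = cmod (f' x) powr q" using ae by eventually_elim simp
  have "integrable (lebesgue_on Om) (\<lambda>z. cmod (f' z) powr q)"
    by (rule integrable_cong_AE_imp[OF f(2) m(1) ae'])
  then have "borel_Lp q f'" using m(2)[THEN iffD1] f' unfolding borel_Lp_def by blast
  moreover have "Lp_norm Om q f = Lp_norm Om q f'"
    unfolding Lp_norm_def by (rule arg_cong[where f="\<lambda>x. x powr (1 / q)"], rule integral_cong_AE[OF borel_measurable_integrable[OF f(2)] m(1) ae'])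
  ultimately show ?thesis using ae by blast
qed

text \<open>Holomorphic functions are continuous, hence Borel, so Bergman spaces need no passage to
  a representative.\<close>

lemma bergman_iff: "f \<in> bergman_space Om q \<longleftrightarrow> holomorphic2_on f Om \<and> borel_Lp q f"
proof
  assume f: "f \<in> bergman_space Om q"
  then have h: "holomorphic2_on f Om" by (simp add: bergman_space_def)
  have m: "f \<in> borel_measurable MM" by (rule measurable_MM_hol[OF h])
  show "holomorphic2_on f Om \<and> borel_Lp q f"
    using f h m lebesgue_on_Om(2)[OF borel_Lp_powr_measurable[OF m, of q], THEN iffD1] unfolding bergman_space_def Lp_def borel_Lp_def by blast
next
  assume "holomorphic2_on f Om \<and> borel_Lp q f"
  then show "f \<in> bergman_space Om q" using borel_Lp_imp_Lp by (simp add: bergman_space_def)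
qed

lemma borel_Lp_mono: "borel_Lp q f \<Longrightarrow> 0 \<le> r \<Longrightarrow> r \<le> q \<Longrightarrow> borel_Lp r f"
  unfolding borel_Lp_def using MM.integrable_powr_mono by blast

lemma borel_Lp_diff:
  assumes f: "borel_Lp q f" and g: "borel_Lp q g" and q: "0 < q"
  shows "borel_Lp q (\<lambda>z. f z - g z)"
proof -
  have [measurable]: "f \<in> borel_measurable MM" "g \<in> borel_measurable MM" using f g by (auto simp: borel_Lp_def)
  have "integrable MM (\<lambda>z. cmod (f z - g z) powr q)"
  proof (rule Bochner_Integration.integrable_bound)
    show "integrable MM (\<lambda>z. 2 powr q * (cmod (f z) powr q + cmod (g z) powr q))" using f g by (auto simp: borel_Lp_def)
    have "cmod (f z - g z) powr q \<le> 2 powr q * (cmod (f z) powr q + cmod (g z) powr q)" for z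
    proof -
      define M where "M = max (cmod (f z)) (cmod (g z))"
      have "cmod (f z - g z) \<le> 2 * M" using norm_triangle_ineq4[of "f z" "g z"] by (simp add: M_def)
      then have "cmod (f z - g z) powr q \<le> (2 * M) powr q" using q by (intro powr_mono2) auto
      also have "\<dots> = 2 powr q * M powr q" by (rule powr_mult)
      also have "M powr q \<le> cmod (f z) powr q + cmod (g z) powr q" by (simp add: M_def max_def)
      finally show ?thesis by simp
    qed
    then show "AE z in MM. norm (cmod (f z - g z) powr q) \<le> norm (2 powr q * (cmod (f z) powr q + cmod (g z) powr q))"
      by (intro AE_I2) simp
  qed measurable
  then show ?thesis by (simp add: borel_Lp_def)
qed

lemma borel_Lp_cnj: "borel_Lp q f \<Longrightarrow> borel_Lp q (\<lambda>z. cnj (f z))"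
  unfolding borel_Lp_def by (auto intro: measurable_compose[OF _ borel_cnj])

lemma borel_Lp_mult: "borel_Lp 2 f \<Longrightarrow> borel_Lp 2 g \<Longrightarrow> integrable MM (\<lambda>z. f z * g z)"
  by (intro integrable_mult_of_L2 borel_Lp_integrable_2 borel_Lp_measurable)

lemma borel_Lp_bounded:
  assumes "f \<in> borel_measurable MM" "\<And>z. z \<in> Om \<Longrightarrow> cmod (f z) \<le> B" "0 \<le> q"
  shows "borel_Lp q f"
  unfolding borel_Lp_def
proof
  show "integrable MM (\<lambda>z. cmod (f z) powr q)"
    by (rule MM.integrable_const_bound[of _ "B powr q"]) (use assms in \<open>auto intro!: powr_mono2 AE_I2\<close>)
qed (rule assms)

text \<open>The value 0 outside the domain matches the normalisation that makes the projection
  unique as a total function.\<close>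

definition projection :: "(complex \<times> complex \<Rightarrow> complex) \<Rightarrow> complex \<times> complex \<Rightarrow> complex" where
  "projection f z = (if z \<in> Om then \<integral>w. kernel z w * f w \<partial>MM else 0)"

lemma kernel_mult_integrable: "borel_Lp q f \<Longrightarrow> 2 \<le> q \<Longrightarrow> z \<in> Om \<Longrightarrow> integrable MM (\<lambda>w. kernel z w * f w)"
  by (rule integrable_Ker_mult) (auto simp: borel_Lp_def)

lemma projection_hol:
  assumes "borel_Lp q f" "2 \<le> q" shows "holomorphic2_on (projection f) Om"
  by (rule holomorphic2_on_cong[OF proj_holomorphic]) (use assms in \<open>auto simp: borel_Lp_def projection_def\<close>)

lemma kernel_abs_measurable:
  assumes "f \<in> borel_measurable MM"
  shows "(\<lambda>z. \<integral>w. cmod (kernel z w) * cmod (f w) \<partial>MM) \<in> borel_measurable MM"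
proof (rule MM.borel_measurable_lebesgue_integral)
  have [measurable]: "(\<lambda>p. kernel (fst p) (snd p)) \<in> borel_measurable (MM \<Otimes>\<^sub>M MM)" using kernel_measurable2 by (simp add: case_prod_beta')
  note [measurable] = assms
  show "(\<lambda>(z, w). cmod (kernel z w) * cmod (f w)) \<in> borel_measurable (MM \<Otimes>\<^sub>M MM)" unfolding case_prod_beta' by measurable
qed

lemma kernel_abs_Lq:
  assumes q: "2 \<le> q" "q * crit_exponent + 2 * gam > -2"
  shows "\<exists>C>0. \<forall>f. borel_Lp q f \<longrightarrow> integrable MM (\<lambda>z. (\<integral>w. cmod (kernel z w) * cmod (f w) \<partial>MM) powr q) \<and>
    (\<integral>z. (\<integral>w. cmod (kernel z w) * cmod (f w) \<partial>MM) powr q \<partial>MM) \<le> C * (\<integral>z. cmod (f z) powr q \<partial>MM)"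
proof -
  obtain C where C: "C > 0" and b: "\<And>f :: complex \<times> complex \<Rightarrow> real. f \<in> borel_measurable MM \<Longrightarrow> (\<forall>w\<in>Om. 0 \<le> f w) \<Longrightarrow>
    (\<integral>\<^sup>+z. ennreal ((\<integral>w. cmod (kernel z w) * f w \<partial>MM) powr q) \<partial>MM) \<le> ennreal C * (\<integral>\<^sup>+w. ennreal (f w powr q) \<partial>MM)"
    using kernel_Lq[OF q] by blast
  show ?thesis
  proof (intro exI conjI allI impI, rule C)
    fix f assume f: "borel_Lp q f"
    then have m: "f \<in> borel_measurable MM" by (simp add: borel_Lp_def)
    have "(\<integral>\<^sup>+z. ennreal ((\<integral>w. cmod (kernel z w) * cmod (f w) \<partial>MM) powr q) \<partial>MM) \<le> ennreal C * (\<integral>\<^sup>+w. ennreal (cmod (f w) powr q) \<partial>MM)"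
      by (rule b) (use m in auto)
    also have "(\<integral>\<^sup>+w. ennreal (cmod (f w) powr q) \<partial>MM) = ennreal (\<integral>w. cmod (f w) powr q \<partial>MM)"
      using f by (intro nn_integral_eq_integral) (auto simp: borel_Lp_def)
    also have "ennreal C * \<dots> = ennreal (C * (\<integral>w. cmod (f w) powr q \<partial>MM))" using C by (simp add: ennreal_mult')
    finally have le: "(\<integral>\<^sup>+z. ennreal ((\<integral>w. cmod (kernel z w) * cmod (f w) \<partial>MM) powr q) \<partial>MM) \<le> ennreal (C * (\<integral>w. cmod (f w) powr q \<partial>MM))" .
    have mm: "(\<lambda>z. (\<integral>w. cmod (kernel z w) * cmod (f w) \<partial>MM) powr q) \<in> borel_measurable MM"
    proof -
      note [measurable] = kernel_abs_measurable[OF m]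
      show ?thesis by measurable
    qed
    have C0: "0 \<le> C * (\<integral>w. cmod (f w) powr q \<partial>MM)" using C by (intro mult_nonneg_nonneg Bochner_Integration.integral_nonneg) auto
    show "integrable MM (\<lambda>z. (\<integral>w. cmod (kernel z w) * cmod (f w) \<partial>MM) powr q)"
      by (rule integrable_of_nn_bound(1)[OF mm _ le C0]) simp
    show "(\<integral>z. (\<integral>w. cmod (kernel z w) * cmod (f w) \<partial>MM) powr q \<partial>MM) \<le> C * (\<integral>z. cmod (f z) powr q \<partial>MM)"
      by (rule integrable_of_nn_bound(2)[OF mm _ le C0]) simp
  qed
qed

lemma projection_le: "z \<in> Om \<Longrightarrow> cmod (projection f z) \<le> (\<integral>w. cmod (kernel z w) * cmod (f w) \<partial>MM)"
  unfolding projection_def using integral_norm_bound[of MM "\<lambda>w. kernel z w * f w"] by (simp add: norm_mult)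

text \<open>One estimate for two uses: the projection and the operator with the absolute kernel are
  both bounded pointwise by this positive integral.\<close>

lemma borel_Lp_majorized:
  assumes q: "2 \<le> q" "q * crit_exponent + 2 * gam > -2"
  shows "\<exists>C>0. \<forall>f F. borel_Lp q f \<longrightarrow> F \<in> borel_measurable MM \<longrightarrow> (\<forall>z\<in>Om. cmod (F z) \<le> (\<integral>w. cmod (kernel z w) * cmod (f w) \<partial>MM)) \<longrightarrow>
    borel_Lp q F \<and> (\<integral>z. cmod (F z) powr q \<partial>MM) \<le> C * (\<integral>z. cmod (f z) powr q \<partial>MM)"
proof -
  obtain C where C: "C > 0" and b: "\<And>f. borel_Lp q f \<Longrightarrow> integrable MM (\<lambda>z. (\<integral>w. cmod (kernel z w) * cmod (f w) \<partial>MM) powr q)"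
    "\<And>f. borel_Lp q f \<Longrightarrow> (\<integral>z. (\<integral>w. cmod (kernel z w) * cmod (f w) \<partial>MM) powr q \<partial>MM) \<le> C * (\<integral>z. cmod (f z) powr q \<partial>MM)"
    using kernel_abs_Lq[OF q] by blast
  show ?thesis
  proof (intro exI conjI allI impI, rule C)
    fix f F assume f: "borel_Lp q f" and F: "F \<in> borel_measurable MM" and le: "\<forall>z\<in>Om. cmod (F z) \<le> (\<integral>w. cmod (kernel z w) * cmod (f w) \<partial>MM)"
    have pw: "cmod (F z) powr q \<le> (\<integral>w. cmod (kernel z w) * cmod (f w) \<partial>MM) powr q" if "z \<in> Om" for z
      using le that q by (intro powr_mono2) auto
    have i: "integrable MM (\<lambda>z. cmod (F z) powr q)"
      by (rule Bochner_Integration.integrable_bound[OF b(1)[OF f] borel_Lp_powr_measurable[OF F]]) (use pw in \<open>auto intro!: AE_I2\<close>)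
    then show "borel_Lp q F" using F by (simp add: borel_Lp_def)
    have "(\<integral>z. cmod (F z) powr q \<partial>MM) \<le> (\<integral>z. (\<integral>w. cmod (kernel z w) * cmod (f w) \<partial>MM) powr q \<partial>MM)"
      by (rule integral_mono[OF i b(1)[OF f]]) (use pw in auto)
    then show "(\<integral>z. cmod (F z) powr q \<partial>MM) \<le> C * (\<integral>z. cmod (f z) powr q \<partial>MM)" using b(2)[OF f] by linarith
  qed
qed

lemma crit_exponent_two: "2 * crit_exponent + 2 * gam > -2"
  using crit_exponent_gt crit_exponent_le_0 p mult_right_mono_neg[of 2 p crit_exponent] by linarith

lemma projection_LL:
  assumes f: "borel_Lp q f" and q: "2 \<le> q" "q * crit_exponent + 2 * gam > -2"
  shows "borel_Lp q (projection f)"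
  using borel_Lp_majorized[OF q] f measurable_MM_hol[OF projection_hol[OF f q(1)]] projection_le by blast

text \<open>Membership in \<open>G2\<close> in terms of Borel functions and squared distances, so
  that no root enters the estimates.\<close>

definition in_G2 :: "(complex \<times> complex \<Rightarrow> complex) \<Rightarrow> bool" where
  "in_G2 g \<longleftrightarrow> holomorphic2_on g Om \<and> borel_Lp 2 g \<and> (\<forall>\<epsilon>>0. \<exists>h. holomorphic2_on h Om \<and> borel_Lp p h \<and> (\<integral>z. (cmod (g z - h z))\<^sup>2 \<partial>MM) < \<epsilon>)"

lemma G2_iff: "g \<in> G2 Om p \<longleftrightarrow> in_G2 g"
proof -
  have nrm: "Lp_norm Om 2 (\<lambda>z. g z - h z) = sqrt (\<integral>z. (cmod (g z - h z))\<^sup>2 \<partial>MM)" if "borel_Lp 2 g" "borel_Lp p h" for g h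
    using borel_Lp_Lp_norm[OF borel_Lp_diff[OF that(1) borel_Lp_mono[OF that(2)]]] p
    by (simp add: powr_half_sqrt Bochner_Integration.integral_nonneg)
  show ?thesis
  proof
    assume g: "g \<in> G2 Om p"
    then have g1: "holomorphic2_on g Om" "borel_Lp 2 g" by (auto simp: G2_def bergman_iff)
    have "\<exists>h. holomorphic2_on h Om \<and> borel_Lp p h \<and> (\<integral>z. (cmod (g z - h z))\<^sup>2 \<partial>MM) < \<epsilon>" if "\<epsilon> > 0" for \<epsilon>
    proof -
      have "sqrt \<epsilon> > 0" using that by simp
      then obtain h where h: "h \<in> bergman_space Om p" "Lp_norm Om 2 (\<lambda>z. g z - h z) < sqrt \<epsilon>"
        using g unfolding G2_def by blast
      then show ?thesis using nrm[OF g1(2), of h] by (auto simp: bergman_iff)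
    qed
    then show "in_G2 g" using g1 by (simp add: in_G2_def)
  next
    assume g: "in_G2 g"
    then have g1: "holomorphic2_on g Om" "borel_Lp 2 g" by (auto simp: in_G2_def)
    have "\<exists>h\<in>bergman_space Om p. Lp_norm Om 2 (\<lambda>z. g z - h z) < \<epsilon>" if "\<epsilon> > 0" for \<epsilon>
    proof -
      have "\<epsilon>\<^sup>2 > 0" using that by simp
      then obtain h where h: "holomorphic2_on h Om" "borel_Lp p h" "(\<integral>z. (cmod (g z - h z))\<^sup>2 \<partial>MM) < \<epsilon>\<^sup>2"
        using g unfolding in_G2_def by blast
      have "Lp_norm Om 2 (\<lambda>z. g z - h z) < \<epsilon>"
        unfolding nrm[OF g1(2) h(2)] using real_sqrt_less_mono[OF h(3)] that by simp
      then show ?thesis using h by (auto simp: bergman_iff)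
    qed
    then show "g \<in> G2 Om p" using g1 by (simp add: G2_def bergman_iff)
  qed
qed

lemma in_G2_LL: "in_G2 g \<Longrightarrow> borel_Lp 2 g" by (simp add: in_G2_def)
lemma in_G2_hol: "in_G2 g \<Longrightarrow> holomorphic2_on g Om" by (simp add: in_G2_def)

lemma in_G2_I_bergman: "holomorphic2_on h Om \<Longrightarrow> borel_Lp p h \<Longrightarrow> in_G2 h"
  unfolding in_G2_def using borel_Lp_mono[of p h 2] p by (auto intro!: exI[of _ h])

lemma in_G2_diff:
  assumes f: "in_G2 f" and g: "in_G2 g"
  shows "in_G2 (\<lambda>z. f z - g z)"
  unfolding in_G2_def
proof (intro conjI allI impI)
  show "holomorphic2_on (\<lambda>z. f z - g z) Om" using f g by (auto simp: in_G2_def intro: holomorphic2_on_diff)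
  show "borel_Lp 2 (\<lambda>z. f z - g z)" using f g by (auto simp: in_G2_def intro: borel_Lp_diff)
  fix \<epsilon> :: real assume "\<epsilon> > 0"
  \<comment> \<open>The inequality (a + b)^2 \<le> 2 a^2 + 2 b^2 makes \<epsilon> / 4 the share of
    each approximation.\<close>
  then have e: "\<epsilon> / 4 > 0" by simp
  obtain h where h: "holomorphic2_on h Om" "borel_Lp p h" "(\<integral>z. (cmod (f z - h z))\<^sup>2 \<partial>MM) < \<epsilon> / 4" using f e unfolding in_G2_def by blast
  obtain k where k: "holomorphic2_on k Om" "borel_Lp p k" "(\<integral>z. (cmod (g z - k z))\<^sup>2 \<partial>MM) < \<epsilon> / 4" using g e unfolding in_G2_def by blast
  have l: "borel_Lp 2 h" "borel_Lp 2 k" using h k p borel_Lp_mono by auto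
  have i1: "integrable MM (\<lambda>z. (cmod (f z - h z))\<^sup>2)" and i2: "integrable MM (\<lambda>z. (cmod (g z - k z))\<^sup>2)"
    by (intro borel_Lp_integrable_2 borel_Lp_diff in_G2_LL[OF f] in_G2_LL[OF g] l; simp)+
  have i3: "integrable MM (\<lambda>z. (cmod ((f z - g z) - (h z - k z)))\<^sup>2)"
    by (intro borel_Lp_integrable_2 borel_Lp_diff in_G2_LL[OF f] in_G2_LL[OF g] l; simp)
  have pw: "(cmod ((f z - g z) - (h z - k z)))\<^sup>2 \<le> 2 * (cmod (f z - h z))\<^sup>2 + 2 * (cmod (g z - k z))\<^sup>2" for z
  proof -
    have "(f z - g z) - (h z - k z) = (f z - h z) - (g z - k z)" by simp
    then have "cmod ((f z - g z) - (h z - k z)) \<le> cmod (f z - h z) + cmod (g z - k z)" using norm_triangle_ineq4 by metis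
    then have "(cmod ((f z - g z) - (h z - k z)))\<^sup>2 \<le> (cmod (f z - h z) + cmod (g z - k z))\<^sup>2" by (intro power_mono) auto
    also have "\<dots> \<le> 2 * (cmod (f z - h z))\<^sup>2 + 2 * (cmod (g z - k z))\<^sup>2"
      using sum_squares_bound[of "cmod (f z - h z)" "cmod (g z - k z)"] by (simp add: power2_sum)
    finally show ?thesis .
  qed
  have "(\<integral>z. (cmod ((f z - g z) - (h z - k z)))\<^sup>2 \<partial>MM) \<le> (\<integral>z. 2 * (cmod (f z - h z))\<^sup>2 + 2 * (cmod (g z - k z))\<^sup>2 \<partial>MM)"
    using i1 i2 by (intro integral_mono i3 pw) auto
  also have "\<dots> = 2 * (\<integral>z. (cmod (f z - h z))\<^sup>2 \<partial>MM) + 2 * (\<integral>z. (cmod (g z - k z))\<^sup>2 \<partial>MM)" using i1 i2 by simp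
  also have "\<dots> < \<epsilon>" using h(3) k(3) by simp
  finally show "\<exists>h. holomorphic2_on h Om \<and> borel_Lp p h \<and> (\<integral>z. (cmod (f z - g z - h z))\<^sup>2 \<partial>MM) < \<epsilon>"
    using h k p by (intro exI[of _ "\<lambda>z. h z - k z"]) (auto intro: holomorphic2_on_diff borel_Lp_diff)
qed

lemma projection_diff:
  assumes "borel_Lp 2 f" "borel_Lp 2 g" shows "projection (\<lambda>z. f z - g z) = (\<lambda>z. projection f z - projection g z)"
  using kernel_mult_integrable[OF assms(1)] kernel_mult_integrable[OF assms(2)] by (auto simp: projection_def fun_eq_iff right_diff_distrib)

text \<open>Bounded functions are dense in \<open>L\<^sup>2\<close>, and the projection maps them to \<open>A\<^sup>p\<close>.\<close>

lemma in_G2_PP: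
  assumes f: "borel_Lp 2 f" shows "in_G2 (projection f)"
proof -
  have mf [measurable]: "f \<in> borel_measurable MM" using f by (simp add: borel_Lp_def)
  obtain C where C: "C > 0" and b: "\<And>f F. borel_Lp 2 f \<Longrightarrow> F \<in> borel_measurable MM \<Longrightarrow> (\<forall>z\<in>Om. cmod (F z) \<le> (\<integral>w. cmod (kernel z w) * cmod (f w) \<partial>MM)) \<Longrightarrow>
    borel_Lp 2 F \<and> (\<integral>z. cmod (F z) powr 2 \<partial>MM) \<le> C * (\<integral>z. cmod (f z) powr 2 \<partial>MM)"
    using borel_Lp_majorized[OF order_refl crit_exponent_two] by blast
  have hol: "holomorphic2_on (projection f) Om" by (rule projection_hol[OF f]) simp
  have L: "borel_Lp 2 (projection f)" by (rule projection_LL[OF f]) (use crit_exponent_two in auto)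
  show ?thesis unfolding in_G2_def
  proof (intro conjI allI impI hol L)
    fix \<epsilon> :: real assume e: "\<epsilon> > 0"
    \<comment> \<open>Truncation at height N: bounded, hence in every \<open>L^q\<close> on a domain
      of finite measure, and convergent to f by domination.\<close>
    define fN where "fN N z = (if cmod (f z) \<le> real N then f z else 0)" for N :: nat and z
    have mN [measurable]: "fN N \<in> borel_measurable MM" for N unfolding fN_def by measurable
    have LN: "0 \<le> q \<Longrightarrow> borel_Lp q (fN N)" for q N
      by (rule borel_Lp_bounded[OF mN, of _ "real N"]) (auto simp: fN_def)
    have "(\<lambda>N. \<integral>z. (cmod (f z - fN N z))\<^sup>2 \<partial>MM) \<longlonglongrightarrow> (\<integral>z. 0 \<partial>MM)"
    proof (rule integral_dominated_convergence[where w="\<lambda>z. (cmod (f z))\<^sup>2"])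
      show "AE z in MM. (\<lambda>N. (cmod (f z - fN N z))\<^sup>2) \<longlonglongrightarrow> 0"
      proof (intro AE_I2)
        fix z
        obtain N0 where "cmod (f z) \<le> real N0" using real_arch_simple by blast
        then have "\<forall>\<^sub>F N in sequentially. (cmod (f z - fN N z))\<^sup>2 = 0"
          unfolding eventually_sequentially by (intro exI[of _ N0]) (auto simp: fN_def)
        then show "(\<lambda>N. (cmod (f z - fN N z))\<^sup>2) \<longlonglongrightarrow> 0" by (rule tendsto_eventually)
      qed
      show "AE z in MM. norm ((cmod (f z - fN N z))\<^sup>2) \<le> (cmod (f z))\<^sup>2" for N
        by (intro AE_I2) (simp add: fN_def)
      show "(\<lambda>z. (cmod (f z - fN N z))\<^sup>2) \<in> borel_measurable MM" for N by measurable
    qed (use f in \<open>auto intro: borel_Lp_integrable_2\<close>)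
    then have "(\<lambda>N. \<integral>z. (cmod (f z - fN N z))\<^sup>2 \<partial>MM) \<longlonglongrightarrow> 0" by simp
    moreover have "\<epsilon> / C > 0" using e C by simp
    ultimately have "\<forall>\<^sub>F N in sequentially. (\<integral>z. (cmod (f z - fN N z))\<^sup>2 \<partial>MM) < \<epsilon> / C" by (rule order_tendstoD(2))
    then obtain N where N: "(\<integral>z. (cmod (f z - fN N z))\<^sup>2 \<partial>MM) < \<epsilon> / C" by (auto simp: eventually_sequentially)
    have d: "borel_Lp 2 (\<lambda>z. f z - fN N z)" by (rule borel_Lp_diff[OF f LN]) auto
    have PPd: "projection (\<lambda>z. f z - fN N z) = (\<lambda>z. projection f z - projection (fN N) z)" by (rule projection_diff[OF f LN]) simp
    have "(\<integral>z. cmod (projection (\<lambda>z. f z - fN N z) z) powr 2 \<partial>MM) \<le> C * (\<integral>z. cmod (f z - fN N z) powr 2 \<partial>MM)"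
      using b[OF d measurable_MM_hol[OF projection_hol[OF d]]] projection_le by auto
    then have "(\<integral>z. (cmod (projection f z - projection (fN N) z))\<^sup>2 \<partial>MM) \<le> C * (\<integral>z. (cmod (f z - fN N z))\<^sup>2 \<partial>MM)" by (simp add: PPd)
    also have "\<dots> < \<epsilon>" using N C by (simp add: pos_less_divide_eq mult.commute)
    finally have "(\<integral>z. (cmod (projection f z - projection (fN N) z))\<^sup>2 \<partial>MM) < \<epsilon>" .
    \<comment> \<open>Here the bound at exponent p enters; the distance was controlled by the one at
      exponent 2.\<close>
    moreover have "borel_Lp p (projection (fN N))" by (rule projection_LL[OF LN p crit_exponent_gt]) (use p in simp)
    moreover have "holomorphic2_on (projection (fN N)) Om" by (rule projection_hol[OF LN p]) (use p in simp)
    ultimately show "\<exists>h. holomorphic2_on h Om \<and> borel_Lp p h \<and> (\<integral>z. (cmod (projection f z - h z))\<^sup>2 \<partial>MM) < \<epsilon>" by blast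
  qed
qed

lemma projection_bergman:
  assumes "holomorphic2_on h Om" "borel_Lp p h" "z \<in> Om"
  shows "projection h z = h z"
  using reproducing[of h z] assms by (simp add: projection_def borel_Lp_def)

end

section \<open>Orthogonality, and identification with the abstract projection and its kernel\<close>

context hartogs_domain
begin

text \<open>Fubini moves the kernel onto h, where by Hermitian symmetry it acts as a reproducing
  kernel.\<close>

lemma projection_adjoint:
  assumes f: "borel_Lp 2 f" and h: "holomorphic2_on h Om" "borel_Lp p h"
  shows "(\<integral>z. projection f z * cnj (h z) \<partial>MM) = (\<integral>w. f w * cnj (h w) \<partial>MM)"
proof -
  have [measurable]: "f \<in> borel_measurable MM" "h \<in> borel_measurable MM" using f h by (auto simp: borel_Lp_def)
  have [measurable]: "(\<lambda>x. kernel (fst x) (snd x)) \<in> borel_measurable (MM \<Otimes>\<^sub>M MM)" using kernel_measurable2 by (simp add: case_prod_beta')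
  have h2: "borel_Lp 2 h" using borel_Lp_mono[OF h(2), of 2] p by simp
  \<comment> \<open>Square integrable by the bound for the absolute kernel; paired with h it yields
    the absolute convergence required by Fubini.\<close>
  define A where "A z = (\<integral>w. cmod (kernel z w) * cmod (f w) \<partial>MM)" for z
  have A2: "integrable MM (\<lambda>z. A z powr 2)" using kernel_abs_Lq[OF order_refl crit_exponent_two] f unfolding A_def by blast
  have mA: "A \<in> borel_measurable MM" unfolding A_def by (rule kernel_abs_measurable) simp
  have A0: "0 \<le> A z" for z unfolding A_def by (rule Bochner_Integration.integral_nonneg) simp
  have "borel_Lp 2 (\<lambda>z. of_real (A z))" unfolding borel_Lp_def using A2 A0 mA by simp
  from borel_Lp_mult[OF this h2] have "integrable MM (\<lambda>z. cmod (of_real (A z) * h z))" by (rule integrable_norm)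
  then have iA: "integrable MM (\<lambda>z. A z * cmod (h z))" using A0 by (simp add: norm_mult)
  have int: "integrable (MM \<Otimes>\<^sub>M MM) (\<lambda>(z, w). kernel z w * f w * cnj (h z))"
  proof (rule MMP.Fubini_integrable)
    show "(\<lambda>(z, w). kernel z w * f w * cnj (h z)) \<in> borel_measurable (MM \<Otimes>\<^sub>M MM)"
      unfolding case_prod_beta' by measurable
    have "(\<integral>w. norm (case (z, w) of (z, w) \<Rightarrow> kernel z w * f w * cnj (h z)) \<partial>MM) = A z * cmod (h z)" for z
      unfolding A_def by (simp add: norm_mult)
    then show "integrable MM (\<lambda>z. \<integral>w. norm (case (z, w) of (z, w) \<Rightarrow> kernel z w * f w * cnj (h z)) \<partial>MM)" using iA by simp
    show "AE z in MM. integrable MM (\<lambda>w. case (z, w) of (z, w) \<Rightarrow> kernel z w * f w * cnj (h z))"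
      using kernel_mult_integrable[OF f] by (intro AE_I2) simp
  qed
  have "(\<integral>z. projection f z * cnj (h z) \<partial>MM) = (\<integral>z. (\<integral>w. kernel z w * f w * cnj (h z) \<partial>MM) \<partial>MM)"
    by (rule Bochner_Integration.integral_cong[OF refl]) (simp add: projection_def)
  also have "\<dots> = (\<integral>w. (\<integral>z. kernel z w * f w * cnj (h z) \<partial>MM) \<partial>MM)"
    by (rule MMP.Fubini_integral[OF int, symmetric])
  also have "\<dots> = (\<integral>w. f w * cnj (h w) \<partial>MM)"
  proof (rule Bochner_Integration.integral_cong[OF refl])
    fix w assume "w \<in> space MM"
    then have w: "w \<in> Om" by simp
    have "(\<integral>z. kernel z w * f w * cnj (h z) \<partial>MM) = (\<integral>z. f w * cnj (kernel w z * h z) \<partial>MM)"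
      by (rule Bochner_Integration.integral_cong[OF refl]) (subst kernel_cnj, simp add: mult_ac)
    also have "\<dots> = f w * cnj (\<integral>z. kernel w z * h z \<partial>MM)" by (simp only: integral_mult_right_zero Bochner_Integration.integral_cnj)
    also have "(\<integral>z. kernel w z * h z \<partial>MM) = h w" using projection_bergman[OF h w] w by (simp add: projection_def)
    finally show "(\<integral>z. kernel z w * f w * cnj (h z) \<partial>MM) = f w * cnj (h w)" .
  qed
  finally show ?thesis .
qed

text \<open>For h in \<open>A^p\<close> this is \<open>projection_adjoint\<close>. Elements of the
  closure are reached by approximation, with a b \<le> \<delta> a^2 + b^2 / \<delta> in place of the
  Cauchy-Schwarz inequality.\<close>

lemma projection_orthogonal:
  assumes f: "borel_Lp 2 f" and h: "in_G2 h"
  shows "(\<integral>z. (f z - projection f z) * cnj (h z) \<partial>MM) = 0"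
proof -
  have LP: "borel_Lp 2 (projection f)" by (rule in_G2_LL[OF in_G2_PP[OF f]])
  define F where "F z = f z - projection f z" for z
  have F: "borel_Lp 2 F" unfolding F_def by (rule borel_Lp_diff[OF f LP]) simp
  define I where "I = (\<integral>z. F z * cnj (h z) \<partial>MM)"
  define B where "B = (\<integral>z. (cmod (F z))\<^sup>2 \<partial>MM)"
  have B0: "0 \<le> B" unfolding B_def by (rule Bochner_Integration.integral_nonneg) simp
  have "cmod I \<le> \<epsilon>" if e: "\<epsilon> > 0" for \<epsilon>
  proof -
    \<comment> \<open>Chosen so that \<delta> B \<le> \<epsilon> / 2; adding 1 avoids a division by
      0 when B = 0.\<close>
    define \<delta> where "\<delta> = \<epsilon> / (2 * (B + 1))"
    have \<delta>: "\<delta> > 0" using e B0 by (simp add: \<delta>_def)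
    have "\<delta> * \<epsilon> / 2 > 0" using \<delta> e by simp
    then obtain k where k: "holomorphic2_on k Om" "borel_Lp p k" "(\<integral>z. (cmod (h z - k z))\<^sup>2 \<partial>MM) < \<delta> * \<epsilon> / 2"
      using h unfolding in_G2_def by blast
    have k2: "borel_Lp 2 k" using borel_Lp_mono[OF k(2), of 2] p by simp
    have d: "borel_Lp 2 (\<lambda>z. h z - k z)" by (rule borel_Lp_diff[OF in_G2_LL[OF h] k2]) simp
    have i1: "integrable MM (\<lambda>z. f z * cnj (k z))" "integrable MM (\<lambda>z. projection f z * cnj (k z))"
      by (intro borel_Lp_mult borel_Lp_cnj f k2 LP)+
    have "(\<integral>z. F z * cnj (k z) \<partial>MM) = (\<integral>z. f z * cnj (k z) - projection f z * cnj (k z) \<partial>MM)" by (simp add: F_def left_diff_distrib)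
    also have "\<dots> = 0" using projection_adjoint[OF f k(1,2)] i1 by simp
    finally have Fk: "(\<integral>z. F z * cnj (k z) \<partial>MM) = 0" .
    have i2: "integrable MM (\<lambda>z. F z * cnj (h z))" "integrable MM (\<lambda>z. F z * cnj (k z))"
      by (intro borel_Lp_mult borel_Lp_cnj F k2 in_G2_LL[OF h])+
    have i3: "integrable MM (\<lambda>z. F z * cnj (h z - k z))" by (intro borel_Lp_mult borel_Lp_cnj F d)
    have "I = (\<integral>z. F z * cnj (h z) - F z * cnj (k z) \<partial>MM)" using i2 Fk by (simp add: I_def)
    also have "\<dots> = (\<integral>z. F z * cnj (h z - k z) \<partial>MM)" by (simp add: right_diff_distrib)
    finally have "cmod I \<le> (\<integral>z. norm (F z * cnj (h z - k z)) \<partial>MM)" by (simp add: integral_norm_bound)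
    also have "\<dots> \<le> (\<integral>z. \<delta> * (cmod (F z))\<^sup>2 + (1 / \<delta>) * (cmod (h z - k z))\<^sup>2 \<partial>MM)"
    proof (rule integral_mono)
      show "integrable MM (\<lambda>z. norm (F z * cnj (h z - k z)))" by (rule integrable_norm[OF i3])
      show "integrable MM (\<lambda>z. \<delta> * (cmod (F z))\<^sup>2 + (1 / \<delta>) * (cmod (h z - k z))\<^sup>2)"
        using borel_Lp_integrable_2[OF F] borel_Lp_integrable_2[OF d] by simp
      fix z
      define a where "a = cmod (F z)"
      define b where "b = cmod (h z - k z)"
      have "0 \<le> (\<delta> * a - b)\<^sup>2" by simp
      then have "2 * (\<delta> * a * b) \<le> \<delta>\<^sup>2 * a\<^sup>2 + b\<^sup>2" by (simp add: power2_diff power_mult_distrib mult_ac)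
      moreover have "0 \<le> \<delta> * a * b" using \<delta> by (simp add: a_def b_def)
      ultimately have "\<delta> * (a * b) \<le> \<delta> * (\<delta> * a\<^sup>2 + 1 / \<delta> * b\<^sup>2)" using \<delta> by (simp add: algebra_simps power2_eq_square)
      then have "a * b \<le> \<delta> * a\<^sup>2 + 1 / \<delta> * b\<^sup>2" by (rule mult_left_le_imp_le[OF _ \<delta>])
      then show "norm (F z * cnj (h z - k z)) \<le> \<delta> * (cmod (F z))\<^sup>2 + (1 / \<delta>) * (cmod (h z - k z))\<^sup>2"
        unfolding norm_mult complex_mod_cnj a_def b_def .
    qed
    also have "\<dots> = \<delta> * B + (1 / \<delta>) * (\<integral>z. (cmod (h z - k z))\<^sup>2 \<partial>MM)"
      using borel_Lp_integrable_2[OF F] borel_Lp_integrable_2[OF d] by (simp add: B_def)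
    also have "\<dots> \<le> \<epsilon> / 2 + (1 / \<delta>) * (\<delta> * \<epsilon> / 2)"
    proof (intro add_mono mult_left_mono)
      show "\<delta> * B \<le> \<epsilon> / 2" using B0 e by (simp add: \<delta>_def field_simps)
    qed (use k(3) \<delta> in auto)
    also have "\<dots> = \<epsilon>" using \<delta> by simp
    finally show ?thesis .
  qed
  then have "cmod I \<le> 0" by (meson field_le_epsilon add_0 dense_ge)
  then show ?thesis by (simp add: I_def F_def)
qed

text \<open>The set where a continuous function on the open domain is nonzero is open, and a
  nonempty open set is not negligible.\<close>

lemma AE_zero_imp_zero:
  assumes k: "continuous_on Om k" and ae: "AE w in MM. k w = (0 :: complex)" and w: "w \<in> Om"
  shows "k w = 0"
proof -
  let ?S = "Om \<inter> k -` (- {0})"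
  have S: "open ?S" by (rule continuous_open_preimage[OF k open_Om]) auto
  have "AE w in lborel. w \<in> Om \<longrightarrow> k w = 0" using ae by (subst (asm) AE_restrict_space_iff) auto
  then have "AE w in lborel. w \<notin> ?S" by eventually_elim auto
  then have "?S \<in> null_sets lborel" using S by (subst AE_iff_null_sets) auto
  then have "negligible ?S" by (simp add: negligible_iff_null_sets null_sets_completionI)
  then have "?S = {}" using S open_not_negligible by blast
  then show ?thesis using w by auto
qed

lemma in_G2_eq_0:
  assumes k: "in_G2 k" and z: "(\<integral>w. k w * cnj (k w) \<partial>MM) = 0" and w: "w \<in> Om"
  shows "k w = 0"
proof (rule AE_zero_imp_zero[OF holomorphic2_on_imp_continuous_on[OF in_G2_hol[OF k]] _ w])
  have i: "integrable MM (\<lambda>w. (cmod (k w))\<^sup>2)" by (rule borel_Lp_integrable_2[OF in_G2_LL[OF k]])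
  have "complex_of_real (\<integral>w. (cmod (k w))\<^sup>2 \<partial>MM) = (\<integral>w. k w * cnj (k w) \<partial>MM)"
    unfolding integral_complex_of_real[symmetric] by (simp only: complex_norm_square)
  then have "(\<integral>w. (cmod (k w))\<^sup>2 \<partial>MM) = 0" using z by simp
  then have "AE w in MM. (cmod (k w))\<^sup>2 = 0" using integral_nonneg_eq_0_iff_AE[OF i] by simp
  then show "AE w in MM. k w = 0" by simp
qed

lemma integral_lebesgue_version:
  fixes f f' g k :: "complex \<times> complex \<Rightarrow> complex"
  assumes f: "f \<in> borel_measurable (lebesgue_on Om)" and f': "f' \<in> borel_measurable MM"
    and ae: "AE x in lebesgue_on Om. f x = f' x" 
    and g: "g \<in> borel_measurable MM" and k: "k \<in> borel_measurable MM"
  shows "(\<integral>z. (f z - g z) * k z \<partial>lebesgue_on Om) = (\<integral>z. (f' z - g z) * k z \<partial>MM)"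
    and "(\<integral>z. k z * f z \<partial>lebesgue_on Om) = (\<integral>z. k z * f' z \<partial>MM)"
    and "integrable MM (\<lambda>z. k z * f' z) \<Longrightarrow> integrable (lebesgue_on Om) (\<lambda>z. k z * f z)"
proof -
  have m1: "(\<lambda>z. (f' z - g z) * k z) \<in> borel_measurable MM" and m2: "(\<lambda>z. k z * f' z) \<in> borel_measurable MM"
    by (intro borel_measurable_times borel_measurable_diff f' g k)+
  have ae2: "AE z in lebesgue_on Om. k z * f' z = k z * f z" using ae by eventually_elim simp
  have "(\<integral>z. (f z - g z) * k z \<partial>lebesgue_on Om) = (\<integral>z. (f' z - g z) * k z \<partial>lebesgue_on Om)"
  proof (rule integral_cong_AE)
    show "AE z in lebesgue_on Om. (f z - g z) * k z = (f' z - g z) * k z" using ae by eventually_elim simp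
    show "(\<lambda>z. (f z - g z) * k z) \<in> borel_measurable (lebesgue_on Om)"
      by (intro borel_measurable_times borel_measurable_diff f lebesgue_on_Om(1) g k)
    show "(\<lambda>z. (f' z - g z) * k z) \<in> borel_measurable (lebesgue_on Om)" by (rule lebesgue_on_Om(1)[OF m1])
  qed
  then show "(\<integral>z. (f z - g z) * k z \<partial>lebesgue_on Om) = (\<integral>z. (f' z - g z) * k z \<partial>MM)"
    using lebesgue_on_Om(3)[OF m1] by simp
  have mkf: "(\<lambda>z. k z * f z) \<in> borel_measurable (lebesgue_on Om)"
    by (intro borel_measurable_times f lebesgue_on_Om(1) k)
  have "(\<integral>z. k z * f z \<partial>lebesgue_on Om) = (\<integral>z. k z * f' z \<partial>lebesgue_on Om)"
    by (rule integral_cong_AE[OF mkf lebesgue_on_Om(1)[OF m2]]) (use ae in \<open>eventually_elim, simp\<close>)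
  then show "(\<integral>z. k z * f z \<partial>lebesgue_on Om) = (\<integral>z. k z * f' z \<partial>MM)"
    using lebesgue_on_Om(3)[OF m2] by simp
  assume "integrable MM (\<lambda>z. k z * f' z)"
  then have "integrable (lebesgue_on Om) (\<lambda>z. k z * f' z)" by (rule lebesgue_on_Om(2)[OF m2, THEN iffD2])
  then show "integrable (lebesgue_on Om) (\<lambda>z. k z * f z)" by (rule integrable_cong_AE_imp[OF _ mkf ae2])
qed

text \<open>Any competitor differs from \<open>projection f'\<close> by an element of
  \<open>G2\<close> that is orthogonal to itself, so the two agree on the domain; outside both
  vanish.\<close>

lemma sub_bergman_proj_eq:
  assumes f: "f \<in> borel_measurable (lebesgue_on Om)" and f': "borel_Lp 2 f'" and ae: "AE x in lebesgue_on Om. f x = f' x"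
  shows "sub_bergman_proj Om p f = projection f'"
  unfolding sub_bergman_proj_def
proof (rule the_equality)
  note iv = integral_lebesgue_version(1)[OF f borel_Lp_measurable[OF f'] ae]
  have conv: "(\<integral>z. (f z - g z) * cnj (h z) \<partial>lebesgue_on Om) = (\<integral>z. (f' z - g z) * cnj (h z) \<partial>MM)" if "in_G2 g" "in_G2 h" for g h
    by (rule iv) (use that in \<open>auto intro!: borel_Lp_measurable borel_Lp_cnj dest: in_G2_LL\<close>)
  have P: "in_G2 (projection f')" by (rule in_G2_PP[OF f'])
  show "projection f' \<in> G2 Om p \<and> (\<forall>z. z \<notin> Om \<longrightarrow> projection f' z = 0) \<and> (\<forall>h\<in>G2 Om p. (\<integral>z. (f z - projection f' z) * cnj (h z) \<partial>lebesgue_on Om) = 0)"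
    using P conv[OF P] projection_orthogonal[OF f'] by (auto simp: G2_iff projection_def)
  fix g assume g: "g \<in> G2 Om p \<and> (\<forall>z. z \<notin> Om \<longrightarrow> g z = 0) \<and> (\<forall>h\<in>G2 Om p. (\<integral>z. (f z - g z) * cnj (h z) \<partial>lebesgue_on Om) = 0)"
  then have G: "in_G2 g" by (simp add: G2_iff)
  define k where "k z = projection f' z - g z" for z
  have k: "in_G2 k" unfolding k_def by (rule in_G2_diff[OF P G])
  have 1: "(\<integral>z. (f' z - g z) * cnj (k z) \<partial>MM) = 0" using g k conv[OF G k] by (auto simp: G2_iff)
  have 2: "(\<integral>z. (f' z - projection f' z) * cnj (k z) \<partial>MM) = 0" by (rule projection_orthogonal[OF f' k])
  have i: "integrable MM (\<lambda>z. (f' z - g z) * cnj (k z))" "integrable MM (\<lambda>z. (f' z - projection f' z) * cnj (k z))"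
    by (intro borel_Lp_mult borel_Lp_cnj borel_Lp_diff f' in_G2_LL P G k; simp)+
  have "(\<integral>z. k z * cnj (k z) \<partial>MM) = (\<integral>z. (f' z - g z) * cnj (k z) - (f' z - projection f' z) * cnj (k z) \<partial>MM)"
    by (rule Bochner_Integration.integral_cong[OF refl]) (simp add: k_def algebra_simps)
  also have "\<dots> = 0" using i 1 2 by simp
  finally have "k z = 0" if "z \<in> Om" for z using in_G2_eq_0[OF k _ that] by simp
  then show "g = projection f'" using g by (intro ext) (metis projection_def eq_iff_diff_eq_0 k_def)
qed

text \<open>The conjugate of \<open>kernel z\<close> is holomorphic and, by
  \<open>kernel_bound'\<close> and \<open>crit_exponent_gt\<close>, p-th power integrable, so it
  lies in \<open>G2\<close>. A second representing kernel is excluded by testing both on their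
  conjugated difference.\<close>

lemma sub_bergman_kernel_eq:
  assumes z: "z \<in> Om"
  shows "sub_bergman_kernel Om p z = (\<lambda>w. if w \<in> Om then kernel z w else 0)"
  unfolding sub_bergman_kernel_def
proof (rule the_equality)
  let ?k = "\<lambda>w. if w \<in> Om then kernel z w else 0"
  have mk: "?k \<in> borel_measurable MM"
    by (rule measurable_cong[THEN iffD1, OF _ kernel_measurable[of z]]) simp
  have hol: "holomorphic2_on (\<lambda>w. cnj (?k w)) Om"
    by (rule holomorphic2_on_cong[OF kernel_hol[OF z]]) (simp add: kernel_cnj[of _ z])
  have "borel_Lp p (\<lambda>w. cnj (?k w))"
    unfolding borel_Lp_def
  proof
    show m: "(\<lambda>w. cnj (?k w)) \<in> borel_measurable MM" by (rule measurable_compose[OF mk borel_cnj])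
    show "integrable MM (\<lambda>w. cmod (cnj (?k w)) powr p)"
    proof (rule Bochner_Integration.integrable_bound)
      show "integrable MM (\<lambda>w. kernel_growth z powr p * cmod (snd w) powr (p * crit_exponent))"
        using integrable_snd_powr[OF crit_exponent_gt] by simp
      show "AE w in MM. norm (cmod (cnj (?k w)) powr p) \<le> norm (kernel_growth z powr p * cmod (snd w) powr (p * crit_exponent))"
      proof (intro AE_I2)
        fix w assume "w \<in> space MM"
        then have w: "w \<in> Om" by simp
        have "cmod (kernel z w) powr p \<le> (kernel_growth z * cmod (snd w) powr crit_exponent) powr p"
          using kernel_bound'[OF z w] p by (intro powr_mono2) auto
        also have "\<dots> = kernel_growth z powr p * cmod (snd w) powr (p * crit_exponent)" by (simp add: powr_mult powr_powr mult.commute)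
        finally show "norm (cmod (cnj (?k w)) powr p) \<le> norm (kernel_growth z powr p * cmod (snd w) powr (p * crit_exponent))" using w by simp
      qed
    qed (rule borel_Lp_powr_measurable[OF m])
  qed
  then have Gk: "in_G2 (\<lambda>w. cnj (?k w))" by (rule in_G2_I_bergman[OF hol])
  have rep: "sub_bergman_proj Om p f z = (\<integral>w. ?k w * f w \<partial>lebesgue_on Om)" if f: "f \<in> Lp Om 2" for f
  proof -
    obtain f' where f': "borel_Lp 2 f'" "AE x in lebesgue_on Om. f x = f' x" using Lp_borel_version[OF f] by blast
    have mf: "f \<in> borel_measurable (lebesgue_on Om)" using f by (simp add: Lp_def)
    have "sub_bergman_proj Om p f z = (\<integral>w. kernel z w * f' w \<partial>MM)"
      unfolding sub_bergman_proj_eq[OF mf f'] using z by (simp add: projection_def)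
    also have "\<dots> = (\<integral>w. ?k w * f' w \<partial>MM)" by (rule Bochner_Integration.integral_cong[OF refl]) simp
    also have "\<dots> = (\<integral>w. ?k w * f w \<partial>lebesgue_on Om)"
      by (rule integral_lebesgue_version(2)[OF mf borel_Lp_measurable[OF f'(1)] f'(2) mk mk, symmetric])
    finally show ?thesis .
  qed
  show "(\<lambda>w. cnj (?k w)) \<in> G2 Om p \<and> (\<forall>w. w \<notin> Om \<longrightarrow> ?k w = 0) \<and> (\<forall>f\<in>Lp Om 2. sub_bergman_proj Om p f z = (\<integral>w. ?k w * f w \<partial>lebesgue_on Om))"
    using Gk rep by (simp add: G2_iff)
  fix k assume k: "(\<lambda>w. cnj (k w)) \<in> G2 Om p \<and> (\<forall>w. w \<notin> Om \<longrightarrow> k w = 0) \<and> (\<forall>f\<in>Lp Om 2. sub_bergman_proj Om p f z = (\<integral>w. k w * f w \<partial>lebesgue_on Om))"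
  then have G: "in_G2 (\<lambda>w. cnj (k w))" by (simp add: G2_iff)
  \<comment> \<open>The test function: on the domain the difference of the two kernels is the
    conjugate of d, so equality of the two representations at d says that d has norm 0.\<close>
  define d where "d w = cnj (k w) - cnj (?k w)" for w
  have d: "in_G2 d" unfolding d_def by (rule in_G2_diff[OF G Gk])
  have Ld: "borel_Lp 2 d" by (rule in_G2_LL[OF d])
  have Lk: "borel_Lp 2 k" using borel_Lp_cnj[OF in_G2_LL[OF G]] by simp
  have Lkk: "borel_Lp 2 ?k" using borel_Lp_cnj[OF in_G2_LL[OF Gk]] by simp
  have i: "integrable MM (\<lambda>w. k w * d w)" "integrable MM (\<lambda>w. ?k w * d w)" by (intro borel_Lp_mult Lk Lkk Ld)+
  have "(\<integral>w. k w * d w \<partial>lebesgue_on Om) = (\<integral>w. ?k w * d w \<partial>lebesgue_on Om)"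
    using k rep[OF borel_Lp_imp_Lp[OF Ld]] borel_Lp_imp_Lp[OF Ld] by auto
  then have "(\<integral>w. k w * d w \<partial>MM) = (\<integral>w. ?k w * d w \<partial>MM)"
    using lebesgue_on_Om(3)[OF borel_measurable_integrable[OF i(1)]] lebesgue_on_Om(3)[OF borel_measurable_integrable[OF i(2)]] by simp
  then have "(\<integral>w. k w * d w - ?k w * d w \<partial>MM) = 0" using i by (subst Bochner_Integration.integral_diff) auto
  then have "(\<integral>w. d w * cnj (d w) \<partial>MM) = 0" by (simp add: d_def algebra_simps)
  then have "d w = 0" if "w \<in> Om" for w using in_G2_eq_0[OF d _ that] by simp
  moreover have "k w = 0" if "w \<notin> Om" for w using k that by blast
  ultimately have "k w = ?k w" for w by (cases "w \<in> Om") (simp_all add: d_def)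
  then show "k = ?k" by blast
qed

lemma abs_kernel_measurable:
  "(\<lambda>w. complex_of_real (cmod (if w \<in> Om then kernel z w else 0))) \<in> borel_measurable MM"
proof -
  have "(\<lambda>w. complex_of_real (cmod (kernel z w))) \<in> borel_measurable MM" using kernel_measurable[of z] by auto
  then show ?thesis by (rule measurable_cong[THEN iffD1, rotated]) simp
qed

text \<open>The integrability clause certifies that the values of the absolute operator are
  convergent integrals and not the default 0 of a divergent Bochner integral. Boundedness and the
  mapping property both come from \<open>borel_Lp_majorized\<close> at exponent p, the identity on
  \<open>A^p\<close> from \<open>reproducing\<close>.\<close>

theorem sub_bergman_Lp_regularity:
  "(\<forall>f\<in>Lp Om p. sub_bergman_proj Om p f \<in> bergman_space Om p)
    \<and> ((\<forall>f\<in>Lp Om p. \<forall>z\<in>Om. integrable (lebesgue_on Om) (\<lambda>w. of_real (cmod (sub_bergman_kernel Om p z w)) * f w))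
        \<and> bounded_on_Lp Om p (abs_sub_bergman_op Om p))
    \<and> (\<forall>h\<in>bergman_space Om p. \<forall>z\<in>Om. sub_bergman_proj Om p h z = h z)"
proof (intro conjI ballI)
  fix f assume f: "f \<in> Lp Om p"
  obtain f' where f': "borel_Lp p f'" "AE x in lebesgue_on Om. f x = f' x" using Lp_borel_version[OF f] by blast
  have mf: "f \<in> borel_measurable (lebesgue_on Om)" using f by (simp add: Lp_def)
  have f2: "borel_Lp 2 f'" using borel_Lp_mono[OF f'(1), of 2] p by simp
  show "sub_bergman_proj Om p f \<in> bergman_space Om p"
    unfolding sub_bergman_proj_eq[OF mf f2 f'(2)] bergman_iff
    using projection_hol[OF f'(1) p] projection_LL[OF f'(1) p crit_exponent_gt] by simp
  fix z assume z: "z \<in> Om"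
  have "integrable MM (\<lambda>w. of_real (cmod (if w \<in> Om then kernel z w else 0)) * f' w)"
  proof (rule integrable_mult_kap[OF borel_Lp_measurable[OF f'(1)] abs_kernel_measurable _ p])
    show "cmod (complex_of_real (cmod (if w \<in> Om then kernel z w else 0))) \<le> kernel_growth z * cmod (snd w) powr crit_exponent" if "w \<in> Om" for w
      using kernel_bound'[OF z that] that by simp
  qed (use f' in \<open>simp add: borel_Lp_def\<close>)
  then show "integrable (lebesgue_on Om) (\<lambda>w. of_real (cmod (sub_bergman_kernel Om p z w)) * f w)"
    unfolding sub_bergman_kernel_eq[OF z]
    by (rule integral_lebesgue_version(3)[OF mf borel_Lp_measurable[OF f'(1)] f'(2) abs_kernel_measurable abs_kernel_measurable])
next
  fix h z assume h: "h \<in> bergman_space Om p" and z: "z \<in> Om"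
  then have hh: "holomorphic2_on h Om" "borel_Lp p h" by (auto simp: bergman_iff)
  have mf: "h \<in> borel_measurable (lebesgue_on Om)" by (rule lebesgue_on_Om(1)[OF borel_Lp_measurable[OF hh(2)]])
  have "sub_bergman_proj Om p h = projection h"
    by (rule sub_bergman_proj_eq[OF mf]) (use borel_Lp_mono[OF hh(2), of 2] p in auto)
  then show "sub_bergman_proj Om p h z = h z" using projection_bergman[OF hh z] by simp
next
  obtain C where C: "C > 0" and b: "\<And>f F. borel_Lp p f \<Longrightarrow> F \<in> borel_measurable MM \<Longrightarrow> (\<forall>z\<in>Om. cmod (F z) \<le> (\<integral>w. cmod (kernel z w) * cmod (f w) \<partial>MM)) \<Longrightarrow>
    borel_Lp p F \<and> (\<integral>z. cmod (F z) powr p \<partial>MM) \<le> C * (\<integral>z. cmod (f z) powr p \<partial>MM)"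
    using borel_Lp_majorized[OF p crit_exponent_gt] by blast
  show "bounded_on_Lp Om p (abs_sub_bergman_op Om p)"
    unfolding bounded_on_Lp_def
  proof (intro exI ballI)
    fix f assume f: "f \<in> Lp Om p"
    obtain f' where f': "borel_Lp p f'" "AE x in lebesgue_on Om. f x = f' x" "Lp_norm Om p f = Lp_norm Om p f'" using Lp_borel_version[OF f] by blast
    have mf: "f \<in> borel_measurable (lebesgue_on Om)" using f by (simp add: Lp_def)
    note [measurable] = borel_Lp_measurable[OF f'(1)]
    define T where "T = abs_sub_bergman_op Om p f"
    \<comment> \<open>The operator applied to the Borel representative, measurable as a parameter
      integral; agreement on the domain passes measurability on to \<open>T\<close>.\<close>
    define F where "F z = (\<integral>w. of_real (cmod (kernel z w)) * f' w \<partial>MM)" for z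
    have mF: "F \<in> borel_measurable MM" unfolding F_def
    proof (rule MM.borel_measurable_lebesgue_integral)
      have [measurable]: "(\<lambda>x. kernel (fst x) (snd x)) \<in> borel_measurable (MM \<Otimes>\<^sub>M MM)" using kernel_measurable2 by (simp add: case_prod_beta')
      show "(\<lambda>(z, w). complex_of_real (cmod (kernel z w)) * f' w) \<in> borel_measurable (MM \<Otimes>\<^sub>M MM)"
        unfolding case_prod_beta' by measurable
    qed
    have TF: "T z = F z" if z: "z \<in> Om" for z
    proof -
      have "T z = (\<integral>w. of_real (cmod (if w \<in> Om then kernel z w else 0)) * f' w \<partial>MM)"
        unfolding T_def abs_sub_bergman_op_def sub_bergman_kernel_eq[OF z]
        by (rule integral_lebesgue_version(2)[OF mf borel_Lp_measurable[OF f'(1)] f'(2) abs_kernel_measurable abs_kernel_measurable])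
      also have "\<dots> = F z" unfolding F_def by (rule Bochner_Integration.integral_cong[OF refl]) simp
      finally show ?thesis .
    qed
    have mT: "T \<in> borel_measurable MM"
      by (rule measurable_cong[THEN iffD1, OF _ mF]) (simp add: TF)
    have "\<forall>z\<in>Om. cmod (T z) \<le> (\<integral>w. cmod (kernel z w) * cmod (f' w) \<partial>MM)"
      using integral_norm_bound[of MM "\<lambda>w. of_real (cmod (kernel z w)) * f' w" for z] by (simp add: TF F_def norm_mult)
    from b[OF f'(1) mT this] have LT: "borel_Lp p T" and le: "(\<integral>z. cmod (T z) powr p \<partial>MM) \<le> C * (\<integral>z. cmod (f' z) powr p \<partial>MM)" by auto
    have "Lp_norm Om p T = (\<integral>z. cmod (T z) powr p \<partial>MM) powr (1 / p)" by (rule borel_Lp_Lp_norm[OF LT])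
    also have "\<dots> \<le> (C * (\<integral>z. cmod (f' z) powr p \<partial>MM)) powr (1 / p)"
      using p by (intro powr_mono2 le Bochner_Integration.integral_nonneg) auto
    also have "\<dots> = C powr (1 / p) * Lp_norm Om p f" unfolding powr_mult f'(3) borel_Lp_Lp_norm[OF f'(1)] ..
    finally show "abs_sub_bergman_op Om p f \<in> Lp Om p \<and> Lp_norm Om p (abs_sub_bergman_op Om p f) \<le> C powr (1 / p) * Lp_norm Om p f"
      using borel_Lp_imp_Lp[OF LT] by (simp add: T_def)
  qed
qed

end

theorem theorem4p3:
  fixes m n :: nat and p :: real
  assumes "m > 0" and "n > 0" and "coprime m n" and "2 \<le> p"
  shows "(\<forall>f\<in>Lp (hartogs m n) p. sub_bergman_proj (hartogs m n) p f \<in> bergman_space (hartogs m n) p)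
    \<and> ((\<forall>f\<in>Lp (hartogs m n) p. \<forall>z\<in>hartogs m n. integrable (lebesgue_on (hartogs m n))
            (\<lambda>w. of_real (cmod (sub_bergman_kernel (hartogs m n) p z w)) * f w))
        \<and> bounded_on_Lp (hartogs m n) p (abs_sub_bergman_op (hartogs m n) p))
    \<and> (\<forall>h\<in>bergman_space (hartogs m n) p. \<forall>z\<in>hartogs m n. sub_bergman_proj (hartogs m n) p h z = h z)"
proof -
  interpret hartogs_domain m n p using assms by unfold_locales
  show ?thesis by (rule sub_bergman_Lp_regularity)
qed

end
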